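(* Let $k\geqslant1$ be fixed and let $f$ be a multiplicative function on $S_n$ with $|\hat f(j)|\leqslant1$ for all $j$. Then for $p>1/\beta$, $$\mathbf M_n^{(k)}f=\exp\Big\{\sum_{\substack{1\leqslant j\leqslant n\\(j,k)=1}}\frac{\hat f(j)-1}{j}\Big\}\prod_{\substack{j\leqslant n\\(j,k)>1}}\frac{1+\sum_{s\geqslant1:\,q_k(j)\mid s}\frac{\hat f(j)^s}{j^ss!}}{1+\sum_{s\geqslant1:\,q_k(j)\mid s}\frac{1}{j^ss!}}+O\Big(\mu_n(p)+\frac1{n^\beta}\Big),$$ where $\beta=\phi(k)/k$ if $k$ is prime, and $\beta=\min_{d\mid k,\,d>1}\frac{\phi(k)}{k}\Big(1-\mu(d)\prod_{p\mid d}\frac1{p-1}\Big)$ if $k$ is composite.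
   Context: $S_n^{(k)}=\{x^k:x\in S_n\}$ and $\mathbf M_n^{(k)}f=|S_n^{(k)}|^{-1}\sum_{\sigma\in S_n^{(k)}}f(\sigma)$. A function $f$ on $S_n$ is multiplicative if it is the product over the cycles of $\sigma$ of values $\hat f(j)$ depending only on the cycle length $j$. If $k=\prod_p p^{l_k(p)}$, then $q_k(j)=\prod_{p\mid(k,j)}p^{l_k(p)}$. $\mu_n(p)=\big(\frac1n\sum_{1\leqslant j\leqslant n,(j,k)=1}|\hat f(j)-1|^p\big)^{1/p}$. $\phi$ is Euler's totient function and $\mu$ the Möbius function. The implied constant may depend on $k$ and $p$. *)

theory Defs
  imports
    "HOL-Analysis.Analysis"
    "HOL-Combinatorics.Orbits"
    "HOL-Computational_Algebra.Squarefree"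
    "HOL-Number_Theory.Totient"
begin

definition sym_group_powers :: "nat \<Rightarrow> nat \<Rightarrow> (nat \<Rightarrow> nat) set" where
  "sym_group_powers k n = {x ^^ k | x. x permutes {1..n}}"

definition mean_on_powers :: "nat \<Rightarrow> nat \<Rightarrow> ((nat \<Rightarrow> nat) \<Rightarrow> complex) \<Rightarrow> complex" where
  "mean_on_powers k n f =
     (\<Sum>\<sigma>\<in>sym_group_powers k n. f \<sigma>) / of_nat (card (sym_group_powers k n))"

text \<open>The cycles of a permutation are its orbits; fixed points are cycles of length 1.\<close>

definition perm_cycles :: "nat \<Rightarrow> (nat \<Rightarrow> nat) \<Rightarrow> nat set set" where
  "perm_cycles n \<sigma> = orbit \<sigma> ` {1..n}"

definition multiplicative_on_perms ::
    "nat \<Rightarrow> ((nat \<Rightarrow> nat) \<Rightarrow> complex) \<Rightarrow> (nat \<Rightarrow> complex) \<Rightarrow> bool" where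
  "multiplicative_on_perms n f fhat \<longleftrightarrow>
     (\<forall>\<sigma>. \<sigma> permutes {1..n} \<longrightarrow> f \<sigma> = (\<Prod>C\<in>perm_cycles n \<sigma>. fhat (card C)))"

definition q_part :: "nat \<Rightarrow> nat \<Rightarrow> nat" where
  "q_part k j = (\<Prod>p\<in>prime_factors (gcd k j). p ^ multiplicity p k)"

definition mu_dist :: "nat \<Rightarrow> nat \<Rightarrow> real \<Rightarrow> (nat \<Rightarrow> complex) \<Rightarrow> real" where
  "mu_dist k n p fhat =
     ((\<Sum>j | j \<in> {1..n} \<and> coprime j k. cmod (fhat j - 1) powr p) / real n) powr (1 / p)"

definition moebius :: "nat \<Rightarrow> int" where
  "moebius d = (if squarefree d then (-1) ^ card (prime_factors d) else 0)"

text \<open>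
  The two cases of the exponent are k prime and k composite. For k = 1, which is neither,
  the minimum would range over the empty set; the first formula is used there and gives 1.
\<close>

definition beta_exp :: "nat \<Rightarrow> real" where
  "beta_exp k =
     (if k = 1 \<or> prime k then real (totient k) / real k
      else Min ((\<lambda>d. real (totient k) / real k *
                   (1 - of_int (moebius d) * (\<Prod>p\<in>prime_factors d. 1 / (real p - 1))))
                ` {d. d dvd k \<and> d > 1}))"

end

theory Submission
  imports
    Defs
    "HOL-Complex_Analysis.Complex_Analysis"
    "HOL-Computational_Algebra.Fundamental_Theorem_Algebra"
begin

text \<open>
  A permutation is a \<open>k\<close>-th power iff the number of its cycles of length \<open>j\<close> is always divisible
  by \<open>q_part k j\<close>. Hence the sum of \<open>f\<close> over the \<open>k\<close>-th powers is \<open>n!\<close> times a coefficient of a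
  product: the exponential of \<open>\<Sum> fhat j z\<^sup>j / j\<close> over \<open>j\<close> coprime to \<open>k\<close>, and factors for the
  remaining \<open>j\<close> whose product has coefficients \<open>O(m powr -2)\<close> and is therefore evaluated at \<open>1\<close>.

  Write the exponential as \<open>B R\<close>, where \<open>B\<close> belongs to \<open>fhat = 1\<close> and \<open>R\<close> is the exponential of
  the polynomial with coefficients \<open>(fhat j - 1) / j\<close>. Then \<open>B\<close> is a product of powers
  \<open>(1 - z / \<xi>) powr - gam \<xi>\<close> over the \<open>k\<close>-th roots of unity \<open>\<xi>\<close>, with Ramanujan sums as exponents;
  at \<open>\<xi> = 1\<close> the exponent is \<open>\<phi>(k) / k\<close> and everywhere else it is smaller by at least
  \<open>beta_exp k\<close>. The \<open>n\<close>-th coefficients of \<open>B R\<close> and of \<open>n powr -N\<close> times \<open>(z d/dz)\<^sup>N B\<close> times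
  \<open>R\<close> differ by an admissible error, because the logarithmic derivative of \<open>R\<close> has
  coefficients \<open>fhat j - 1\<close>. The smoothed coefficient is compared with \<open>R(1)\<close> times that of \<open>B\<close> by
  Cauchy's formula on the circle of radius \<open>1 - 1 / n\<close>. Near another root of unity \<open>\<xi>\<close> one
  only knows that \<open>R\<close> is \<open>O((1 + n \<mu>\<^sup>p) powr (gam 1 - gam \<xi>))\<close>, which is where \<open>p \<ge> 1 / beta_exp k\<close>
  is used.
\<close>

subsection \<open>Permutations, cycles and exponential coefficients\<close>

text \<open>R is controlled only by growth bounds such as |R(z)| <= (1 + n |1 - z|)^4, so Cauchy's
  formula for B R itself would not concentrate near the singularities. Each z d/dz applied to B
  sharpens them by one power, and eight powers are needed: four for the growth of R, one for the
  factor n |1 - z| gained from comparing R(z) with R(1), two to leave an integrable inverse square,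
  and one to absorb the exponents \<open>gam\<close>, which lie between -1 and 1. What makes the
  bounds uniform in \<open>fhat\<close> is the inequality |chi j + d j| <= chi j, where d j is fhat
  j - 1 for j coprime to k and 0 otherwise: the weights of B R are dominated by those of B. The mean
  value is a quotient of two coefficients, one for \<open>fhat\<close> and one for
  \<open>fhat = 1\<close>. The error must therefore be small relative to the coefficient of B, and a
  lower bound of the true order n powr (dens k - 1) is required. It comes from a lower bound for the
  partial sums and from the comparison itself in the case d = 0, which shows that neighbouring
  coefficients of B are nearly equal.\<close>

fun ecoef :: "(nat \<Rightarrow> 'a::field_char_0) \<Rightarrow> nat \<Rightarrow> 'a" where
  "ecoef x 0 = 1"
| "ecoef x (Suc n) = (\<Sum>j\<le>n. x (Suc j) * ecoef x (n - j)) / of_nat (Suc n)"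

text \<open>This is exp of the sum of \<open>x j\<close> X^j / j. The recursion in
  \<open>ecoef\<close> compares coefficients in X F' = (sum of \<open>x j\<close> X^j) F, so neither
  composition of series nor convergence is involved.\<close>

definition efps :: "(nat \<Rightarrow> 'a::field_char_0) \<Rightarrow> 'a fps" where
  "efps x = Abs_fps (ecoef x)"

definition afps :: "(nat \<Rightarrow> 'a::field_char_0) \<Rightarrow> 'a fps" where
  "afps x = Abs_fps (\<lambda>j. if j = 0 then 0 else x j)"

lemma efps_nth [simp]: "fps_nth (efps x) n = ecoef x n"
  by (simp add: efps_def)

lemma afps_nth: "fps_nth (afps x) n = (if n = 0 then 0 else x n)"
  by (simp add: afps_def)

lemma afps_mult_nth:
  "fps_nth (afps x * G) n = (\<Sum>j=1..n. x j * fps_nth G (n - j))"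
proof -
  have "fps_nth (afps x * G) n = (\<Sum>j=0..n. fps_nth (afps x) j * fps_nth G (n - j))"
    by (simp add: fps_mult_nth)
  also have "\<dots> = (\<Sum>j=1..n. x j * fps_nth G (n - j))"
    by (rule sum.mono_neutral_cong_right) (auto simp: afps_nth)
  finally show ?thesis .
qed

lemma ecoef_rec: "of_nat n * ecoef x n = (\<Sum>j=1..n. x j * ecoef x (n - j))"
proof (cases n)
  case (Suc m)
  have "(\<Sum>j\<le>m. x (Suc j) * ecoef x (m - j)) = (\<Sum>j=1..Suc m. x j * ecoef x (Suc m - j))"
    by (rule sum.reindex_bij_witness[of _ "\<lambda>j. j - 1" Suc]) auto
  then show ?thesis using Suc by (simp del: of_nat_Suc)
qed simp

lemma XD_efps: "fps_XD (efps x) = afps x * efps x"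
  by (rule fps_ext) (simp only: fps_XD_nth efps_nth afps_mult_nth ecoef_rec)

text \<open>\<open>afps x\<close> has no constant term, so the equation expresses n times the n-th
  coefficient through earlier ones. The later identifications of a series as an exponential, formal
  or analytic, rest on this differential equation.\<close>

lemma efps_unique:
  assumes "fps_XD F = afps x * F" "fps_nth F 0 = 1"
  shows "F = efps x"
proof (rule fps_ext)
  fix n show "fps_nth F n = fps_nth (efps x) n"
  proof (induction n rule: less_induct)
    case (less n)
    show ?case
    proof (cases "n = 0")
      case False
      have "of_nat n * fps_nth F n = fps_nth (afps x * F) n"
        by (subst assms(1)[symmetric]) simp
      also have "\<dots> = (\<Sum>j=1..n. x j * ecoef x (n - j))"
        unfolding afps_mult_nth by (rule sum.cong) (use less in auto)
      also have "\<dots> = of_nat n * ecoef x n" by (rule ecoef_rec[symmetric])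
      finally show ?thesis using False by simp
    qed (use assms in auto)
  qed
qed

lemma fps_XD_mult: "fps_XD (F * G) = fps_XD F * G + F * fps_XD G"
  for F G :: "'a::comm_ring_1 fps"
  by (simp add: fps_XD_def algebra_simps)

lemma efps_add: "efps (\<lambda>j. x j + y j) = efps x * efps y"
proof (rule efps_unique[symmetric])
  have "afps (\<lambda>j. x j + y j) = afps x + afps y" by (rule fps_ext) (simp add: afps_nth)
  then show "fps_XD (efps x * efps y) = afps (\<lambda>j. x j + y j) * (efps x * efps y)"
    by (simp add: fps_XD_mult XD_efps algebra_simps)
qed simp

lemma efps_zero: "efps (\<lambda>j. 0) = 1"
proof -
  have "afps (\<lambda>j. 0) = (0::'a::field_char_0 fps)" by (rule fps_ext) (simp add: afps_nth)
  then show ?thesis by (intro efps_unique[symmetric]) (auto simp: fps_XD_def)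
qed

lemma efps_sum: "finite S \<Longrightarrow> efps (\<lambda>j. \<Sum>i\<in>S. x i j) = (\<Prod>i\<in>S. efps (x i))"
  by (induction S rule: finite_induct) (auto simp: efps_zero efps_add)

lemma ecoef_cong:
  assumes "\<And>j. 1 \<le> j \<Longrightarrow> j \<le> n \<Longrightarrow> x j = y j"
  shows "ecoef x n = ecoef y n"
  using assms
proof (induction n rule: less_induct)
  case (less n)
  show ?case
  proof (cases "n = 0")
    case False
    have "of_nat n * ecoef x n = of_nat n * ecoef y n"
      unfolding ecoef_rec by (rule sum.cong) (use less in auto)
    then show ?thesis using False by simp
  qed auto
qed

text \<open>This is exp(c z^j / j), the contribution of the cycles of a single length j.\<close>

lemma efps_single:
  assumes "j > 0"
  shows "efps (\<lambda>l. if l = j then c else 0) =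
         Abs_fps (\<lambda>m. if j dvd m then (c / of_nat j) ^ (m div j) / fact (m div j) else 0)"
    (is "_ = ?F")
proof (rule efps_unique[symmetric])
  show "fps_XD ?F = afps (\<lambda>l. if l = j then c else 0) * ?F"
  proof (rule fps_ext)
    fix m
    have "fps_nth (afps (\<lambda>l. if l = j then c else 0) * ?F) m =
       (\<Sum>l=1..m. (if l = j then c else 0) * fps_nth ?F (m - l))"
      by (simp only: afps_mult_nth)
    also have "\<dots> = (if j \<le> m then c * fps_nth ?F (m - j) else 0)"
      using assms by (simp add: if_distrib[of "\<lambda>x. x * _"] sum.delta' cong: if_cong)
    also have "\<dots> = of_nat m * fps_nth ?F m"
    proof (cases "j dvd m \<and> m > 0")
      case True
      then obtain s where s: "m = j * s" by auto
      with True assms obtain t where t: "s = Suc t" by (cases s) auto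
      have "m - j = j * t" using s t by simp
      have nz: "(of_nat (Suc t) :: 'a) \<noteq> 0" "(of_nat j :: 'a) \<noteq> 0"
        using assms by (simp_all del: of_nat_Suc)
      have aux: "J * N * (u * w / (N * F)) = J * u * (w / F)" if "N \<noteq> 0" for J N u w F :: 'a
        using that by simp
      have "of_nat m * ((c / of_nat j) ^ Suc t / fact (Suc t)) =
            of_nat j * (c / of_nat j) * ((c / of_nat j) ^ t / fact t)"
        unfolding s t of_nat_mult fact_Suc power_Suc using aux[OF nz(1)] .
      also have "\<dots> = c * ((c / of_nat j) ^ t / fact t)" using nz by simp
      finally have "of_nat m * ((c / of_nat j) ^ Suc t / fact (Suc t)) = c * ((c / of_nat j) ^ t / fact t)" .
      moreover have "j \<le> m" "j dvd m" "j dvd m - j" "m div j = Suc t" "(m - j) div j = t"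
        using s t assms \<open>m - j = j * t\<close> by simp_all
      ultimately show ?thesis by (simp del: power_Suc fact_Suc)
    next
      case False
      show ?thesis
      proof (cases "m = 0")
        case m: False
        have "\<not> j dvd m - j" if "j \<le> m"
          using that False m dvd_diffD[of j m j] by auto
        then show ?thesis using False m by simp
      qed (use assms in simp)
    qed
    finally show "fps_nth (fps_XD ?F) m = fps_nth (afps (\<lambda>l. if l = j then c else 0) * ?F) m"
      by simp
  qed
qed simp

text \<open>A set T containing \<open>a\<close> is determined by its card T - 1 other
  elements.\<close>

lemma orbit_sum_by_card:
  fixes F :: "nat \<Rightarrow> 'a::comm_semiring_1"
  assumes "finite A" "a \<in> A"
  shows "(\<Sum>T | T \<subseteq> A \<and> a \<in> T. F (card T)) =
         (\<Sum>j=1..card A. of_nat ((card A - 1) choose (j - 1)) * F j)"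
proof -
  have fin: "finite {T. T \<subseteq> A \<and> a \<in> T}" using assms by auto
  have "(\<Sum>T | T \<subseteq> A \<and> a \<in> T. F (card T)) =
        (\<Sum>j\<in>{1..card A}. \<Sum>T\<in>{T\<in>{T. T \<subseteq> A \<and> a \<in> T}. card T = j}. F (card T))"
    by (rule sum.group[symmetric, OF fin])
       (use assms in \<open>auto intro!: card_mono simp: Suc_le_eq card_gt_0_iff dest: finite_subset\<close>)
  also have "\<dots> = (\<Sum>j=1..card A. of_nat ((card A - 1) choose (j - 1)) * F j)"
  proof (rule sum.cong)
    fix j assume j: "j \<in> {1..card A}"
    have "bij_betw (\<lambda>T. insert a T) {T. T \<subseteq> A - {a} \<and> card T = j - 1}
            {T\<in>{T. T \<subseteq> A \<and> a \<in> T}. card T = j}"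
    proof (rule bij_betwI[where g = "\<lambda>T. T - {a}"])
      show "insert a \<in> {T. T \<subseteq> A - {a} \<and> card T = j - 1} \<rightarrow> {T \<in> {T. T \<subseteq> A \<and> a \<in> T}. card T = j}"
      proof safe
        fix T assume T: "T \<subseteq> A - {a}" "card T = j - 1"
        then have "finite T" "a \<notin> T" using assms finite_subset by blast+
        then show "card (insert a T) = j" using T j by simp
      qed (use assms in auto)
      show "(\<lambda>T. T - {a}) \<in> {T \<in> {T. T \<subseteq> A \<and> a \<in> T}. card T = j} \<rightarrow> {T. T \<subseteq> A - {a} \<and> card T = j - 1}"
        by auto
    qed auto
    then have "card {T\<in>{T. T \<subseteq> A \<and> a \<in> T}. card T = j} = (card A - 1) choose (j - 1)"
      using bij_betw_same_card n_subsets[of "A - {a}" "j - 1"] assms by fastforce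
    then show "(\<Sum>T\<in>{T\<in>{T. T \<subseteq> A \<and> a \<in> T}. card T = j}. F (card T)) =
        of_nat ((card A - 1) choose (j - 1)) * F j" by simp
  qed simp
  finally show ?thesis .
qed

text \<open>Splits a permutation into its cycle through \<open>a\<close> and the rest. With
  \<open>permutes_orbit_compose\<close>, the inverse construction, this is the bijection behind
  \<open>sum_perms_by_orbit\<close>.\<close>

lemma permutes_orbit_restrict:
  assumes "finite A" "\<sigma> permutes A" "a \<in> A" "orbit \<sigma> a = T"
  shows "perm_restrict \<sigma> T permutes T" "orbit (perm_restrict \<sigma> T) a = T"
        "perm_restrict \<sigma> (A - T) permutes (A - T)"
        "perm_restrict \<sigma> T \<circ> perm_restrict \<sigma> (A - T) = \<sigma>"
        "orbit \<sigma> ` A = insert T (orbit (perm_restrict \<sigma> (A - T)) ` (A - T))"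
proof -
  have cyc: "cyclic_on \<sigma> T" using cyclic_on_orbit[OF assms(2,1)] assms by auto
  have TA: "T \<subseteq> A" using permutes_orbit_subset[OF assms(2,3)] assms by simp
  have perm: "permutation \<sigma>" using assms(1,2) by (auto simp: permutation_permutes)
  have aT: "a \<in> T" using permutation_self_in_orbit[OF perm] assms by auto
  have closed: "\<sigma> x \<in> T \<longleftrightarrow> x \<in> T" for x
    using cyclic_on_inI[OF cyc] cyclic_on_f_in[OF assms(2) cyc] by blast
  have bij: "bij_betw \<sigma> T T"
    unfolding bij_betw_def
  proof
    show "inj_on \<sigma> T" using permutes_inj[OF assms(2)] by (rule inj_on_subset) auto
    then show "\<sigma> ` T = T" using closed TA assms(1)
      by (intro endo_inj_surj) (auto dest: finite_subset)
  qed
  then have "bij_betw (perm_restrict \<sigma> T) T T"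
    by (subst bij_betw_cong[of T _ \<sigma>]) (auto simp: perm_restrict_def)
  then show p1: "perm_restrict \<sigma> T permutes T"
    by (rule bij_imp_permutes) (auto simp: perm_restrict_def)
  have "orbit \<sigma> a = orbit (perm_restrict \<sigma> T) a"
    by (rule orbit_cong0[of a T]) (use aT closed in \<open>auto simp: perm_restrict_def\<close>)
  then show "orbit (perm_restrict \<sigma> T) a = T" using assms by simp
  show p2: "perm_restrict \<sigma> (A - T) permutes (A - T)"
    by (rule perm_restrict_diff_cyclic[OF assms(2) cyc])
  show "perm_restrict \<sigma> T \<circ> perm_restrict \<sigma> (A - T) = \<sigma>"
    using perm_restrict_union[OF p1 p2] TA assms by (simp add: Un_absorb1)
  have *: "orbit (perm_restrict \<sigma> (A - T)) x = orbit \<sigma> x" if "x \<in> A - T" for x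
    by (rule orbit_cong0[of x "A - T"]) 
       (use that closed permutes_in_image[OF assms(2)] in \<open>auto simp: perm_restrict_def\<close>)
  have "orbit \<sigma> x = T" if "x \<in> T" for x using orbit_cyclic_eq3[OF cyc that] .
  then have "orbit \<sigma> ` A = insert T (orbit \<sigma> ` (A - T))" using TA aT by blast
  then show "orbit \<sigma> ` A = insert T (orbit (perm_restrict \<sigma> (A - T)) ` (A - T))"
    using * by simp
qed

lemma permutes_orbit_compose:
  assumes "finite A" "T \<subseteq> A" "a \<in> T" "\<tau> permutes T" "orbit \<tau> a = T" "\<rho> permutes (A - T)"
  shows "\<tau> \<circ> \<rho> permutes A" "orbit (\<tau> \<circ> \<rho>) a = T"
        "perm_restrict (\<tau> \<circ> \<rho>) T = \<tau>" "perm_restrict (\<tau> \<circ> \<rho>) (A - T) = \<rho>"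
proof -
  have t: "\<tau> permutes A" using permutes_subset[OF assms(4,2)] .
  have r: "\<rho> permutes A" using permutes_subset[OF assms(6)] by auto
  show "\<tau> \<circ> \<rho> permutes A" by (rule permutes_compose[OF r t])
  have in1: "\<rho> x = x" if "x \<in> T" for x using permutes_not_in[OF assms(6)] that by auto
  have in2: "\<tau> x = x" if "x \<notin> T" for x using permutes_not_in[OF assms(4) that] .
  have in3: "\<rho> x \<notin> T" if "x \<notin> T" for x
    by (metis DiffD2 assms(6) permutes_in_image permutes_not_in that)
  have "orbit \<tau> a = orbit (\<tau> \<circ> \<rho>) a"
    by (rule orbit_cong0[of a T]) (use in1 assms permutes_in_image[OF assms(4)] in auto)
  then show "orbit (\<tau> \<circ> \<rho>) a = T" using assms by simp
  show "perm_restrict (\<tau> \<circ> \<rho>) T = \<tau>"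
    using in1 in2 by (auto simp: perm_restrict_def fun_eq_iff)
  show "perm_restrict (\<tau> \<circ> \<rho>) (A - T) = \<rho>"
    using in1 in2 in3 permutes_not_in[OF assms(6)]
    by (auto simp: perm_restrict_def fun_eq_iff)
qed

text \<open>Counts the cyclic permutations of T. The value (card T - 1)! is extracted in
  \<open>ncyc_eq\<close> from the same recursion that serves for arbitrary weights.\<close>

definition ncyc :: "'b \<Rightarrow> 'b set \<Rightarrow> nat" where
  "ncyc a T = card {\<tau>. \<tau> permutes T \<and> orbit \<tau> a = T}"

lemma sum_perms_by_orbit:
  fixes x :: "nat \<Rightarrow> 'a::comm_semiring_1"
  assumes "finite A" "a \<in> A"
  shows "(\<Sum>\<sigma> | \<sigma> permutes A. \<Prod>C\<in>orbit \<sigma> ` A. x (card C)) =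
     (\<Sum>T | T \<subseteq> A \<and> a \<in> T. of_nat (ncyc a T) * x (card T) *
        (\<Sum>\<rho> | \<rho> permutes (A - T). \<Prod>C\<in>orbit \<rho> ` (A - T). x (card C)))"
proof -
  define w where "w \<sigma> A = (\<Prod>C\<in>orbit \<sigma> ` A. x (card C))" for \<sigma> :: "'b \<Rightarrow> 'b" and A
  have finP: "finite {\<sigma>. \<sigma> permutes B}" if "finite B" for B :: "'b set"
    using finite_permutations that by auto
  have aorb: "a \<in> orbit \<sigma> a" if "\<sigma> permutes A" for \<sigma>
    using permutation_self_in_orbit that assms(1) by (metis permutation_permutes)
  have "(\<Sum>\<sigma> | \<sigma> permutes A. w \<sigma> A) =
     (\<Sum>T\<in>{T. T \<subseteq> A \<and> a \<in> T}. \<Sum>\<sigma>\<in>{\<sigma>\<in>{\<sigma>. \<sigma> permutes A}. orbit \<sigma> a = T}. w \<sigma> A)"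
    by (rule sum.group[symmetric])
       (use assms aorb permutes_orbit_subset[of _ A a] in \<open>auto intro: finP\<close>)
  also have "\<dots> = (\<Sum>T | T \<subseteq> A \<and> a \<in> T. of_nat (ncyc a T) * x (card T) * 
      (\<Sum>\<rho> | \<rho> permutes (A - T). w \<rho> (A - T)))"
  proof (rule sum.cong)
    fix T assume T: "T \<in> {T. T \<subseteq> A \<and> a \<in> T}"
    then have finT: "finite T" using assms finite_subset by blast
    have "(\<Sum>\<sigma>\<in>{\<sigma>\<in>{\<sigma>. \<sigma> permutes A}. orbit \<sigma> a = T}. w \<sigma> A) =
          (\<Sum>(\<tau>,\<rho>)\<in>{\<tau>. \<tau> permutes T \<and> orbit \<tau> a = T} \<times> {\<rho>. \<rho> permutes (A - T)}.
             x (card T) * w \<rho> (A - T))"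
    proof (rule sum.reindex_bij_witness[of _ "\<lambda>(\<tau>,\<rho>). \<tau> \<circ> \<rho>"
             "\<lambda>\<sigma>. (perm_restrict \<sigma> T, perm_restrict \<sigma> (A - T))"], goal_cases)
      case (5 \<sigma>)
      then have \<sigma>: "\<sigma> permutes A" "orbit \<sigma> a = T" by auto
      let ?\<rho> = "perm_restrict \<sigma> (A - T)"
      note p = permutes_orbit_restrict[OF assms(1) \<sigma>(1) assms(2) \<sigma>(2)]
      \<comment> \<open>The cycle T differs from all cycles of the remaining permutation, so its
        weight splits off as a separate factor.\<close>
      have "T \<notin> orbit ?\<rho> ` (A - T)"
        using permutes_orbit_subset[OF p(3)] T by fastforce
      then show ?case using assms(1) by (auto simp: w_def p(5))
    qed (use T permutes_orbit_restrict[OF assms(1) _ assms(2)] permutes_orbit_compose[OF assms(1)] in auto)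
    also have "\<dots> = of_nat (ncyc a T) * x (card T) * (\<Sum>\<rho> | \<rho> permutes (A - T). w \<rho> (A - T))"
      by (simp add: sum.cartesian_product[symmetric] sum_distrib_left[symmetric] ncyc_def mult.assoc)
    finally show "(\<Sum>\<sigma>\<in>{\<sigma>\<in>{\<sigma>. \<sigma> permutes A}. orbit \<sigma> a = T}. w \<sigma> A) = \<dots>" .
  qed simp
  finally show ?thesis by (simp add: w_def)
qed

lemma binomial_fact_diff:
  assumes "1 \<le> j" "j \<le> n"
  shows "((n - 1) choose (j - 1)) * fact (j - 1) * fact (n - j) = fact (n - 1)"
  using binomial_fact_lemma[of "j - 1" "n - 1"] assms by (simp add: mult.assoc mult.commute mult.left_commute)

text \<open>With unit weights the recursion over the orbit of \<open>a\<close> counts all n!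
  permutations. The terms of proper subsets T are known by induction, and giving T = A the term (n -
  1)! makes the total n (n - 1)! = n!; hence the term of A has this value.\<close>

lemma ncyc_eq:
  assumes "finite A" "a \<in> A"
  shows "ncyc a A = fact (card A - 1)"
  using assms
proof (induction "card A" arbitrary: A rule: less_induct)
  case (less A)
  define n where "n = card A"
  have n: "n \<ge> 1" using less.prems by (auto simp: n_def Suc_le_eq card_gt_0_iff)
  let ?S = "{T. T \<subseteq> A \<and> a \<in> T}"
  have fin: "finite ?S" using less.prems by auto
  have "(fact n :: nat) = (\<Sum>\<sigma> | \<sigma> permutes A. \<Prod>C\<in>orbit \<sigma> ` A. 1)"
    using card_permutations[of A n] less.prems by (simp add: n_def)
  also have "\<dots> = (\<Sum>T\<in>?S. ncyc a T * fact (card (A - T)))"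
    unfolding sum_perms_by_orbit[OF less.prems, of "\<lambda>_. 1 :: nat"] 
    by (rule sum.cong) (use less.prems in \<open>auto simp: card_permutations[OF refl]\<close>)
  also have "\<dots> = (\<Sum>T\<in>?S - {A}. ncyc a T * fact (card (A - T))) + ncyc a A"
    using fin less.prems by (subst sum.remove[of _ A]) auto
  finally have 1: "(fact n :: nat) = (\<Sum>T\<in>?S - {A}. ncyc a T * fact (card (A - T))) + ncyc a A" .
  define G :: "'a set \<Rightarrow> nat" where "G T = fact (card T - 1) * fact (n - card T)" for T
  have 2: "(\<Sum>T\<in>?S - {A}. ncyc a T * fact (card (A - T))) = (\<Sum>T\<in>?S - {A}. G T)"
  proof (rule sum.cong)
    fix T assume T: "T \<in> ?S - {A}"
    then have "finite T" "card T < card A"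
      using less.prems finite_subset[of T A] psubset_card_mono[of A T] by auto
    then show "ncyc a T * fact (card (A - T)) = G T"
      using less.hyps[of T] T by (auto simp: n_def card_Diff_subset G_def)
  qed simp
  have "(\<Sum>T\<in>?S - {A}. G T) + fact (n - 1) = (\<Sum>T\<in>?S. G T)"
    using fin less.prems by (subst sum.remove[of ?S A]) (auto simp: n_def G_def)
  also have "\<dots> = (\<Sum>j=1..n. ((n - 1) choose (j - 1)) * (fact (j - 1) * fact (n - j)))"
    using orbit_sum_by_card[OF less.prems, of "\<lambda>j. fact (j - 1) * fact (n - j) :: nat"]
    by (simp add: n_def G_def)
  also have "\<dots> = (\<Sum>j=1..n. fact (n - 1))"
    by (rule sum.cong) (use binomial_fact_diff[of _ n] in \<open>auto simp: mult.assoc\<close>)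
  also have "\<dots> = fact n" using n by (cases n) auto
  finally show ?case using 1 2 by (simp add: n_def)
qed

text \<open>The recursion over the orbit of one element becomes the recursion of
  \<open>ecoef\<close>: binomial coefficient, number of cycles and the factorial from the induction
  hypothesis always multiply to (n - 1)!.\<close>

lemma sum_multiplicative_perms:
  fixes x :: "nat \<Rightarrow> 'a::field_char_0"
  assumes "finite A"
  shows "(\<Sum>\<sigma> | \<sigma> permutes A. \<Prod>C\<in>orbit \<sigma> ` A. x (card C)) = fact (card A) * ecoef x (card A)"
  using assms
proof (induction "card A" arbitrary: A rule: less_induct)
  case (less A)
  show ?case
  proof (cases "A = {}")
    case False
    then obtain a where a: "a \<in> A" by auto
    define n where "n = card A"
    have n: "n \<ge> 1" using less.prems a by (auto simp: n_def Suc_le_eq card_gt_0_iff)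
    have "(\<Sum>\<sigma> | \<sigma> permutes A. \<Prod>C\<in>orbit \<sigma> ` A. x (card C)) =
       (\<Sum>T | T \<subseteq> A \<and> a \<in> T. fact (card T - 1) * x (card T) * (fact (n - card T) * ecoef x (n - card T)))"
      unfolding sum_perms_by_orbit[OF less.prems a]
    proof (rule sum.cong)
      fix T assume T: "T \<in> {T. T \<subseteq> A \<and> a \<in> T}"
      then have fT: "finite T" using less.prems finite_subset by blast
      have "card (A - T) = n - card T" using T fT by (simp add: card_Diff_subset n_def)
      moreover have "card (A - T) < card A" using T a less.prems by (intro psubset_card_mono) auto
      ultimately show "of_nat (ncyc a T) * x (card T) * 
          (\<Sum>\<rho> | \<rho> permutes (A - T). \<Prod>C\<in>orbit \<rho> ` (A - T). x (card C)) =
          fact (card T - 1) * x (card T) * (fact (n - card T) * ecoef x (n - card T))"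
        using less.hyps[of "A - T"] less.prems fT T by (simp add: ncyc_eq)
    qed simp
    also have "\<dots> = (\<Sum>j=1..n. of_nat ((n - 1) choose (j - 1)) * 
        (fact (j - 1) * x j * (fact (n - j) * ecoef x (n - j))))"
      using orbit_sum_by_card[OF less.prems a, of "\<lambda>j. fact (j - 1) * x j * (fact (n - j) * ecoef x (n - j))"]
      by (simp add: n_def)
    also have "\<dots> = (\<Sum>j=1..n. fact (n - 1) * (x j * ecoef x (n - j)))"
    proof (rule sum.cong)
      fix j assume "j \<in> {1..n}"
      then have "of_nat (((n - 1) choose (j - 1)) * fact (j - 1) * fact (n - j)) = (of_nat (fact (n - 1)) :: 'a)"
        by (subst binomial_fact_diff) auto
      then have *: "of_nat ((n - 1) choose (j - 1)) * fact (j - 1) * fact (n - j) = (fact (n - 1) :: 'a)"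
        by simp
      show "of_nat ((n - 1) choose (j - 1)) * (fact (j - 1) * x j * (fact (n - j) * ecoef x (n - j))) = 
         fact (n - 1) * (x j * ecoef x (n - j))"
        unfolding *[symmetric] by (simp add: mult_ac)
    qed simp
    also have "\<dots> = fact (n - 1) * (of_nat n * ecoef x n)"
      by (simp only: ecoef_rec sum_distrib_left)
    also have "\<dots> = fact n * ecoef x n" using n by (cases n) (auto simp: algebra_simps)
    finally show ?thesis by (simp add: n_def)
  qed simp
qed

subsection \<open>Powers of permutations\<close>

lemma orbit_period:
  assumes "permutation f"
  shows "(f ^^ m) y = y \<longleftrightarrow> card (orbit f y) dvd m" and "card (orbit f y) > 0"
proof -
  have self: "y \<in> orbit f y" by (rule permutation_self_in_orbit[OF assms])
  define d where "d = funpow_dist1 f y y"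
  have d: "(f ^^ d) y = y" unfolding d_def by (rule funpow_dist1_prop[OF self])
  have "card (orbit f y) = d"
    using orbit_conv_funpow_dist1[OF self] inj_on_funpow_dist1[OF self]
    by (simp add: d_def card_image)
  moreover have "(f ^^ m) y = y \<longleftrightarrow> d dvd m"
  proof
    assume m: "(f ^^ m) y = y"
    then have "(f ^^ (m mod d)) y = y" using funpow_mod_eq[OF d, of m] by simp
    moreover have "m mod d < d" by (simp add: d_def)
    ultimately have "m mod d = 0"
      using funpow_dist1_least[of "m mod d" f y y] by (auto simp: d_def)
    then show "d dvd m" by auto
  next
    assume "d dvd m"
    then have "m mod d = 0" by auto
    then show "(f ^^ m) y = y" using funpow_mod_eq[OF d, of m] by simp
  qed
  ultimately show "(f ^^ m) y = y \<longleftrightarrow> card (orbit f y) dvd m" "card (orbit f y) > 0"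
    by (auto simp: d_def)
qed

lemma orbit_funpow_cong:
  assumes "permutation f" "[l = l'] (mod card (orbit f y))"
  shows "(f ^^ l) y = (f ^^ l') y"
proof -
  let ?d = "card (orbit f y)"
  have *: "(f ^^ ?d) y = y" using orbit_period(1)[OF assms(1), of ?d y] by simp
  show ?thesis
    using funpow_mod_eq[OF *, of l] funpow_mod_eq[OF *, of l'] assms(2) by (simp add: cong_def)
qed

lemma permutes_funpow: "f permutes A \<Longrightarrow> (f ^^ k) permutes A"
  by (induction k) (auto intro: permutes_compose simp: permutes_id[unfolded id_def] permutes_id)

lemma permutation_funpow: "permutation f \<Longrightarrow> permutation (f ^^ k)"
  by (induction k) (auto intro: permutation_compose simp: permutation_id[unfolded id_def] permutation_id)

text \<open>Both numbers are determined by their multiples: i is a multiple of the left one iff f^(k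
  i) fixes y, that is, iff the cycle length of f divides k i.\<close>

lemma card_orbit_funpow:
  assumes "permutation f" "k > 0"
  shows "card (orbit (f ^^ k) y) = card (orbit f y) div gcd (card (orbit f y)) k"
proof -
  define L where "L = card (orbit f y)"
  define g where "g = gcd L k"
  have L: "L > 0" using orbit_period(2)[OF assms(1)] by (simp add: L_def)
  have pk: "permutation (f ^^ k)" using permutation_funpow[OF assms(1)] .
  have "card (orbit (f ^^ k) y) dvd i \<longleftrightarrow> L div g dvd i" for i
  proof -
    have g: "g > 0" "coprime (L div g) (k div g)"
      using L by (simp_all add: g_def div_gcd_coprime)
    have gL: "L = g * (L div g)" "k = g * (k div g)" by (simp_all add: g_def)
    have "card (orbit (f ^^ k) y) dvd i \<longleftrightarrow> (f ^^ (k * i)) y = y"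
      using orbit_period(1)[OF pk, of i y] by (simp add: funpow_mult)
    also have "\<dots> \<longleftrightarrow> L dvd k * i"
      using orbit_period(1)[OF assms(1), of "k * i" y] by (simp add: L_def)
    also have "\<dots> \<longleftrightarrow> L div g dvd k div g * i"
      using g(1) nat_mult_dvd_cancel_disj[of g "L div g" "k div g * i"] gL by (simp add: mult.assoc[symmetric])
    also have "\<dots> \<longleftrightarrow> L div g dvd i"
      using g(2) coprime_dvd_mult_right_iff by blast
    finally show ?thesis .
  qed
  then show ?thesis unfolding L_def g_def using dvd_antisym dvd_refl by blast
qed

lemma multiplicity_q_part:
  assumes "k > 0" "j > 0" "prime p"
  shows "multiplicity p (q_part k j) = (if p dvd k \<and> p dvd j then multiplicity p k else 0)"
proof -
  have "multiplicity p (q_part k j) = (if p \<in> prime_factors (gcd k j) then multiplicity p k else 0)"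
    unfolding q_part_def using assms by (subst multiplicity_prod_prime_powers) auto
  moreover have "p \<in> prime_factors (gcd k j) \<longleftrightarrow> p dvd k \<and> p dvd j"
    using assms by (auto simp: prime_factors_dvd)
  ultimately show ?thesis by simp
qed

lemma q_part_pos: "q_part k j > 0"
  unfolding q_part_def by (rule prod_pos) (auto intro!: zero_less_power simp: prime_gt_0_nat in_prime_factors_iff)

lemma q_part_dvd:
  assumes "k > 0" "j > 0"
  shows "q_part k j dvd k"
proof (rule multiplicity_le_imp_dvd)
  show "q_part k j \<noteq> 0" using q_part_pos[of k j] by simp
  fix p :: nat assume "prime p"
  then show "multiplicity p (q_part k j) \<le> multiplicity p k"
    using multiplicity_q_part[OF assms] by simp
qed

text \<open>\<open>q_part k j\<close> takes from k the full power of every prime that also divides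
  j. The consequence needed later is that k / \<open>q_part k j\<close> is invertible modulo
  j.\<close>

lemma coprime_q_part:
  assumes "k > 0" "j > 0"
  shows "coprime (k div q_part k j) j"
proof (rule ccontr)
  assume "\<not> ?thesis"
  then obtain p where p: "prime p" "p dvd k div q_part k j" "p dvd j"
    using prime_factor_nat[of "gcd (k div q_part k j) j"] by (auto simp: coprime_iff_gcd_eq_1)
  have eq: "k = q_part k j * (k div q_part k j)" using q_part_dvd[OF assms] by simp
  have nz: "k div q_part k j \<noteq> 0" using eq assms by (metis mult_0_right gr0I less_numeral_extra(3))
  have pk: "p dvd k" using p eq by (metis dvd_mult)
  have "multiplicity p k = multiplicity p (q_part k j) + multiplicity p (k div q_part k j)"
    using p(1) nz q_part_pos[of k j]
    by (subst eq, subst prime_elem_multiplicity_mult_distrib) auto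
  then have "multiplicity p (k div q_part k j) = 0"
    using multiplicity_q_part[OF assms p(1)] p pk by simp
  then show False using p nz by (metis not_prime_unit not_dvd_imp_multiplicity_0 multiplicity_eq_zero_iff prime_def prime_elem_def)
qed

text \<open>Under the k-th power a cycle of length L breaks into gcd L k cycles of length L / gcd L
  k. If a prime of k still divides this length, then L contains it to a higher power than k does, so
  the gcd contains the full power from k.\<close>

lemma q_part_dvd_gcd:
  assumes "k > 0" "L > 0"
  shows "q_part k (L div gcd L k) dvd gcd L k"
proof (rule multiplicity_le_imp_dvd)
  let ?g = "gcd L k"
  have g: "?g > 0" and L: "L = ?g * (L div ?g)" using assms by auto
  have j: "L div ?g > 0" using L assms by (metis mult_0_right gr0I less_numeral_extra(3))
  show "q_part k (L div ?g) \<noteq> 0" using q_part_pos[of k "L div ?g"] by simp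
  fix p :: nat assume p: "prime p"
  show "multiplicity p (q_part k (L div ?g)) \<le> multiplicity p ?g"
  proof (cases "p dvd k \<and> p dvd L div ?g")
    case True
    have "multiplicity p L = multiplicity p ?g + multiplicity p (L div ?g)"
      using p g j by (subst L, subst prime_elem_multiplicity_mult_distrib) auto
    moreover have "multiplicity p (L div ?g) > 0"
      using True p j by (simp add: prime_multiplicity_gt_zero_iff)
    moreover have "multiplicity p ?g = min (multiplicity p L) (multiplicity p k)"
      using assms p by (intro multiplicity_gcd) auto
    ultimately have "multiplicity p ?g = multiplicity p k" by linarith
    then show ?thesis using multiplicity_q_part[OF assms(1) j p] by simp
  qed (use multiplicity_q_part[OF assms(1) j p] in auto)
qed

lemma orbit_eq_of_mem:
  assumes "permutation f" "z \<in> orbit f y"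
  shows "orbit f z = orbit f y"
  using orbit_cyclic_eq3[OF cyclic_on_orbit'[OF assms(1)] assms(2)] .

text \<open>The cycles of x^k of length j are counted according to the cycle D of x that contains
  them. Each D contributes none or exactly gcd (card D) k of them, a multiple of
  \<open>q_part k j\<close>.\<close>

lemma power_imp_cycle_counts:
  assumes "finite A" "x permutes A" "k > 0"
  shows "q_part k j dvd card {C \<in> orbit (x ^^ k) ` A. card C = j}"
proof -
  define \<sigma> where "\<sigma> = x ^^ k"
  have px: "permutation x" using assms by (auto simp: permutation_permutes)
  have ps: "permutation \<sigma>" unfolding \<sigma>_def by (rule permutation_funpow[OF px])
  have pA: "\<sigma> permutes A" using assms(2) by (simp add: \<sigma>_def permutes_funpow)
  define S where "S = {C \<in> orbit \<sigma> ` A. card C = j}"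
  have finS: "finite S" using assms by (auto simp: S_def)
  have sub: "orbit \<sigma> y \<subseteq> orbit x y" for y
    by (auto simp: orbit_altdef \<sigma>_def funpow_mult) (use assms(3) in \<open>metis nat_0_less_mult_iff\<close>)
  \<comment> \<open>Each cycle C of \<open>\<sigma>\<close> lies inside one cycle of
    \<open>x\<close>, so the chosen element does not matter.\<close>
  define blk where "blk C = orbit x (SOME y. y \<in> C)" for C
  have blk: "blk (orbit \<sigma> y) = orbit x y" for y
  proof -
    have "(SOME z. z \<in> orbit \<sigma> y) \<in> orbit \<sigma> y"
      by (rule someI[of _ y]) (rule permutation_self_in_orbit[OF ps])
    then show ?thesis unfolding blk_def using sub orbit_eq_of_mem[OF px] by blast
  qed
  have "card S = (\<Sum>D\<in>orbit x ` A. card {C\<in>S. blk C = D})"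
  proof -
    have "(\<Sum>D\<in>orbit x ` A. \<Sum>C\<in>{C\<in>S. blk C = D}. 1) = (\<Sum>C\<in>S. 1 :: nat)"
      by (rule sum.group[OF finS]) (use assms blk in \<open>auto simp: S_def\<close>)
    then show ?thesis by simp
  qed
  moreover have "q_part k j dvd card {C\<in>S. blk C = D}" if D: "D \<in> orbit x ` A" for D
  proof (cases "{C\<in>S. blk C = D} = {}")
    case False
    obtain y where y: "y \<in> A" "D = orbit x y" using D by auto
    have fD: "finite D" unfolding y by (rule finite_orbit[OF permutation_self_in_orbit[OF px]])
    have cD: "card D > 0" using orbit_period(2)[OF px] y by simp
    have DA: "D \<subseteq> A" using permutes_orbit_subset[OF assms(2)] y by simp
    have cz: "card (orbit \<sigma> z) = card D div gcd (card D) k" if "z \<in> D" for z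
      unfolding \<sigma>_def using card_orbit_funpow[OF px assms(3), of z] orbit_eq_of_mem[OF px] that y by simp
    have mem: "orbit \<sigma> z \<in> {C\<in>S. blk C = D} \<longleftrightarrow> z \<in> D \<and> card D div gcd (card D) k = j" if "z \<in> A" for z
    proof -
      have "orbit x z = D \<longleftrightarrow> z \<in> D"
        using permutation_self_in_orbit[OF px, of z] orbit_eq_of_mem[OF px] y by blast
      then show ?thesis using that cz[of z] by (auto simp: S_def blk)
    qed
    have j: "card D div gcd (card D) k = j" using False mem by (fastforce simp: S_def)
    have "\<Union>{C\<in>S. blk C = D} = D"
    proof
      show "\<Union>{C\<in>S. blk C = D} \<subseteq> D" using sub blk by (fastforce simp: S_def)
      show "D \<subseteq> \<Union>{C\<in>S. blk C = D}"
      proof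
        fix z assume "z \<in> D"
        then have "orbit \<sigma> z \<in> {C\<in>S. blk C = D}" using mem j DA by blast
        then show "z \<in> \<Union>{C\<in>S. blk C = D}" using permutation_self_in_orbit[OF ps] by blast
      qed
    qed
    moreover have "j * card {C\<in>S. blk C = D} = card (\<Union>{C\<in>S. blk C = D})"
    proof (rule card_partition)
      show "finite (\<Union>{C\<in>S. blk C = D})" using calculation fD by simp
      fix C1 C2 assume *: "C1 \<in> {C\<in>S. blk C = D}" "C2 \<in> {C\<in>S. blk C = D}" "C1 \<noteq> C2"
      then obtain u v where "C1 = orbit \<sigma> u" "C2 = orbit \<sigma> v" by (auto simp: S_def)
      then show "C1 \<inter> C2 = {}" using * orbit_eq_of_mem[OF ps] by blast
    next
      show "finite {C\<in>S. blk C = D}" using finS by simp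
    qed (auto simp: S_def)
    ultimately have "j * card {C\<in>S. blk C = D} = card D" by simp
    moreover have "card D = j * gcd (card D) k" using j by (metis dvd_div_mult_self gcd_dvd1)
    moreover have "j > 0" using calculation cD by (metis mult_0 gr0I less_numeral_extra(3))
    ultimately have "card {C\<in>S. blk C = D} = gcd (card D) k"
      by (metis nat_mult_eq_cancel1)
    then show ?thesis using q_part_dvd_gcd[OF assms(3) cD] j by simp
  qed (simp only: card.empty dvd_0_right)
  ultimately have "q_part k j dvd card S" by (auto intro!: dvd_sum)
  then show ?thesis by (simp add: S_def \<sigma>_def)
qed

text \<open>The cycles through r 0, ..., r (N - 1) are taken in consecutive blocks of q.
  \<open>x\<close> passes from a cycle to the next one of its block at the same position; from the
  last it returns to the first with a shift by e. One round through a block is thus \<sigma>^e,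
  wherever it starts.\<close>

lemma chain_power:
  fixes r :: "nat \<Rightarrow> 'b"
  assumes "q > 0" "q dvd N" "i < N"
    and step: "\<And>i l. i < N \<Longrightarrow> x ((\<sigma> ^^ l) (r i)) =
          (if Suc i mod q = 0 then (\<sigma> ^^ (l + e)) (r (Suc i - q)) else (\<sigma> ^^ l) (r (Suc i)))"
  shows "(x ^^ q) ((\<sigma> ^^ l) (r i)) = (\<sigma> ^^ e) ((\<sigma> ^^ l) (r i))"
proof -
  define c where "c = q * (i div q)"
  have "i div q < N div q" using assms by (simp add: less_mult_imp_div_less)
  then have cN: "c + q \<le> N"
    using assms unfolding c_def
    by (metis Suc_leI dvd_mult_div_cancel mult.commute mult_Suc_right mult_le_mono2 add.commute)
  have up: "(x ^^ m) ((\<sigma> ^^ l) (r c)) = (\<sigma> ^^ l) (r (c + m))" if "m < q" for m l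
    using that
  proof (induction m)
    case (Suc m)
    have "Suc (c + m) mod q = Suc m" using Suc.prems by (simp add: c_def)
    then show ?case using Suc step[of "c + m" l] cN by simp
  qed simp
  have full: "(x ^^ q) ((\<sigma> ^^ l) (r c)) = (\<sigma> ^^ (l + e)) (r c)" for l
  proof -
    obtain p where p: "q = Suc p" using assms(1) by (cases q) auto
    have "(x ^^ q) ((\<sigma> ^^ l) (r c)) = x ((\<sigma> ^^ l) (r (c + p)))" using up[of p l] p by simp
    also have "Suc (c + p) = q * Suc (i div q)" unfolding c_def using p by simp
    then have "Suc (c + p) mod q = 0" by simp
    then have "x ((\<sigma> ^^ l) (r (c + p))) = (\<sigma> ^^ (l + e)) (r c)"
      using step[of "c + p" l] cN p by simp
    finally show ?thesis .
  qed
  define m where "m = i mod q"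
  have m: "m < q" "i = c + m" using assms(1) by (simp_all add: m_def c_def)
  \<comment> \<open>A start in the middle of a block is reduced to its first cycle: the point is x^m
    of a point there, and x^m commutes with x^q.\<close>
  have "(x ^^ q) ((\<sigma> ^^ l) (r i)) = (x ^^ q) ((x ^^ m) ((\<sigma> ^^ l) (r c)))"
    using up[OF m(1), of l] m(2) by simp
  also have "\<dots> = (x ^^ m) ((x ^^ q) ((\<sigma> ^^ l) (r c)))"
    by (metis add.commute comp_apply funpow_add)
  also have "\<dots> = (\<sigma> ^^ (l + e)) (r i)" using full up[OF m(1)] m(2) by simp
  also have "\<dots> = (\<sigma> ^^ e) ((\<sigma> ^^ l) (r i))"
    by (metis add.commute comp_apply funpow_add)
  finally show ?thesis .
qed

text \<open>The cycles of each length j are grouped in blocks of q = \<open>q_part k j\<close> and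
  interleaved as in \<open>chain_power\<close>, with e inverse to k / q modulo j. On them x^q =
  \<sigma>^e, so x^k = \<sigma>^(e k / q) = \<sigma>.\<close>

lemma cycle_counts_imp_power:
  assumes "finite A" "\<sigma> permutes A" "k > 0"
    and div: "\<And>j. q_part k j dvd card {C \<in> orbit \<sigma> ` A. card C = j}"
  shows "\<exists>x. x permutes A \<and> x ^^ k = \<sigma>"
proof -
  have ps: "permutation \<sigma>" using assms by (auto simp: permutation_permutes)
  define S where "S j = {C \<in> orbit \<sigma> ` A. card C = j}" for j
  define N where "N j = card (S j)" for j
  have "\<exists>h. bij_betw h {..<N j} (S j)" for j
    using ex_bij_betw_nat_finite[of "S j"] assms(1) by (auto simp: S_def N_def lessThan_atLeast0)
  then obtain h where h: "\<And>j. bij_betw (h j) {..<N j} (S j)" by metis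
  define r where "r j i = (SOME y. y \<in> A \<and> orbit \<sigma> y = h j i)" for j i
  have r: "r j i \<in> A" "orbit \<sigma> (r j i) = h j i" "card (h j i) = j" if "i < N j" for i j
  proof -
    have "h j i \<in> S j" using bij_betwE[OF h] that by blast
    then have ex: "\<exists>y. y \<in> A \<and> orbit \<sigma> y = h j i" and "card (h j i) = j" by (auto simp: S_def)
    then show "card (h j i) = j" by simp
    show "r j i \<in> A" "orbit \<sigma> (r j i) = h j i"
      using someI_ex[OF ex] by (simp_all add: r_def)
  qed
  define q where "q j = q_part k j" for j
  have qpos: "q j > 0" for j by (simp add: q_def q_part_pos)
  have qN: "q j dvd N j" for j using div by (simp add: q_def N_def S_def)
  define jj where "jj y = card (orbit \<sigma> y)" for y
  have jpos: "jj y > 0" for y unfolding jj_def by (rule orbit_period(2)[OF ps])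
  have "\<exists>e. [e * (k div q (jj y)) = 1] (mod jj y)" for y
    using cong_solve_coprime_nat[OF coprime_q_part[OF assms(3) jpos[of y]]]
    by (simp add: q_def mult.commute)
  then have ex: "\<exists>e. [e * (k div q j) = 1] (mod j)" if "j \<in> range jj" for j using that by auto
  define ee where "ee j = (SOME e. [e * (k div q j) = 1] (mod j))" for j
  have ee: "[ee j * (k div q j) = 1] (mod j)" if "j \<in> range jj" for j
    unfolding ee_def by (rule someI_ex[OF ex[OF that]])
  \<comment> \<open>Coordinates of a point: the index of its cycle among those of the same length,
    and its position relative to the representative. The position is unique only modulo the
    length.\<close>
  have coord: "\<exists>p. fst p < N (jj y) \<and> y = (\<sigma> ^^ snd p) (r (jj y) (fst p))" if y: "y \<in> A" for y
  proof -
    have "orbit \<sigma> y \<in> S (jj y)" using y by (auto simp: S_def jj_def)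
    then have "orbit \<sigma> y \<in> h (jj y) ` {..<N (jj y)}"
      by (simp only: bij_betw_imp_surj_on[OF h])
    then obtain i where i: "h (jj y) i = orbit \<sigma> y" "i < N (jj y)"
      by (metis imageE lessThan_iff)
    have "y \<in> orbit \<sigma> (r (jj y) i)"
      using r(2)[OF i(2)] i(1) permutation_self_in_orbit[OF ps, of y] by simp
    then obtain l where "y = (\<sigma> ^^ l) (r (jj y) i)" unfolding orbit_altdef by blast
    then show ?thesis using i(2) by (intro exI[of _ "(i, l)"]) simp
  qed
  define ii where "ii y = fst (SOME p. fst p < N (jj y) \<and> y = (\<sigma> ^^ snd p) (r (jj y) (fst p)))" for y
  define ll where "ll y = snd (SOME p. fst p < N (jj y) \<and> y = (\<sigma> ^^ snd p) (r (jj y) (fst p)))" for y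
  have il: "ii y < N (jj y) \<and> y = (\<sigma> ^^ ll y) (r (jj y) (ii y))" if "y \<in> A" for y
    unfolding ii_def ll_def by (rule someI_ex[OF coord[OF that]])
  have inA: "(\<sigma> ^^ l) y \<in> A \<longleftrightarrow> y \<in> A" for l y
    using permutes_in_image[OF permutes_funpow[OF assms(2)]] .
  have oshift: "orbit \<sigma> ((\<sigma> ^^ l) y) = orbit \<sigma> y" for l y
    by (rule orbit_eq_of_mem[OF ps funpow_in_orbit[OF permutation_self_in_orbit[OF ps]]])
  have jshift: "jj ((\<sigma> ^^ l) y) = jj y" for l y
    by (simp add: jj_def oshift)
  have jr: "jj (r j i) = j" if "i < N j" for i j using r[OF that] by (simp add: jj_def)
  define x where "x y = (if y \<in> A then let j = jj y; i = ii y; l = ll y in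
     (if Suc i mod q j = 0 then (\<sigma> ^^ (l + ee j)) (r j (Suc i - q j)) else (\<sigma> ^^ l) (r j (Suc i)))
     else y)" for y
  \<comment> \<open>\<open>x\<close> was defined through chosen coordinates. Here any coordinates
    (i, l) are shown to give the same image, because l is determined modulo j.\<close>
  have step: "x ((\<sigma> ^^ l) (r j i)) =
      (if Suc i mod q j = 0 then (\<sigma> ^^ (l + ee j)) (r j (Suc i - q j)) else (\<sigma> ^^ l) (r j (Suc i)))"
    if i: "i < N j" for i j l
  proof -
    define y where "y = (\<sigma> ^^ l) (r j i)"
    have yA: "y \<in> A" using r(1)[OF i] inA by (simp add: y_def)
    have jy: "jj y = j" by (simp add: y_def jshift jr[OF i])
    have iy: "ii y < N j" and ly: "y = (\<sigma> ^^ ll y) (r j (ii y))" using il[OF yA] jy by auto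
    have "h j (ii y) = orbit \<sigma> y"
      using r(2)[OF iy] oshift[of "ll y" "r j (ii y)"] ly by simp
    moreover have "h j i = orbit \<sigma> y"
      using r(2)[OF i] oshift[of l "r j i"] by (simp add: y_def)
    ultimately have ii: "ii y = i"
      using inj_onD[OF bij_betw_imp_inj_on[OF h[of j]], of "ii y" i] iy i by simp
    have eq: "(\<sigma> ^^ l) (r j i) = (\<sigma> ^^ ll y) (r j i)" using ly ii y_def by simp
    have cong: "[l = ll y] (mod j)"
    proof -
      have aux: "[a = b] (mod j)" if "a \<le> b" "(\<sigma> ^^ a) (r j i) = (\<sigma> ^^ b) (r j i)" for a b
      proof -
        have "(\<sigma> ^^ a) ((\<sigma> ^^ (b - a)) (r j i)) = (\<sigma> ^^ a) (r j i)"
          using that funpow_add[of a "b - a" \<sigma>] by simp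
        then have "(\<sigma> ^^ (b - a)) (r j i) = r j i"
          by (rule injD[OF permutes_inj[OF permutes_funpow[OF assms(2)]]])
        then have "j dvd b - a"
          using orbit_period(1)[OF ps, of "b - a" "r j i"] jr[OF i] by (simp add: jj_def)
        then show ?thesis using cong_altdef_nat[OF that(1)] by (simp add: cong_sym_eq)
      qed
      show ?thesis using aux[of l "ll y"] aux[of "ll y" l] eq by (metis cong_sym nat_le_linear)
    qed
    have fc: "(\<sigma> ^^ a) (r j i') = (\<sigma> ^^ b) (r j i')" if "i' < N j" "[a = b] (mod j)" for a b i'
      using orbit_funpow_cong[OF ps, of a b "r j i'"] that jr[OF that(1)] by (simp add: jj_def)
    \<comment> \<open>\<open>N j\<close> is a multiple of \<open>q j\<close>, so the last index
      always ends a block and the next cycle exists in all other cases.\<close>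
    have "Suc i < N j" if "Suc i mod q j \<noteq> 0" 
      using that i qN[of j] by (metis Suc_lessI dvd_imp_mod_0)
    moreover have "Suc i - q j < N j" using i qpos[of j] by simp
    ultimately show ?thesis
      unfolding y_def[symmetric] x_def Let_def jy ii if_P[OF yA]
      using fc[OF _ cong_add[OF cong_sym[OF cong] cong_refl]] fc[OF _ cong_sym[OF cong]] by simp
  qed
  have xq: "(x ^^ q (jj y)) y = (\<sigma> ^^ ee (jj y)) y" if "y \<in> A" for y
  proof -
    have *: "ii y < N (jj y)" "y = (\<sigma> ^^ ll y) (r (jj y) (ii y))" using il[OF that] by auto
    show ?thesis
      using chain_power[OF qpos qN *(1), of x \<sigma> "r (jj y)" "ee (jj y)" "ll y"] step *(2) by simp
  qed
  have xk: "(x ^^ k) y = \<sigma> y" for y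
  proof (cases "y \<in> A")
    case True
    define j where "j = jj y"
    have *: "((x ^^ q j) ^^ t) y = (\<sigma> ^^ (ee j * t)) y" for t
    proof (induction t)
      case (Suc t)
      have "((x ^^ q j) ^^ Suc t) y = (x ^^ q j) ((\<sigma> ^^ (ee j * t)) y)" using Suc by simp
      also have "\<dots> = (\<sigma> ^^ ee j) ((\<sigma> ^^ (ee j * t)) y)"
        using xq[of "(\<sigma> ^^ (ee j * t)) y"] True inA jshift by (simp add: j_def)
      finally show ?case by (simp add: funpow_add)
    qed simp
    have "(x ^^ k) y = ((x ^^ q j) ^^ (k div q j)) y"
      using q_part_dvd[OF assms(3) jpos[of y]] by (simp add: funpow_mult q_def j_def mult.commute)
    also have "\<dots> = (\<sigma> ^^ (ee j * (k div q j))) y" by (rule *)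
    also have "\<dots> = (\<sigma> ^^ 1) y"
      by (rule orbit_funpow_cong[OF ps]) (use ee[of j] in \<open>simp add: j_def jj_def\<close>)
    finally show ?thesis by simp
  next
    case False
    have "(x ^^ t) y = y" for t by (induction t) (use False in \<open>auto simp: x_def\<close>)
    then show ?thesis using permutes_not_in[OF assms(2) False] by simp
  qed
  have xkf: "x ^^ k = \<sigma>" using xk by (intro ext)
  obtain k' where k': "k = Suc k'" using assms(3) by (cases k) auto
  \<comment> \<open>Since k > 0, one factor \<open>x\<close> can be split off from
    \<open>\<sigma>\<close> on either side, so it inherits injectivity and surjectivity.\<close>
  have "inj x" using permutes_inj[OF assms(2)] unfolding xkf[symmetric] k'
    by (simp add: funpow_Suc_right del: funpow.simps) (rule inj_on_imageI2)
  moreover have "surj x" using permutes_surj[OF assms(2)] unfolding xkf[symmetric] k'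
    by (metis comp_apply funpow.simps(2) surjD surjI surj_def)
  ultimately have "\<exists>!z. x z = y" for y by (metis injD surjD)
  moreover have "x z = z" if "z \<notin> A" for z using that by (simp add: x_def)
  ultimately have "x permutes A" unfolding permutes_def by blast
  then show ?thesis using xkf by blast
qed

lemma mem_sym_group_powers_iff:
  assumes "k > 0"
  shows "\<sigma> \<in> sym_group_powers k n \<longleftrightarrow>
    \<sigma> permutes {1..n} \<and> (\<forall>j. q_part k j dvd card {C \<in> perm_cycles n \<sigma>. card C = j})"
  using power_imp_cycle_counts[OF finite_atLeastAtMost _ assms, of _ 1 n]
    cycle_counts_imp_power[OF finite_atLeastAtMost _ assms, of \<sigma> 1 n]
  unfolding sym_group_powers_def perm_cycles_def by (auto intro: permutes_funpow)

subsection \<open>Counting powers by cycle type\<close>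

lemma cis_root_eq_1_iff:
  assumes "q > 0"
  shows "cis (2 * pi * real s / real q) = 1 \<longleftrightarrow> q dvd s"
proof
  assume "cis (2 * pi * real s / real q) = 1"
  then have "cos (2 * pi * real s / real q) = 1" by (metis cis.sel(1) one_complex.sel(1))
  then obtain z :: int where "2 * pi * real s / real q = of_int z * 2 * pi"
    unfolding cos_one_2pi_int by auto
  then have "real s = of_int z * real q" using assms by (simp add: field_simps)
  then have "int s = z * int q" by (metis of_int_eq_iff of_int_mult of_int_of_nat_eq)
  then show "q dvd s" by (metis dvd_triv_right int_dvd_int_iff)
next
  assume "q dvd s"
  then obtain t where "s = q * t" by auto
  then show "cis (2 * pi * real s / real q) = 1"
    using assms cis_multiple_2pi[of "real t"] by (simp add: mult_ac)
qed

lemma unity_root_filter: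
  assumes "q > 0"
  shows "(\<Sum>i<q. cis (2 * pi * real i / real q) ^ s) = (if q dvd s then of_nat q else 0)"
proof -
  define w where "w = cis (2 * pi * real s / real q)"
  have pw: "cis (2 * pi * real i / real q) ^ s = w ^ i" for i
    by (simp add: w_def Complex.DeMoivre mult_ac)
  have wq: "w ^ q = 1"
    using assms cis_multiple_2pi[of "real s"] by (simp add: w_def Complex.DeMoivre mult.commute)
  have w1: "w = 1 \<longleftrightarrow> q dvd s" unfolding w_def by (rule cis_root_eq_1_iff[OF assms])
  show ?thesis
  proof (cases "q dvd s")
    case True
    then show ?thesis using w1 by (simp add: pw)
  next
    case False
    have "(\<Sum>i<q. w ^ i) = (1 - w ^ q) / (1 - w)"
      using False w1 by (intro sum_gp_strict[of w q, THEN trans]) simp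
    then show ?thesis using False wq by (simp add: pw)
  qed
qed

text \<open>The part of exp(x j z^j / j) in which the number m / j of cycles of length j is
  divisible by \<open>q_part k j\<close>.\<close>

definition cycle_factor :: "(nat \<Rightarrow> 'a::field_char_0) \<Rightarrow> nat \<Rightarrow> nat \<Rightarrow> 'a fps" where
  "cycle_factor x k j = Abs_fps (\<lambda>m. if j dvd m \<and> q_part k j dvd m div j
      then x j ^ (m div j) / (of_nat j ^ (m div j) * fact (m div j)) else 0)"

text \<open>Averaging over roots of unity expresses the divisibility restriction through
  unrestricted exponentials, to which \<open>sum_multiplicative_perms\<close> applies.\<close>

lemma cycle_factor_filter:
  fixes x :: "nat \<Rightarrow> complex"
  assumes "j > 0"
  shows "of_nat (q_part k j) * cycle_factor x k j =
    (\<Sum>i<q_part k j. efps (\<lambda>l. if l = j then x j * cis (2 * pi * real i / real (q_part k j)) else 0))"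
proof (rule fps_ext)
  fix m
  define s where "s = m div j"
  let ?q = "q_part k j"
  have "fps_nth (\<Sum>i<?q. efps (\<lambda>l. if l = j then x j * cis (2 * pi * real i / real ?q) else 0)) m =
    (\<Sum>i<?q. if j dvd m then (x j ^ s / (of_nat j ^ s * fact s)) * cis (2 * pi * real i / real ?q) ^ s else 0)"
    unfolding efps_single[OF assms] fps_sum_nth
    by (intro sum.cong) (auto simp: s_def power_mult_distrib power_divide)
  also have "\<dots> = (if j dvd m then (x j ^ s / (of_nat j ^ s * fact s)) *
       (\<Sum>i<?q. cis (2 * pi * real i / real ?q) ^ s) else 0)"
    by (simp add: sum_distrib_left)
  also have "\<dots> = fps_nth (of_nat ?q * cycle_factor x k j) m"
    unfolding unity_root_filter[OF q_part_pos] fps_of_nat[symmetric]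
    by (simp add: cycle_factor_def s_def)
  finally show "fps_nth (of_nat ?q * cycle_factor x k j) m = 
      fps_nth (\<Sum>i<?q. efps (\<lambda>l. if l = j then x j * cis (2 * pi * real i / real ?q) else 0)) m" by simp
qed

lemma prod_by_card:
  fixes g :: "nat \<Rightarrow> 'a::comm_monoid_mult"
  assumes "finite S" "\<And>C. C \<in> S \<Longrightarrow> card C \<in> J" "finite J"
  shows "(\<Prod>C\<in>S. g (card C)) = (\<Prod>j\<in>J. g j ^ card {C \<in> S. card C = j})"
proof -
  have "(\<Prod>C\<in>S. g (card C)) = (\<Prod>j\<in>J. \<Prod>C\<in>{C \<in> S. card C = j}. g (card C))"
    by (rule prod.group[symmetric]) (use assms in auto)
  then show ?thesis by simp
qed

lemma fps_const_prod: "fps_const (\<Prod>i\<in>S. f i) = (\<Prod>i\<in>S. fps_const (f i))"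
  by (induction S rule: infinite_finite_induct) (auto simp flip: fps_const_mult)

text \<open>Being a k-th power is a condition on each cycle count separately. It is detected by
  multiplying every \<open>x j\<close> by a \<open>q_part k j\<close>-th root of unity and averaging
  over all choices; for a fixed choice the sum runs over the whole symmetric group and is an
  \<open>ecoef\<close>.\<close>

lemma sum_over_powers:
  fixes x :: "nat \<Rightarrow> complex"
  assumes "k > 0"
  shows "(\<Sum>\<sigma>\<in>sym_group_powers k n. \<Prod>C\<in>perm_cycles n \<sigma>. x (card C)) =
         fact n * fps_nth (\<Prod>j\<in>{1..n}. cycle_factor x k j) n"
proof -
  define q where "q = q_part k"
  have q: "q j > 0" for j by (simp add: q_def q_part_pos)
  define w where "w j i = cis (2 * pi * real i / real (q j))" for j i
  define Q where "Q = (\<Prod>j\<in>{1..n}. of_nat (q j) :: complex)"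
  have qnz: "q j \<noteq> 0" for j using q[of j] by simp
  have Q0: "Q \<noteq> 0" by (simp add: Q_def qnz)
  define Z where "Z = PiE {1..n} (\<lambda>j. {..<q j})"
  define xx where "xx \<iota> j = x j * w j (\<iota> j)" for \<iota> j
  \<comment> \<open>Truncated at n, so that \<open>efps (y \<iota>)\<close> is a finite product over
    single lengths; the n-th coefficient is that of \<open>xx \<iota>\<close>.\<close>
  define y where "y \<iota> j = (if j \<in> {1..n} then xx \<iota> j else 0)" for \<iota> j
  define P where "P = {\<sigma>. \<sigma> permutes {1..n}}"
  define cnt where "cnt \<sigma> j = card {C \<in> perm_cycles n \<sigma>. card C = j}" for \<sigma> j
  have cyc: "C \<in> perm_cycles n \<sigma> \<Longrightarrow> card C \<in> {1..n}" if "\<sigma> \<in> P" for C \<sigma>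
  proof -
    assume C: "C \<in> perm_cycles n \<sigma>"
    have s: "\<sigma> permutes {1..n}" using that by (simp add: P_def)
    have p: "permutation \<sigma>" using s by (auto simp: permutation_permutes)
    obtain a where a: "a \<in> {1..n}" "C = orbit \<sigma> a" using C by (auto simp: perm_cycles_def)
    have "C \<subseteq> {1..n}" using permutes_orbit_subset[OF s a(1)] a(2) by simp
    then have "card C \<le> n" using card_mono[of "{1..n}" C] by simp
    moreover have "card C > 0" using orbit_period(2)[OF p] a by simp
    ultimately show "card C \<in> {1..n}" by simp
  qed
  have fincyc: "finite (perm_cycles n \<sigma>)" for \<sigma> by (simp add: perm_cycles_def)
  have pow: "\<sigma> \<in> sym_group_powers k n \<longleftrightarrow> (\<forall>j\<in>{1..n}. q j dvd cnt \<sigma> j)" if "\<sigma> \<in> P" for \<sigma>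
  proof -
    have "cnt \<sigma> j = 0" if "j \<notin> {1..n}" for j
      using cyc[OF \<open>\<sigma> \<in> P\<close>] that fincyc by (auto simp: cnt_def)
    then have "(\<forall>j\<in>{1..n}. q j dvd cnt \<sigma> j) \<longleftrightarrow> (\<forall>j. q j dvd cnt \<sigma> j)"
      by (metis dvd_0_right)
    then show ?thesis
      using mem_sym_group_powers_iff[OF assms, of \<sigma> n] that by (simp add: P_def q_def cnt_def)
  qed
  have sub: "sym_group_powers k n \<subseteq> P"
    using mem_sym_group_powers_iff[OF assms] by (auto simp: P_def)
  have finP: "finite P" by (simp add: P_def finite_permutations)
  have finZ: "finite Z" by (simp add: Z_def finite_PiE)
  have "Q * fps_nth (\<Prod>j\<in>{1..n}. cycle_factor x k j) n =
        fps_nth (\<Prod>j\<in>{1..n}. of_nat (q j) * cycle_factor x k j) n"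
  proof -
    have "fps_const Q = (\<Prod>j\<in>{1..n}. of_nat (q j))"
      unfolding Q_def fps_of_nat[symmetric] by (rule fps_const_prod)
    then have "(\<Prod>j\<in>{1..n}. of_nat (q j) * cycle_factor x k j) =
        fps_const Q * (\<Prod>j\<in>{1..n}. cycle_factor x k j)"
      by (simp add: prod.distrib)
    then show ?thesis by simp
  qed
  also have "(\<Prod>j\<in>{1..n}. of_nat (q j) * cycle_factor x k j) =
      (\<Prod>j\<in>{1..n}. \<Sum>i\<in>{..<q j}. efps (\<lambda>l. if l = j then x j * w j i else 0))"
    unfolding q_def w_def by (rule prod.cong) (auto simp: cycle_factor_filter)
  also have "\<dots> = (\<Sum>\<iota>\<in>Z. \<Prod>j\<in>{1..n}. efps (\<lambda>l. if l = j then xx \<iota> j else 0))"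
    unfolding Z_def xx_def by (rule prod_sum_PiE) auto
  also have "\<dots> = (\<Sum>\<iota>\<in>Z. efps (y \<iota>))"
  proof (rule sum.cong)
    fix \<iota> assume "\<iota> \<in> Z"
    have "efps (y \<iota>) = efps (\<lambda>l. \<Sum>j\<in>{1..n}. if l = j then xx \<iota> j else 0)"
      by (rule arg_cong[of _ _ efps]) (auto simp: y_def fun_eq_iff)
    also have "\<dots> = (\<Prod>j\<in>{1..n}. efps (\<lambda>l. if l = j then xx \<iota> j else 0))"
      by (rule efps_sum) simp
    finally show "(\<Prod>j\<in>{1..n}. efps (\<lambda>l. if l = j then xx \<iota> j else 0)) = efps (y \<iota>)" ..
  qed simp
  finally have "fact n * (Q * fps_nth (\<Prod>j\<in>{1..n}. cycle_factor x k j) n) =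
      (\<Sum>\<iota>\<in>Z. fact n * ecoef (xx \<iota>) n)"
  proof -
    assume "Q * fps_nth (\<Prod>j\<in>{1..n}. cycle_factor x k j) n = fps_nth (\<Sum>\<iota>\<in>Z. efps (y \<iota>)) n"
    moreover have "ecoef (y \<iota>) n = ecoef (xx \<iota>) n" for \<iota>
      by (rule ecoef_cong) (simp add: y_def)
    ultimately show ?thesis by (simp add: fps_sum_nth sum_distrib_left)
  qed
  also have "\<dots> = (\<Sum>\<iota>\<in>Z. \<Sum>\<sigma>\<in>P. \<Prod>C\<in>perm_cycles n \<sigma>. xx \<iota> (card C))"
    using sum_multiplicative_perms[of "{1..n}" "xx _"] by (simp add: P_def perm_cycles_def)
  also have "\<dots> = (\<Sum>\<sigma>\<in>P. \<Sum>\<iota>\<in>Z. \<Prod>C\<in>perm_cycles n \<sigma>. xx \<iota> (card C))"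
    by (rule sum.swap)
  also have "\<dots> = (\<Sum>\<sigma>\<in>P. (if \<sigma> \<in> sym_group_powers k n then Q * (\<Prod>C\<in>perm_cycles n \<sigma>. x (card C)) else 0))"
  proof (rule sum.cong)
    fix \<sigma> assume s: "\<sigma> \<in> P"
    have "(\<Sum>\<iota>\<in>Z. \<Prod>C\<in>perm_cycles n \<sigma>. xx \<iota> (card C)) =
        (\<Sum>\<iota>\<in>Z. (\<Prod>C\<in>perm_cycles n \<sigma>. x (card C)) * (\<Prod>j\<in>{1..n}. w j (\<iota> j) ^ cnt \<sigma> j))"
    proof (rule sum.cong)
      fix \<iota>
      have "(\<Prod>C\<in>perm_cycles n \<sigma>. w (card C) (\<iota> (card C))) = (\<Prod>j\<in>{1..n}. w j (\<iota> j) ^ cnt \<sigma> j)"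
        unfolding cnt_def by (rule prod_by_card[OF fincyc]) (use cyc[OF s] in auto)
      then show "(\<Prod>C\<in>perm_cycles n \<sigma>. xx \<iota> (card C)) = 
          (\<Prod>C\<in>perm_cycles n \<sigma>. x (card C)) * (\<Prod>j\<in>{1..n}. w j (\<iota> j) ^ cnt \<sigma> j)"
        by (simp add: xx_def prod.distrib)
    qed simp
    \<comment> \<open>For a fixed permutation the sum over all choices of roots factorises over the
      lengths; each factor is \<open>q j\<close> or 0.\<close>
    also have "\<dots> = (\<Prod>C\<in>perm_cycles n \<sigma>. x (card C)) * (\<Prod>j\<in>{1..n}. \<Sum>i\<in>{..<q j}. w j i ^ cnt \<sigma> j)"
      unfolding Z_def by (subst prod_sum_PiE) (auto simp: sum_distrib_left)
    also have "(\<Prod>j\<in>{1..n}. \<Sum>i\<in>{..<q j}. w j i ^ cnt \<sigma> j) =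
        (\<Prod>j\<in>{1..n}. if q j dvd cnt \<sigma> j then of_nat (q j) else 0)"
      unfolding w_def by (rule prod.cong) (use unity_root_filter[OF q] in auto)
    also have "\<dots> = (if \<sigma> \<in> sym_group_powers k n then Q else 0)"
    proof (cases "\<sigma> \<in> sym_group_powers k n")
      case True
      then have "\<forall>j\<in>{1..n}. q j dvd cnt \<sigma> j" using pow[OF s] by simp
      then show ?thesis unfolding Q_def if_P[OF True] by (intro prod.cong) auto
    next
      case False
      then obtain j where "j \<in> {1..n}" "\<not> q j dvd cnt \<sigma> j" using pow[OF s] by blast
      then have "(\<Prod>j\<in>{1..n}. if q j dvd cnt \<sigma> j then of_nat (q j) else 0) = (0 :: complex)"
        by (intro prod_zero) auto
      then show ?thesis using False by simp
    qed
    finally show "(\<Sum>\<iota>\<in>Z. \<Prod>C\<in>perm_cycles n \<sigma>. xx \<iota> (card C)) =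
       (if \<sigma> \<in> sym_group_powers k n then Q * (\<Prod>C\<in>perm_cycles n \<sigma>. x (card C)) else 0)"
      by simp
  qed simp
  also have "\<dots> = Q * (\<Sum>\<sigma>\<in>sym_group_powers k n. \<Prod>C\<in>perm_cycles n \<sigma>. x (card C))"
    using finP sub by (simp add: sum.If_cases Int_absorb1 sum_distrib_left)
  finally show ?thesis using Q0 by (simp add: mult.left_commute)
qed

subsection \<open>Elementary estimates\<close>

lemma ecoef_nonneg:
  fixes y :: "nat \<Rightarrow> real"
  assumes "\<And>j. j \<ge> 1 \<Longrightarrow> y j \<ge> 0"
  shows "ecoef y n \<ge> 0"
proof (induction n rule: less_induct)
  case (less n)
  show ?case
  proof (cases "n = 0")
    case False
    have "0 \<le> (\<Sum>j=1..n. y j * ecoef y (n - j))"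
      using less assms by (intro sum_nonneg mult_nonneg_nonneg) auto
    then show ?thesis using False unfolding ecoef_rec[symmetric] by (simp add: zero_le_mult_iff)
  qed simp
qed

lemma norm_ecoef_le:
  fixes x :: "nat \<Rightarrow> complex" and y :: "nat \<Rightarrow> real"
  assumes "\<And>j. j \<ge> 1 \<Longrightarrow> cmod (x j) \<le> y j"
  shows "cmod (ecoef x n) \<le> ecoef y n"
proof (induction n rule: less_induct)
  case (less n)
  have y0: "y j \<ge> 0" if "j \<ge> 1" for j using assms[OF that] norm_ge_zero order_trans by blast
  show ?case
  proof (cases "n = 0")
    case False
    have "real n * cmod (ecoef x n) = cmod (of_nat n * ecoef x n)" by (simp add: norm_mult)
    also have "\<dots> \<le> (\<Sum>j=1..n. cmod (x j * ecoef x (n - j)))"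
      unfolding ecoef_rec by (rule norm_sum)
    also have "\<dots> \<le> (\<Sum>j=1..n. y j * ecoef y (n - j))"
      unfolding norm_mult using less assms y0 by (intro sum_mono mult_mono) auto
    also have "\<dots> = real n * ecoef y n" by (simp add: ecoef_rec)
    finally show ?thesis using False by simp
  qed simp
qed

lemma ecoef_of_real: "ecoef (\<lambda>j. of_real (y j) :: complex) n = of_real (ecoef y n)"
proof (induction n rule: less_induct)
  case (less n)
  show ?case
  proof (cases "n = 0")
    case False
    have "of_nat n * ecoef (\<lambda>j. of_real (y j) :: complex) n = (\<Sum>j=1..n. of_real (y j * ecoef y (n - j)))"
      unfolding ecoef_rec using less by (intro sum.cong) auto
    also have "\<dots> = of_real (real n * ecoef y n)" unfolding ecoef_rec by simp
    finally show ?thesis using False by simp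
  qed simp
qed

lemma ecoef_mono:
  fixes x y :: "nat \<Rightarrow> real"
  assumes "\<And>j. j \<ge> 1 \<Longrightarrow> 0 \<le> x j" "\<And>j. j \<ge> 1 \<Longrightarrow> x j \<le> y j"
  shows "ecoef x n \<le> ecoef y n"
proof -
  have "cmod (ecoef (\<lambda>j. of_real (x j)) n) \<le> ecoef y n"
    by (rule norm_ecoef_le) (use assms in auto)
  then show ?thesis using ecoef_nonneg[of x n] assms by (simp add: ecoef_of_real)
qed

text \<open>The pairs (i, j) with i + j <= n lie in the square of pairs with both entries at most
  n.\<close>

lemma sum_fps_mult_le:
  fixes F G :: "real fps"
  assumes "\<And>n. fps_nth F n \<ge> 0" "\<And>n. fps_nth G n \<ge> 0"
  shows "(\<Sum>m\<le>n. fps_nth (F * G) m) \<le> (\<Sum>m\<le>n. fps_nth F m) * (\<Sum>m\<le>n. fps_nth G m)"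
proof -
  have "(\<Sum>m\<le>n. fps_nth (F * G) m) = (\<Sum>m\<le>n. \<Sum>i\<le>m. fps_nth F i * fps_nth G (m - i))"
    by (simp add: fps_mult_nth atLeast0AtMost)
  also have "\<dots> = (\<Sum>(i,j)\<in>{(i,j). i + j \<le> n}. fps_nth F i * fps_nth G j)"
    by (rule sum.triangle_reindex_eq[symmetric])
  also have "\<dots> \<le> (\<Sum>(i,j)\<in>{..n} \<times> {..n}. fps_nth F i * fps_nth G j)"
    by (rule sum_mono2) (use assms in auto)
  also have "\<dots> = (\<Sum>m\<le>n. fps_nth F m) * (\<Sum>m\<le>n. fps_nth G m)"
    by (simp add: sum_product sum.cartesian_product)
  finally show ?thesis .
qed

lemma fps_prod_nonneg:
  fixes F :: "'b \<Rightarrow> real fps"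
  assumes "\<And>i n. i \<in> S \<Longrightarrow> fps_nth (F i) n \<ge> 0"
  shows "fps_nth (\<Prod>i\<in>S. F i) n \<ge> 0"
  using assms
proof (induction S arbitrary: n rule: infinite_finite_induct)
  case (insert a S)
  then show ?case by (auto simp: fps_mult_nth intro!: sum_nonneg mult_nonneg_nonneg)
qed (auto simp: fps_one_nth)

lemma sum_fps_prod_le:
  fixes F :: "'b \<Rightarrow> real fps"
  assumes "finite S" "\<And>i n. i \<in> S \<Longrightarrow> fps_nth (F i) n \<ge> 0"
  shows "(\<Sum>m\<le>n. fps_nth (\<Prod>i\<in>S. F i) m) \<le> (\<Prod>i\<in>S. \<Sum>m\<le>n. fps_nth (F i) m)"
  using assms
proof (induction S rule: finite_induct)
  case empty
  have "(\<Sum>m\<le>n. if m = 0 then 1 else 0) = (1::real)" by simp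
  then show ?case by (simp add: fps_one_nth)
next
  case (insert a S)
  have "(\<Sum>m\<le>n. fps_nth (F a * (\<Prod>i\<in>S. F i)) m) \<le>
        (\<Sum>m\<le>n. fps_nth (F a) m) * (\<Sum>m\<le>n. fps_nth (\<Prod>i\<in>S. F i) m)"
    using insert by (intro sum_fps_mult_le fps_prod_nonneg) auto
  also have "\<dots> \<le> (\<Sum>m\<le>n. fps_nth (F a) m) * (\<Prod>i\<in>S. \<Sum>m\<le>n. fps_nth (F i) m)"
    using insert by (intro mult_left_mono sum_nonneg) auto
  finally show ?case using insert by simp
qed

text \<open>Up to degree n the series is a finite product of the exponentials for single j, partial
  sums of nonnegative series are submultiplicative, and the coefficients of one factor sum to at
  most exp(y j / j).\<close>

lemma sum_ecoef_le:
  fixes y :: "nat \<Rightarrow> real"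
  assumes "\<And>j. j \<ge> 1 \<Longrightarrow> y j \<ge> 0"
  shows "(\<Sum>m\<le>n. ecoef y m) \<le> exp (\<Sum>j=1..n. y j / real j)"
proof -
  define F where "F j = efps (\<lambda>l. if l = j then y j else 0)" for j
  have Fn: "fps_nth (F j) m \<ge> 0" if "j \<in> {1..n}" for j m
    unfolding F_def efps_nth by (rule ecoef_nonneg) (use assms in auto)
  have "(\<Sum>m\<le>n. ecoef y m) = (\<Sum>m\<le>n. fps_nth (\<Prod>j\<in>{1..n}. F j) m)"
  proof (rule sum.cong)
    fix m assume m: "m \<in> {..n}"
    have "ecoef y m = ecoef (\<lambda>l. \<Sum>j\<in>{1..n}. if l = j then y j else 0) m"
      by (rule ecoef_cong) (use m in auto)
    also have "\<dots> = fps_nth (\<Prod>j\<in>{1..n}. F j) m"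
      unfolding F_def by (simp only: efps_sum[OF finite_atLeastAtMost, symmetric] efps_nth)
    finally show "ecoef y m = fps_nth (\<Prod>j\<in>{1..n}. F j) m" .
  qed simp
  also have "\<dots> \<le> (\<Prod>j\<in>{1..n}. \<Sum>m\<le>n. fps_nth (F j) m)"
    by (rule sum_fps_prod_le) (use Fn in auto)
  also have "\<dots> \<le> (\<Prod>j\<in>{1..n}. exp (y j / real j))"
  proof (rule prod_mono, safe)
    fix j assume j: "j \<in> {1..n}"
    show "0 \<le> (\<Sum>m\<le>n. fps_nth (F j) m)" using Fn[OF j] by (intro sum_nonneg) auto
    let ?c = "y j / real j"
    have c: "?c \<ge> 0" using assms j by auto
    have "(\<Sum>m\<le>n. fps_nth (F j) m) = (\<Sum>m\<le>n. if j dvd m then ?c ^ (m div j) / fact (m div j) else 0)"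
      unfolding F_def using j by (subst efps_single) auto
    also have "\<dots> = (\<Sum>m\<in>{m. m \<le> n \<and> j dvd m}. ?c ^ (m div j) / fact (m div j))"
      by (rule sum.mono_neutral_cong_right) auto
    also have "\<dots> = (\<Sum>s\<in>(\<lambda>m. m div j) ` {m. m \<le> n \<and> j dvd m}. ?c ^ s / fact s)"
    proof (rule sum.reindex[symmetric, unfolded o_def])
      show "inj_on (\<lambda>m. m div j) {m. m \<le> n \<and> j dvd m}"
        by (intro inj_onI) (metis (mono_tags) dvd_div_eq_iff mem_Collect_eq)
    qed
    also have "\<dots> \<le> (\<Sum>s. ?c ^ s / fact s)"
    proof (rule sum_le_suminf)
      show "summable (\<lambda>s. ?c ^ s / fact s)" using summable_exp[of ?c] by (simp add: field_simps)
    qed (use c in auto)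
    also have "\<dots> = exp ?c" by (simp add: exp_def field_simps)
    finally show "(\<Sum>m\<le>n. fps_nth (F j) m) \<le> exp ?c" .
  qed
  also have "\<dots> = exp (\<Sum>j=1..n. y j / real j)" by (rule exp_sum[symmetric]) simp
  finally show ?thesis .
qed

section \<open>Logarithmic sums with periodic weights\<close>

lemma inverse_Suc_le_ln:
  assumes "a > (0::real)"
  shows "1 / (a + 1) \<le> ln (a + 1) - ln a"
proof -
  have "ln (a / (a + 1)) \<le> a / (a + 1) - 1" using assms by (intro ln_le_minus_one) auto
  also have "\<dots> = - (1 / (a + 1))" using assms by (simp add: field_simps)
  finally show ?thesis using assms by (simp add: ln_div)
qed

lemma harmonic_bounds:
  assumes "n \<ge> 1"
  shows "\<bar>(\<Sum>j=1..n. 1 / real j) - ln (real n)\<bar> \<le> 1"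
proof -
  have eq: "(\<Sum>j=1..n. 1 / real j) = harm n" by (simp add: harm_def inverse_eq_divide)
  have "ln (real n) \<le> ln (real n + 1)" using assms by simp
  then have 1: "ln (real n) \<le> harm n" using ln_le_harm[of n] by simp
  have "(\<Sum>j=1..n. 1 / real j) \<le> 1 + ln (real n)"
    using assms
  proof (induction n rule: dec_induct)
    case (step m)
    have "1 / (real m + 1) \<le> ln (real m + 1) - ln (real m)" using step by (intro inverse_Suc_le_ln) simp
    then show ?case using step by (simp add: add.commute)
  qed simp
  then show ?thesis using 1 eq by simp
qed

text \<open>After subtraction of the mean M the partial sums \<open>G\<close> are periodic, hence
  bounded, and summation by parts bounds the sum of a j / j. The mean contributes M times a harmonic
  sum.\<close>

lemma log_sum_periodic:
  fixes g :: "nat \<Rightarrow> real"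
  assumes "k > 0" "\<And>j. g (j + k) = g j"
  shows "\<exists>C\<ge>0. \<forall>n\<ge>1. \<bar>(\<Sum>j=1..n. g j / real j) - (\<Sum>j=1..k. g j) / real k * ln (real n)\<bar> \<le> C"
proof -
  define M where "M = (\<Sum>j=1..k. g j) / real k"
  define a where "a j = g j - M" for j
  define G where "G n = (\<Sum>j=1..n. a j)" for n
  define K where "K = (\<Sum>j=1..k. \<bar>a j\<bar>)"
  have aper: "a (j + k) = a j" for j by (simp add: a_def assms)
  have Gk: "G k = 0" using assms(1) by (simp add: G_def a_def sum_subtractf M_def)
  have Gper: "G (n + k) = G n" for n
  proof -
    have "G (n + k) = G k + (\<Sum>j=k+1..k+n. a j)"
      unfolding G_def using sum.ub_add_nat[of 1 k a n] by (simp add: add.commute)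
    also have "(\<Sum>j=k+1..k+n. a j) = (\<Sum>j=1..n. a (j + k))"
      using sum.shift_bounds_cl_nat_ivl[of a 1 k n] by (simp add: add.commute)
    finally show ?thesis using Gk by (simp add: aper G_def)
  qed
  have Gmod: "G n = G (n mod k)" for n
  proof (induction n rule: less_induct)
    case (less n)
    show ?case
    proof (cases "n < k")
      case False
      then have "G n = G (n - k)" using Gper[of "n - k"] by simp
      also have "\<dots> = G (n mod k)" using less[of "n - k"] False assms(1) by (simp add: le_mod_geq)
      finally show ?thesis .
    qed simp
  qed
  have GK: "\<bar>G n\<bar> \<le> K" for n
  proof -
    have "\<bar>G n\<bar> \<le> (\<Sum>j=1..n mod k. \<bar>a j\<bar>)" unfolding Gmod[of n] unfolding G_def by (rule sum_abs)
    also have "\<dots> \<le> K" unfolding K_def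
      by (rule sum_mono2) (use assms(1) mod_less_divisor[of k n] in auto)
    finally show ?thesis .
  qed
  have K0: "K \<ge> 0" by (simp add: K_def sum_nonneg)
  have abel: "(\<Sum>j=1..n. a j / real j) = G n / (real n + 1) + (\<Sum>j=1..n. G j * (1 / real j - 1 / (real j + 1)))" for n
  proof (induction n)
    case (Suc n)
    have "G (Suc n) = G n + a (Suc n)" by (simp add: G_def)
    then show ?case using Suc by (simp add: algebra_simps add_divide_distrib)
  qed (simp add: G_def)
  have tel: "(\<Sum>j=1..n. K * (1 / real j - 1 / (real j + 1))) = K * (1 - 1 / (real n + 1))" for n
    by (induction n) (auto simp: algebra_simps)
  have bound: "\<bar>\<Sum>j=1..n. a j / real j\<bar> \<le> K" for n
  proof -
    have "\<bar>\<Sum>j=1..n. a j / real j\<bar> \<le> \<bar>G n / (real n + 1)\<bar> + \<bar>\<Sum>j=1..n. G j * (1 / real j - 1 / (real j + 1))\<bar>"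
      unfolding abel by (rule abs_triangle_ineq)
    also have "\<bar>G n / (real n + 1)\<bar> \<le> K / (real n + 1)"
      using GK[of n] by (simp add: divide_right_mono)
    also have "\<bar>\<Sum>j=1..n. G j * (1 / real j - 1 / (real j + 1))\<bar> \<le>
        (\<Sum>j=1..n. K * (1 / real j - 1 / (real j + 1)))"
    proof (rule order_trans[OF sum_abs sum_mono])
      fix j assume "j \<in> {1..n}"
      then have "1 / real j - 1 / (real j + 1) \<ge> 0" by (simp add: field_simps)
      then show "\<bar>G j * (1 / real j - 1 / (real j + 1))\<bar> \<le> K * (1 / real j - 1 / (real j + 1))"
        using GK[of j] by (simp add: abs_mult mult_right_mono)
    qed
    finally show ?thesis unfolding tel by (simp add: algebra_simps)
  qed
  have "\<bar>(\<Sum>j=1..n. g j / real j) - M * ln (real n)\<bar> \<le> K + \<bar>M\<bar>" if n: "n \<ge> 1" for n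
  proof -
    have "(\<Sum>j=1..n. g j / real j) = (\<Sum>j=1..n. a j / real j) + M * (\<Sum>j=1..n. 1 / real j)"
      by (simp add: a_def diff_divide_distrib sum_subtractf sum_distrib_left)
    then have "(\<Sum>j=1..n. g j / real j) - M * ln (real n) =
        (\<Sum>j=1..n. a j / real j) + M * ((\<Sum>j=1..n. 1 / real j) - ln (real n))"
      by (simp add: algebra_simps)
    also have "\<bar>\<dots>\<bar> \<le> \<bar>\<Sum>j=1..n. a j / real j\<bar> + \<bar>M\<bar> * \<bar>(\<Sum>j=1..n. 1 / real j) - ln (real n)\<bar>"
      unfolding abs_mult[symmetric] by (rule abs_triangle_ineq)
    also have "\<dots> \<le> K + \<bar>M\<bar> * 1"
      using bound[of n] harmonic_bounds[OF n] by (intro add_mono mult_left_mono) auto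
    finally show ?thesis by simp
  qed
  then show ?thesis using K0 unfolding M_def by (intro exI[of _ "K + \<bar>M\<bar>"]) (auto simp: M_def)
qed

section \<open>Hoelder's inequality and sums of powers\<close>

lemma Holder_sum:
  fixes a b :: "'b \<Rightarrow> real"
  assumes "finite S" "p > 1" "q > 1" "1/p + 1/q = 1"
    and "\<And>i. i \<in> S \<Longrightarrow> a i \<ge> 0" "\<And>i. i \<in> S \<Longrightarrow> b i \<ge> 0"
  shows "(\<Sum>i\<in>S. a i * b i) \<le> (\<Sum>i\<in>S. a i powr p) powr (1/p) * (\<Sum>i\<in>S. b i powr q) powr (1/q)"
proof -
  define A where "A = (\<Sum>i\<in>S. a i powr p)"
  define B where "B = (\<Sum>i\<in>S. b i powr q)"
  have nn: "A \<ge> 0" "B \<ge> 0" by (auto simp: A_def B_def intro!: sum_nonneg)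
  show ?thesis
  proof (cases "A = 0 \<or> B = 0")
    case True
    then have "\<forall>i\<in>S. a i * b i = 0"
      using assms by (auto simp: A_def B_def sum_nonneg_eq_0_iff)
    then have "(\<Sum>i\<in>S. a i * b i) = 0" by (intro sum.neutral) auto
    then show ?thesis by simp
  next
    case False
    then have pos: "A > 0" "B > 0" using nn by auto
    \<comment> \<open>Young's inequality term by term, after both families are normalised to norm
      1.\<close>
    have "(\<Sum>i\<in>S. (a i / A powr (1/p)) * (b i / B powr (1/q))) \<le>
          (\<Sum>i\<in>S. (a i powr p / A) / p + (b i powr q / B) / q)"
    proof (rule sum_mono)
      fix i assume i: "i \<in> S"
      have "(a i / A powr (1/p)) powr p = a i powr p / A" "(b i / B powr (1/q)) powr q = b i powr q / B"
        using assms i pos by (simp_all add: powr_divide powr_powr)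
      then show "(a i / A powr (1/p)) * (b i / B powr (1/q)) \<le> (a i powr p / A) / p + (b i powr q / B) / q"
        using Youngs_inequality[OF assms(2-4), of "a i / A powr (1/p)" "b i / B powr (1/q)"] assms i by simp
    qed
    also have "\<dots> = 1"
      using pos assms(4) by (simp add: sum.distrib A_def[symmetric] B_def[symmetric] flip: sum_divide_distrib)
    also have "(\<Sum>i\<in>S. (a i / A powr (1/p)) * (b i / B powr (1/q))) =
        (\<Sum>i\<in>S. a i * b i) / (A powr (1/p) * B powr (1/q))"
      by (simp add: sum_divide_distrib)
    finally have "(\<Sum>i\<in>S. a i * b i) \<le> A powr (1/p) * B powr (1/q)"
      using pos by (simp add: field_simps)
    then show ?thesis by (simp add: A_def B_def)
  qed
qed

lemma powr_diff_ge:
  assumes "0 < s" "s \<le> 1" "a > (0::real)"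
  shows "s * (a + 1) powr (s - 1) \<le> (a + 1) powr s - a powr s"
proof -
  have "\<exists>z::real. a < z \<and> z < a + 1 \<and> (a + 1) powr s - a powr s = (a + 1 - a) * (s * z powr (s - 1))"
    by (rule MVT2) (use assms in simp, rule has_real_derivative_powr, use assms in simp)
  then obtain z where z: "a < z" "z < a + 1" "(a + 1) powr s - a powr s = s * z powr (s - 1)" by auto
  have "(a + 1) powr (s - 1) \<le> z powr (s - 1)"
    using z assms by (intro powr_mono2') auto
  then show ?thesis using z assms by simp
qed

lemma sum_powr_le:
  assumes "0 < s" "s \<le> 1"
  shows "(\<Sum>m=1..n. real m powr (s - 1)) \<le> real n powr s / s"
proof (induction n)
  case (Suc n)
  have "s * (real n + 1) powr (s - 1) \<le> (real n + 1) powr s - real n powr s"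
  proof (cases "n = 0")
    case False
    then show ?thesis using powr_diff_ge[OF assms, of "real n"] by simp
  qed (use assms in simp)
  then have "(real n + 1) powr (s - 1) \<le> ((real n + 1) powr s - real n powr s) / s"
    using assms by (simp add: field_simps)
  then show ?case using Suc by (simp add: diff_divide_distrib add.commute)
qed simp

lemma powr_tail_diff_ge:
  assumes "q > 1" "a > (0::real)"
  shows "(q - 1) * (a + 1) powr (- q) \<le> a powr (1 - q) - (a + 1) powr (1 - q)"
proof -
  have "\<exists>z::real. a < z \<and> z < a + 1 \<and> (a + 1) powr (1 - q) - a powr (1 - q) = (a + 1 - a) * ((1 - q) * z powr (1 - q - 1))"
    by (rule MVT2) (use assms in simp, rule has_real_derivative_powr, use assms in simp)
  then obtain z where z: "a < z" "z < a + 1" "(a + 1) powr (1 - q) - a powr (1 - q) = (1 - q) * z powr (- q)" by auto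
  have "(a + 1) powr (- q) \<le> z powr (- q)"
    using z assms by (intro powr_mono2') auto
  then have "(q - 1) * (a + 1) powr (- q) \<le> (q - 1) * z powr (- q)" using assms by simp
  then show ?thesis using z by (simp add: algebra_simps)
qed

lemma sum_powr_tail_le:
  assumes "q > 1" "J \<ge> 1"
  shows "(\<Sum>j\<in>{J<..n}. real j powr (- q)) \<le> real J powr (1 - q) / (q - 1)"
proof -
  have "(\<Sum>j\<in>{J<..n}. real j powr (- q)) \<le> (real J powr (1 - q) - real n powr (1 - q)) / (q - 1)" if "J \<le> n"
    using that
  proof (induction n rule: dec_induct)
    case (step m)
    have *: "{J<..Suc m} = insert (Suc m) {J<..m}" using step by auto
    have "(q - 1) * (real m + 1) powr (- q) \<le> real m powr (1 - q) - (real m + 1) powr (1 - q)"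
      using step assms by (intro powr_tail_diff_ge) auto
    then have "(real m + 1) powr (- q) \<le> (real m powr (1 - q) - (real m + 1) powr (1 - q)) / (q - 1)"
      using assms by (simp add: field_simps)
    then show ?case using step unfolding * by (simp add: diff_divide_distrib add.commute)
  qed simp
  moreover have "\<dots> \<le> real J powr (1 - q) / (q - 1)" using assms by (intro divide_right_mono) auto
  ultimately show ?thesis using assms by (cases "J \<le> n") auto
qed

section \<open>The principal character modulo k and the coefficients of B\<close>

definition chi :: "nat \<Rightarrow> nat \<Rightarrow> real" where
  "chi k j = (if coprime j k then 1 else 0)"

definition dens :: "nat \<Rightarrow> real" where
  "dens k = real (totient k) / real k"

lemma chi_bounds: "0 \<le> chi k j" "chi k j \<le> 1"
  by (auto simp: chi_def)

lemma chi_add: "chi k (j + k) = chi k j"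
  by (simp add: chi_def coprime_iff_gcd_eq_1)

lemma sum_chi: "(\<Sum>j=1..k. chi k j) = real (totient k)"
proof -
  have "(\<Sum>j=1..k. chi k j) = (\<Sum>j\<in>totatives k. 1)"
    unfolding chi_def totatives_def
    by (rule sum.mono_neutral_cong_right) (auto simp: Suc_le_eq)
  then show ?thesis by (simp add: totient_def)
qed

lemma dens_pos: "k > 0 \<Longrightarrow> dens k > 0"
  by (simp add: dens_def)

lemma dens_le_1: "dens k \<le> 1"
  using totient_le[of k] by (cases "k = 0") (auto simp: dens_def)

lemma ecoef_chi_nonneg: "ecoef (chi k) n \<ge> 0"
  by (rule ecoef_nonneg) (simp add: chi_bounds)

lemma log_sum_chi:
  assumes "k > 0"
  shows "\<exists>C\<ge>0. \<forall>n\<ge>1. \<bar>(\<Sum>j=1..n. chi k j / real j) - dens k * ln (real n)\<bar> \<le> C"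
  using log_sum_periodic[OF assms, of "chi k", OF chi_add] unfolding sum_chi dens_def .

lemma sum_ecoef_chi_le:
  assumes "k > 0"
  shows "\<exists>C>0. \<forall>n\<ge>1. (\<Sum>m\<le>n. ecoef (chi k) m) \<le> C * real n powr dens k"
proof -
  obtain K where K: "\<And>n. n \<ge> 1 \<Longrightarrow> \<bar>(\<Sum>j=1..n. chi k j / real j) - dens k * ln (real n)\<bar> \<le> K"
    using log_sum_chi[OF assms] by blast
  have "(\<Sum>m\<le>n. ecoef (chi k) m) \<le> exp K * real n powr dens k" if n: "n \<ge> 1" for n
  proof -
    have "(\<Sum>m\<le>n. ecoef (chi k) m) \<le> exp (\<Sum>j=1..n. chi k j / real j)"
      by (rule sum_ecoef_le) (simp add: chi_bounds)
    also have "\<dots> \<le> exp (K + dens k * ln (real n))" using K[OF n] by simp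
    also have "\<dots> = exp K * real n powr dens k" using n by (simp add: exp_add powr_def)
    finally show ?thesis .
  qed
  then show ?thesis by (intro exI[of _ "exp K"]) auto
qed

text \<open>As chi <= 1, the recursion bounds n times the n-th coefficient by the partial sum up to
  n, which saves a factor n.\<close>

lemma ecoef_chi_le:
  assumes "k > 0"
  shows "\<exists>C>0. \<forall>n\<ge>1. ecoef (chi k) n \<le> C * real n powr (dens k - 1)"
proof -
  obtain C where C: "C > 0" "\<And>n. n \<ge> 1 \<Longrightarrow> (\<Sum>m\<le>n. ecoef (chi k) m) \<le> C * real n powr dens k"
    using sum_ecoef_chi_le[OF assms] by blast
  have "ecoef (chi k) n \<le> C * real n powr (dens k - 1)" if n: "n \<ge> 1" for n
  proof -
    have "real n * ecoef (chi k) n = (\<Sum>j=1..n. chi k j * ecoef (chi k) (n - j))" by (rule ecoef_rec)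
    also have "\<dots> \<le> (\<Sum>j=1..n. ecoef (chi k) (n - j))"
      using chi_bounds ecoef_chi_nonneg by (intro sum_mono mult_left_le_one_le) auto
    also have "\<dots> \<le> (\<Sum>m\<le>n. ecoef (chi k) m)"
    proof -
      have "(\<Sum>j=1..n. ecoef (chi k) (n - j)) = (\<Sum>m<n. ecoef (chi k) m)"
        by (rule sum.reindex_bij_witness[of _ "\<lambda>m. n - m" "\<lambda>j. n - j"]) auto
      also have "\<dots> \<le> (\<Sum>m\<le>n. ecoef (chi k) m)" using ecoef_chi_nonneg by (intro sum_mono2) auto
      finally show ?thesis .
    qed
    also have "\<dots> \<le> C * real n powr dens k" by (rule C(2)[OF n])
    finally show ?thesis using n by (simp add: powr_diff field_simps)
  qed
  then show ?thesis using C(1) by blast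
qed

text \<open>
  The coefficients complementary to \<^term>\<open>ecoef (chi k)\<close> multiply with it to the
  geometric series, so an upper bound for their sums is a lower bound here.
\<close>

lemma sum_ecoef_chi_ge:
  assumes "k > 0"
  shows "\<exists>c>0. \<forall>n\<ge>1. c * real n powr dens k \<le> (\<Sum>m\<le>n. ecoef (chi k) m)"
proof -
  obtain K where K: "\<And>n. n \<ge> 1 \<Longrightarrow> \<bar>(\<Sum>j=1..n. chi k j / real j) - dens k * ln (real n)\<bar> \<le> K"
    using log_sum_chi[OF assms] by blast
  define chi' where "chi' j = 1 - chi k j" for j
  have chi': "chi' j \<ge> 0" for j by (simp add: chi'_def chi_bounds)
  have one: "ecoef (\<lambda>j. 1 :: real) n = 1" for n
  proof (induction n rule: less_induct)
    case (less n)
    show ?case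
    proof (cases "n = 0")
      case False
      have "real n * ecoef (\<lambda>j. 1 :: real) n = (\<Sum>j=1..n. 1)"
        unfolding ecoef_rec using less by (intro sum.cong) auto
      then show ?thesis using False by simp
    qed simp
  qed
  have "exp (- K - 1) * real n powr dens k \<le> (\<Sum>m\<le>n. ecoef (chi k) m)" if n: "n \<ge> 1" for n
  proof -
    have "efps (\<lambda>j. 1 :: real) = efps (chi k) * efps chi'"
      using efps_add[of "chi k" chi'] by (simp add: chi'_def)
    then have "(\<Sum>m\<le>n. fps_nth (efps (\<lambda>j. 1 :: real)) m) \<le> (\<Sum>m\<le>n. ecoef (chi k) m) * (\<Sum>m\<le>n. ecoef chi' m)"
      using sum_fps_mult_le[of "efps (chi k)" "efps chi'" n] ecoef_chi_nonneg ecoef_nonneg[of chi'] chi' by simp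
    then have "real n \<le> (\<Sum>m\<le>n. ecoef (chi k) m) * (\<Sum>m\<le>n. ecoef chi' m)" by (simp add: one)
    also have "\<dots> \<le> (\<Sum>m\<le>n. ecoef (chi k) m) * exp (\<Sum>j=1..n. chi' j / real j)"
      using ecoef_chi_nonneg chi' by (intro mult_left_mono sum_ecoef_le sum_nonneg) auto
    also have "\<dots> \<le> (\<Sum>m\<le>n. ecoef (chi k) m) * exp (K + 1 + (1 - dens k) * ln (real n))"
    proof (rule mult_left_mono)
      have "(\<Sum>j=1..n. chi' j / real j) = (\<Sum>j=1..n. 1 / real j) - (\<Sum>j=1..n. chi k j / real j)"
        by (simp add: chi'_def diff_divide_distrib sum_subtractf)
      then show "exp (\<Sum>j=1..n. chi' j / real j) \<le> exp (K + 1 + (1 - dens k) * ln (real n))"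
        using K[OF n] harmonic_bounds[OF n] by (simp add: algebra_simps abs_le_iff)
    qed (use ecoef_chi_nonneg in \<open>intro sum_nonneg, auto\<close>)
    also have "exp (K + 1 + (1 - dens k) * ln (real n)) = real n / (exp (- K - 1) * real n powr dens k)"
      using n by (simp add: powr_def exp_add exp_diff exp_minus field_simps)
    finally have "1 \<le> (\<Sum>m\<le>n. ecoef (chi k) m) / (exp (- K - 1) * real n powr dens k)"
      using n by (simp add: field_simps)
    then show ?thesis using n by (simp add: field_simps)
  qed
  then show ?thesis by (intro exI[of _ "exp (- K - 1)"]) auto
qed

text \<open>Hoelder's inequality with conjugate exponent q: the q-th powers of the coefficients sum
  to O(n powr s) with s = q (dens k - 1 / p), and s > 0 is the assumption on p. With \<delta> j =
  |fhat j - 1| the left side is the error of smoothing.\<close>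

lemma weighted_sum_le:
  assumes k: "k > 0" and p: "p > 1" "1 / p < dens k"
  shows "\<exists>C>0. \<forall>n n' \<delta>. 1 \<le> n' \<longrightarrow> n' \<le> n \<longrightarrow> (\<forall>j. 0 \<le> \<delta> j) \<longrightarrow>
     (\<Sum>j=1..n'. \<delta> j * ecoef (chi k) (n' - j)) \<le>
     C * real n powr dens k * ((\<Sum>j=1..n. \<delta> j powr p) / real n) powr (1/p)"
proof -
  define a where "a = dens k"
  define q where "q = p / (p - 1)"
  have q: "q > 1" "1/p + 1/q = 1" using p by (auto simp: q_def field_simps)
  obtain C where C: "C > 0" "\<And>n. n \<ge> 1 \<Longrightarrow> ecoef (chi k) n \<le> C * real n powr (a - 1)"
    using ecoef_chi_le[OF k] unfolding a_def by blast
  define s where "s = 1 - (1 - a) * q"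
  have sq: "s = q * (a - 1 / p)" using q p by (simp add: s_def q_def field_simps)
  have s: "s > 0" using sq q p by (simp add: a_def)
  have s1: "s \<le> 1" using q dens_le_1[of k] by (simp add: a_def s_def)
  \<comment> \<open>The summand 1 is for the coefficient of index 0, which equals 1 and is not
    covered by the bound with \<open>C\<close>.\<close>
  define C' where "C' = 1 + C powr q / s"
  have C': "C' > 0" using C s by (simp add: C'_def add_pos_nonneg)
  have "(\<Sum>j=1..n'. \<delta> j * ecoef (chi k) (n' - j)) \<le>
     C' powr (1/q) * real n powr a * ((\<Sum>j=1..n. \<delta> j powr p) / real n) powr (1/p)"
    if n: "1 \<le> n'" "n' \<le> n" and d: "\<forall>j. 0 \<le> \<delta> j" for n n' \<delta>
  proof -
    define D where "D = (\<Sum>j=1..n. \<delta> j powr p)"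
    have D0: "D \<ge> 0" by (simp add: D_def sum_nonneg)
    have "(\<Sum>j=1..n'. ecoef (chi k) (n' - j) powr q) = (\<Sum>m<n'. ecoef (chi k) m powr q)"
      by (rule sum.reindex_bij_witness[of _ "\<lambda>m. n' - m" "\<lambda>j. n' - j"]) auto
    also have "\<dots> \<le> (\<Sum>m\<le>n. ecoef (chi k) m powr q)"
      using n by (intro sum_mono2) auto
    also have "\<dots> = 1 + (\<Sum>m=1..n. ecoef (chi k) m powr q)"
      by (simp add: atMost_atLeast0 sum.atLeast_Suc_atMost)
    also have "(\<Sum>m=1..n. ecoef (chi k) m powr q) \<le> (\<Sum>m=1..n. C powr q * real m powr (s - 1))"
    proof (rule sum_mono)
      fix m assume m: "m \<in> {1..n}"
      have "ecoef (chi k) m powr q \<le> (C * real m powr (a - 1)) powr q"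
        using C(2)[of m] m q ecoef_chi_nonneg by (intro powr_mono2) auto
      also have "\<dots> = C powr q * real m powr (s - 1)"
        using C(1) m by (simp add: powr_mult powr_powr s_def algebra_simps)
      finally show "ecoef (chi k) m powr q \<le> C powr q * real m powr (s - 1)" .
    qed
    also have "\<dots> \<le> C powr q * (real n powr s / s)"
      unfolding sum_distrib_left[symmetric] using s s1 by (intro mult_left_mono sum_powr_le) auto
    also have "1 + C powr q * (real n powr s / s) \<le> C' * real n powr s"
      using n s ge_one_powr_ge_zero[of "real n" s] by (simp add: C'_def algebra_simps)
    finally have B: "(\<Sum>j=1..n'. ecoef (chi k) (n' - j) powr q) \<le> C' * real n powr s" by simp
    have "(\<Sum>j=1..n'. \<delta> j * ecoef (chi k) (n' - j)) \<le>
        (\<Sum>j=1..n'. \<delta> j powr p) powr (1/p) * (\<Sum>j=1..n'. ecoef (chi k) (n' - j) powr q) powr (1/q)"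
      by (rule Holder_sum) (use p q d ecoef_chi_nonneg in auto)
    also have "\<dots> \<le> D powr (1/p) * (C' * real n powr s) powr (1/q)"
    proof (intro mult_mono powr_mono2)
      show "(\<Sum>j=1..n'. \<delta> j powr p) \<le> D" unfolding D_def using n by (intro sum_mono2) auto
    qed (use B p q in \<open>auto intro!: sum_nonneg\<close>)
    also have "(C' * real n powr s) powr (1/q) = C' powr (1/q) * real n powr (a - 1/p)"
      using C' q sq by (simp add: powr_mult powr_powr)
    also have "D powr (1/p) * (C' powr (1/q) * real n powr (a - 1/p)) =
       C' powr (1/q) * real n powr a * (D / real n) powr (1/p)"
      using n D0 by (simp add: powr_divide powr_diff)
    finally show ?thesis by (simp add: D_def)
  qed
  then show ?thesis using C' unfolding a_def by (intro exI[of _ "C' powr (1/q)"]) auto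
qed

section \<open>Smoothing by the operator z d/dz\<close>

lemma XD_pow_mult_nth:
  fixes A G :: "'a::comm_ring_1 fps"
  shows "fps_nth ((fps_XD ^^ i) (A * G)) n =
    (\<Sum>h\<le>i. of_nat (i choose h) * fps_nth ((fps_XD ^^ h) A * (fps_XD ^^ (i - h)) G) n)"
proof -
  have "fps_nth ((fps_XD ^^ i) (A * G)) n = (\<Sum>j=0..n. of_nat n ^ i * (fps_nth A j * fps_nth G (n - j)))"
    by (simp add: fps_mult_fps_XD_shift fps_mult_nth sum_distrib_left)
  also have "\<dots> = (\<Sum>j=0..n. \<Sum>h\<le>i. of_nat (i choose h) * (of_nat j ^ h * fps_nth A j * (of_nat (n - j) ^ (i - h) * fps_nth G (n - j))))"
  proof (rule sum.cong)
    fix j assume "j \<in> {0..n}"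
    \<comment> \<open>On coefficients the operator multiplies by the index, so Leibniz's rule is the
      binomial expansion of (j + (n - j))^i.\<close>
    then have "(of_nat n :: 'a) = of_nat j + of_nat (n - j)" by (simp flip: of_nat_add)
    then have "(of_nat n :: 'a) ^ i = (\<Sum>h\<le>i. of_nat (i choose h) * of_nat j ^ h * of_nat (n - j) ^ (i - h))"
      by (simp only: binomial_ring)
    then show "of_nat n ^ i * (fps_nth A j * fps_nth G (n - j)) = 
       (\<Sum>h\<le>i. of_nat (i choose h) * (of_nat j ^ h * fps_nth A j * (of_nat (n - j) ^ (i - h) * fps_nth G (n - j))))"
      by (simp add: sum_distrib_left mult_ac)
  qed simp
  also have "\<dots> = (\<Sum>h\<le>i. of_nat (i choose h) * fps_nth ((fps_XD ^^ h) A * (fps_XD ^^ (i - h)) G) n)"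
    by (subst sum.swap) (simp add: fps_mult_fps_XD_shift fps_mult_nth sum_distrib_left)
  finally show ?thesis .
qed

text \<open>
  Multiplying by \<^term>\<open>efps d\<close> turns the weights \<^term>\<open>chi k\<close> into \<^term>\<open>\<lambda>j. chi k j + d j\<close>,
  which are no larger; this survives any number of applications of \<^term>\<open>fps_XD\<close>
  to the first factor because the Leibniz rule has nonnegative coefficients.
\<close>

lemma norm_XD_pow_le:
  fixes d :: "nat \<Rightarrow> complex"
  assumes "\<And>j. j \<ge> 1 \<Longrightarrow> cmod (of_real (chi k j) + d j) \<le> chi k j"
  shows "cmod (fps_nth ((fps_XD ^^ i) (efps (\<lambda>j. of_real (chi k j))) * efps d) n) \<le> real n ^ i * ecoef (chi k) n"
proof (induction i arbitrary: n rule: less_induct)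
  case (less i)
  define B where "B = efps (\<lambda>j. complex_of_real (chi k j))"
  show ?case
  proof (cases i)
    case 0
    have "B * efps d = efps (\<lambda>j. of_real (chi k j) + d j)" by (simp add: B_def efps_add)
    then show ?thesis using 0 norm_ecoef_le[of "\<lambda>j. of_real (chi k j) + d j" "chi k" n] assms by (simp add: B_def)
  next
    case (Suc i')
    define A where "A = afps (\<lambda>j. complex_of_real (chi k j))"
    define R where "R = efps (chi k)"
    define A' where "A' = afps (chi k)"
    have nB: "fps_XD B = A * B" "fps_XD R = A' * R"
      by (simp_all add: A_def B_def A'_def R_def XD_efps)
    have eq: "fps_nth ((fps_XD ^^ i) B * efps d) n =
       (\<Sum>h\<le>i'. of_nat (i' choose h) * fps_nth ((fps_XD ^^ h) A * ((fps_XD ^^ (i' - h)) B * efps d)) n)"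
    proof -
      \<comment> \<open>One derivative turns B into A B, and Leibniz's rule then leaves at most i -
        1 derivatives on B, within reach of the induction hypothesis.\<close>
      have "(fps_XD ^^ i) B = (fps_XD ^^ i') (A * B)" by (simp add: Suc funpow_Suc_right nB del: funpow.simps)
      also have "\<dots> = (\<Sum>h\<le>i'. of_nat (i' choose h) * ((fps_XD ^^ h) A * (fps_XD ^^ (i' - h)) B))"
        by (rule fps_ext) (simp add: XD_pow_mult_nth fps_sum_nth flip: fps_of_nat)
      finally have "(fps_XD ^^ i) B * efps d = 
         (\<Sum>h\<le>i'. of_nat (i' choose h) * ((fps_XD ^^ h) A * ((fps_XD ^^ (i' - h)) B * efps d)))"
        by (simp add: sum_distrib_right mult.assoc)
      then show ?thesis by (simp add: fps_sum_nth flip: fps_of_nat)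
    qed
    have "cmod (fps_nth ((fps_XD ^^ i) B * efps d) n) \<le>
       (\<Sum>h\<le>i'. of_nat (i' choose h) * fps_nth ((fps_XD ^^ h) A' * (fps_XD ^^ (i' - h)) R) n)"
      unfolding eq
    proof (rule order_trans[OF norm_sum sum_mono])
      fix h assume h: "h \<in> {..i'}"
      have "cmod (fps_nth ((fps_XD ^^ h) A * ((fps_XD ^^ (i' - h)) B * efps d)) n) \<le>
          (\<Sum>j=0..n. cmod (fps_nth ((fps_XD ^^ h) A) j) * cmod (fps_nth ((fps_XD ^^ (i' - h)) B * efps d) (n - j)))"
        unfolding fps_mult_nth[of "(fps_XD ^^ h) A"] by (rule order_trans[OF norm_sum]) (simp add: norm_mult)
      also have "\<dots> \<le> (\<Sum>j=0..n. fps_nth ((fps_XD ^^ h) A') j * fps_nth ((fps_XD ^^ (i' - h)) R) (n - j))"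
      proof (intro sum_mono mult_mono)
        fix j
        show "cmod (fps_nth ((fps_XD ^^ h) A) j) \<le> fps_nth ((fps_XD ^^ h) A') j"
          by (simp add: A_def A'_def fps_mult_fps_XD_shift afps_nth norm_mult norm_power chi_bounds)
        then show "0 \<le> fps_nth ((fps_XD ^^ h) A') j" using norm_ge_zero order_trans by blast
        show "cmod (fps_nth ((fps_XD ^^ (i' - h)) B * efps d) (n - j)) \<le> fps_nth ((fps_XD ^^ (i' - h)) R) (n - j)"
          using less[of "i' - h" "n - j"] Suc h by (simp add: B_def R_def fps_mult_fps_XD_shift)
      qed auto
      finally show "cmod (of_nat (i' choose h) * fps_nth ((fps_XD ^^ h) A * ((fps_XD ^^ (i' - h)) B * efps d)) n)
         \<le> real (i' choose h) * fps_nth ((fps_XD ^^ h) A' * (fps_XD ^^ (i' - h)) R) n"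
        by (simp add: norm_mult fps_mult_nth mult_left_mono)
    qed
    also have "\<dots> = fps_nth ((fps_XD ^^ i') (A' * R)) n" by (simp add: XD_pow_mult_nth)
    also have "(fps_XD ^^ i') (A' * R) = (fps_XD ^^ i) R"
      by (simp add: Suc funpow_Suc_right nB del: funpow.simps)
    finally show ?thesis by (simp add: B_def R_def fps_mult_fps_XD_shift)
  qed
qed

text \<open>z d/dz of F i is F (i + 1) plus \<open>afps d\<close> times F i, so trading a factor n
  for one more derivative on B costs a convolution of d with the coefficients of F i. By
  \<open>norm_XD_pow_le\<close> those are at most n^i times the coefficients of B; the N exchanges
  add up.\<close>

lemma smoothing_error:
  fixes d :: "nat \<Rightarrow> complex"
  assumes "\<And>j. j \<ge> 1 \<Longrightarrow> cmod (of_real (chi k j) + d j) \<le> chi k j" and n: "n \<ge> 1"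
  defines "F \<equiv> \<lambda>i. (fps_XD ^^ i) (efps (\<lambda>j. of_real (chi k j))) * efps d"
  shows "cmod (of_nat n ^ N * fps_nth (F 0) n - fps_nth (F N) n) \<le>
     real N * real n ^ N / real n * (\<Sum>j=1..n. cmod (d j) * ecoef (chi k) (n - j))"
proof -
  define D where "D = (\<Sum>j=1..n. cmod (d j) * ecoef (chi k) (n - j))"
  have D0: "D \<ge> 0" unfolding D_def using ecoef_chi_nonneg by (intro sum_nonneg) auto
  have one: "cmod (of_nat n * fps_nth (F i) n - fps_nth (F (Suc i)) n) \<le> real n ^ i * D" for i
  proof -
    have "fps_XD (F i) = F (Suc i) + afps d * F i"
      by (simp add: F_def fps_XD_mult XD_efps mult_ac)
    then have "of_nat n * fps_nth (F i) n - fps_nth (F (Suc i)) n = fps_nth (afps d * F i) n"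
      by (metis add_diff_cancel_left' fps_XD_nth fps_add_nth)
    also have "cmod \<dots> \<le> (\<Sum>j=1..n. cmod (d j) * cmod (fps_nth (F i) (n - j)))"
      unfolding afps_mult_nth by (rule order_trans[OF norm_sum]) (simp add: norm_mult)
    also have "\<dots> \<le> (\<Sum>j=1..n. cmod (d j) * (real n ^ i * ecoef (chi k) (n - j)))"
    proof (intro sum_mono mult_left_mono)
      fix j assume "j \<in> {1..n}"
      have "cmod (fps_nth (F i) (n - j)) \<le> real (n - j) ^ i * ecoef (chi k) (n - j)"
        unfolding F_def by (rule norm_XD_pow_le[OF assms(1)])
      also have "\<dots> \<le> real n ^ i * ecoef (chi k) (n - j)"
        using ecoef_chi_nonneg by (intro mult_right_mono power_mono) auto
      finally show "cmod (fps_nth (F i) (n - j)) \<le> real n ^ i * ecoef (chi k) (n - j)" .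
    qed auto
    also have "\<dots> = real n ^ i * D" by (simp add: D_def sum_distrib_left mult_ac)
    finally show ?thesis .
  qed
  have "cmod (of_nat n ^ N * fps_nth (F 0) n - fps_nth (F N) n) \<le> real N * real n ^ N / real n * D"
  proof (induction N)
    case (Suc N)
    have "of_nat n ^ Suc N * fps_nth (F 0) n - fps_nth (F (Suc N)) n =
       of_nat n * (of_nat n ^ N * fps_nth (F 0) n - fps_nth (F N) n) +
       (of_nat n * fps_nth (F N) n - fps_nth (F (Suc N)) n)" by (simp add: algebra_simps)
    also have "cmod \<dots> \<le> cmod (of_nat n * (of_nat n ^ N * fps_nth (F 0) n - fps_nth (F N) n)) +
       cmod (of_nat n * fps_nth (F N) n - fps_nth (F (Suc N)) n)"
      by (rule norm_triangle_ineq)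
    also have "\<dots> \<le> real n * (real N * real n ^ N / real n * D) + real n ^ N * D"
      using mult_left_mono[OF Suc, of "real n"] one[of N] by (intro add_mono) (simp_all add: norm_mult)
    also have "\<dots> = real (Suc N) * real n ^ Suc N / real n * D"
      using n by (simp add: field_simps)
    finally show ?case .
  qed simp
  then show ?thesis by (simp add: D_def)
qed

subsection \<open>Ramanujan sums and the exponent\<close>

text \<open>Induction over the set Q of primes sieved out, in which k, \<zeta> and its order D all
  vary. Removing the multiples of p subtracts the sum for \<zeta>^p over a range shorter by the
  factor p, and \<zeta>^p has order D / p or D according to whether p divides D. Without sieving,
  the sum over full periods is 0 unless D = 1. For Q the prime factors of k this is Ramanujan's sum
  divided by k.\<close>

lemma ramanujan_sum_aux:
  fixes \<zeta> :: complex
  assumes "finite Q" "\<And>p. p \<in> Q \<Longrightarrow> prime p" "\<Prod>Q dvd k" "k > 0" "\<zeta> ^ k = 1" "D > 0"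
    and "\<And>i. \<zeta> ^ i = 1 \<longleftrightarrow> D dvd i"
  shows "(\<Sum>i=1..k. if \<exists>p\<in>Q. p dvd i then 0 else \<zeta> ^ i) / of_nat k =
    of_real (if D dvd \<Prod>Q then \<Prod>p\<in>Q. if p dvd D then - 1 / real p else 1 - 1 / real p else 0)"
  using assms
proof (induction Q arbitrary: k \<zeta> D rule: finite_induct)
  case (empty k \<zeta> D)
  show ?case
  proof (cases "\<zeta> = 1")
    case True
    then have "D = 1" using empty.prems(6)[of 1] by simp
    then show ?thesis using True empty.prems by simp
  next
    case False
    then have "D \<noteq> 1" using empty.prems(6)[of 1] by auto
    moreover have "(\<Sum>i=1..k. \<zeta> ^ i) = 0"
    proof -
      have "(\<Sum>i=1..k. \<zeta> ^ i) = \<zeta> * (\<Sum>i<k. \<zeta> ^ i)"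
        unfolding sum_distrib_left
        by (rule sum.reindex_bij_witness[of _ Suc "\<lambda>i. i - 1"]) (auto simp: Suc_le_eq gr0_conv_Suc)
      also have "(\<Sum>i<k. \<zeta> ^ i) = 0"
        using False empty.prems(4) by (simp add: sum_gp_strict)
      finally show ?thesis by simp
    qed
    ultimately show ?thesis by simp
  qed
next
  case (insert p Q k \<zeta> D)
  have p: "prime p" and Q: "\<And>q. q \<in> Q \<Longrightarrow> prime q" using insert.prems by auto
  have p0: "p > 0" using p prime_gt_0_nat by blast
  have pQk: "p * \<Prod>Q dvd k" using insert by simp
  then obtain k' where k': "k = p * k'" by (metis dvd_def dvd_mult_left)
  have k'0: "k' > 0" using k' insert.prems(3) by (cases k') auto
  have Qk': "\<Prod>Q dvd k'" using pQk k' p0 by simp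
  have nd: "\<not> p dvd \<Prod>Q"
  proof
    assume "p dvd \<Prod>Q"
    then obtain q where "q \<in> Q" "p dvd q"
      using prime_dvd_prod_iff[OF insert.hyps(1) p, of "\<lambda>x. x"] by auto
    then show False using Q p primes_dvd_imp_eq insert.hyps(2) by blast
  qed
  define S where "S k \<zeta> = (\<Sum>i=1..k. if \<exists>p\<in>Q. p dvd i then 0 else \<zeta> ^ i)" for k and \<zeta> :: complex
  define V where "V D = (if D dvd \<Prod>Q then \<Prod>q\<in>Q. if q dvd D then - 1 / real q else 1 - 1 / real q else 0)" for D
  have "S k \<zeta> = (\<Sum>i=1..k. if \<exists>q\<in>insert p Q. q dvd i then 0 else \<zeta> ^ i) +
      (\<Sum>i=1..k. if p dvd i then (if \<exists>q\<in>Q. q dvd i then 0 else \<zeta> ^ i) else 0)"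
    unfolding S_def sum.distrib[symmetric] by (rule sum.cong) auto
  also have "(\<Sum>i=1..k. if p dvd i then (if \<exists>q\<in>Q. q dvd i then 0 else \<zeta> ^ i) else 0) = S k' (\<zeta> ^ p)"
  proof -
    have "(\<Sum>i=1..k. if p dvd i then (if \<exists>q\<in>Q. q dvd i then 0 else \<zeta> ^ i) else 0) =
       (\<Sum>i\<in>{i\<in>{1..k}. p dvd i}. if \<exists>q\<in>Q. q dvd i then 0 else \<zeta> ^ i)"
      by (rule sum.inter_filter[symmetric]) simp
    also have "\<dots> = (\<Sum>i=1..k'. if \<exists>q\<in>Q. q dvd p * i then 0 else \<zeta> ^ (p * i))"
      by (rule sum.reindex_bij_witness[of _ "\<lambda>i. p * i" "\<lambda>i. i div p"])
         (use p0 k' in \<open>auto simp: Suc_le_eq\<close>)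
    also have "\<dots> = S k' (\<zeta> ^ p)"
    proof -
      have "q dvd p * i \<longleftrightarrow> q dvd i" if "q \<in> Q" for q i
        using Q[OF that] p insert.hyps(2) that prime_dvd_mult_iff primes_dvd_imp_eq by blast
      then show ?thesis unfolding S_def by (intro sum.cong) (auto simp: power_mult)
    qed
    finally show ?thesis .
  qed
  finally have Seq: "S k \<zeta> = (\<Sum>i=1..k. if \<exists>q\<in>insert p Q. q dvd i then 0 else \<zeta> ^ i) + S k' (\<zeta> ^ p)" .
  have "(of_nat k :: complex) = of_nat k' * of_nat p" using k' by simp
  then have "(\<Sum>i=1..k. if \<exists>q\<in>insert p Q. q dvd i then 0 else \<zeta> ^ i) / of_nat k =
      S k \<zeta> / of_nat k - S k' (\<zeta> ^ p) / of_nat k' / of_nat p"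
    unfolding Seq by (simp only: add_divide_distrib divide_divide_eq_left add_diff_cancel_right')
  also have "S k \<zeta> / of_nat k = of_real (V D)"
    unfolding S_def V_def
    by (rule insert.IH) (use insert.prems Q pQk in \<open>auto intro: dvd_mult_right\<close>)
  also have "S k' (\<zeta> ^ p) / of_nat k' = of_real (V (if p dvd D then D div p else D))"
    unfolding S_def V_def
  proof (rule insert.IH)
    show "(\<zeta> ^ p) ^ k' = 1" using insert.prems(4) k' by (simp add: power_mult)
    fix i
    have "(\<zeta> ^ p) ^ i = 1 \<longleftrightarrow> D dvd p * i" unfolding power_mult[symmetric] by (rule insert.prems(6))
    also have "\<dots> \<longleftrightarrow> (if p dvd D then D div p else D) dvd i"
    proof (cases "p dvd D")
      case True
      then obtain D' where "D = p * D'" by auto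
      then show ?thesis using p0 by simp
    next
      case False
      then have "coprime D p" using p by (metis coprime_commute prime_imp_coprime)
      then show ?thesis using False by (simp add: coprime_dvd_mult_right_iff)
    qed
    finally show "(\<zeta> ^ p) ^ i = 1 \<longleftrightarrow> (if p dvd D then D div p else D) dvd i" .
  qed (use insert.prems Q Qk' k'0 p0 in \<open>auto simp: dvd_imp_le div_greater_zero_iff\<close>)
  also have "complex_of_real (V D) - of_real (V (if p dvd D then D div p else D)) / of_nat p =
     of_real (if D dvd \<Prod>(insert p Q) then \<Prod>q\<in>insert p Q. if q dvd D then - 1 / real q else 1 - 1 / real q else 0)"
  proof (cases "p dvd D")
    case False
    then have "coprime D p" using p by (metis coprime_commute prime_imp_coprime)
    then have "D dvd \<Prod>(insert p Q) \<longleftrightarrow> D dvd \<Prod>Q"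
      using insert.hyps by (simp add: coprime_dvd_mult_right_iff)
    then show ?thesis using False insert.hyps by (auto simp: V_def algebra_simps)
  next
    case True
    then obtain D' where D': "D = p * D'" by auto
    have "\<not> D dvd \<Prod>Q" using nd True dvd_trans by blast
    then have 1: "V D = 0" by (simp add: V_def)
    have 2: "D dvd \<Prod>(insert p Q) \<longleftrightarrow> D' dvd \<Prod>Q" using insert.hyps D' p0 by simp
    have 3: "q dvd D \<longleftrightarrow> q dvd D'" if "q \<in> Q" for q
      unfolding D' using Q[OF that] p insert.hyps(2) that prime_dvd_mult_iff primes_dvd_imp_eq by blast
    have "V D' = (if D' dvd \<Prod>Q then \<Prod>q\<in>Q. if q dvd D then - 1 / real q else 1 - 1 / real q else 0)"
      unfolding V_def using 3 by (auto intro!: prod.cong)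
    then show ?thesis using True 1 2 D' p0 insert.hyps by auto
  qed
  finally show ?case .
qed

definition rt :: "nat \<Rightarrow> nat \<Rightarrow> complex" where
  "rt k a = cis (2 * pi * real a / real k)"

text \<open>A Ramanujan sum divided by k, that is, a Fourier coefficient of \<open>chi k\<close>.
  \<open>Re\<close> only provides a real type: by \<open>gam_formula\<close> the complex sum is
  already real.\<close>

definition gam :: "nat \<Rightarrow> nat \<Rightarrow> real" where
  "gam k a = Re (\<Sum>i=1..k. of_real (chi k i) * rt k a ^ i) / real k"

lemma norm_rt [simp]: "cmod (rt k a) = 1"
  by (simp add: rt_def)

lemma rt_power: "rt k a ^ i = cis (2 * pi * real (a * i) / real k)"
  by (simp add: rt_def Complex.DeMoivre mult_ac)

lemma rt_power_eq_1_iff: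
  assumes "k > 0"
  shows "rt k a ^ i = 1 \<longleftrightarrow> k div gcd a k dvd i"
proof -
  define g where "g = gcd a k"
  have g: "g > 0" "coprime (k div g) (a div g)"
    using assms by (simp_all add: g_def div_gcd_coprime coprime_commute)
  have gL: "a = g * (a div g)" "k = g * (k div g)" by (simp_all add: g_def)
  have "rt k a ^ i = 1 \<longleftrightarrow> k dvd a * i" unfolding rt_power by (rule cis_root_eq_1_iff[OF assms])
  also have "\<dots> \<longleftrightarrow> k div g dvd a div g * i"
    using g(1) nat_mult_dvd_cancel_disj[of g "k div g" "a div g * i"] gL by (simp add: mult.assoc[symmetric])
  also have "\<dots> \<longleftrightarrow> k div g dvd i" using g(2) coprime_dvd_mult_right_iff by blast
  finally show ?thesis by (simp add: g_def)
qed

lemma squarefree_iff_dvd_prod_prime_factors: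
  fixes D k :: nat
  assumes "D dvd k" "k > 0"
  shows "D dvd \<Prod>(prime_factors k) \<longleftrightarrow> squarefree D"
proof
  have sq: "squarefree (\<Prod>(prime_factors k))"
    by (rule squarefree_prod_coprime) (auto intro: squarefree_prime primes_coprime)
  then show "D dvd \<Prod>(prime_factors k) \<Longrightarrow> squarefree D" using squarefree_mono by blast
next
  assume sq: "squarefree D"
  have "D \<noteq> 0" using assms by auto
  then have "D = \<Prod>(prime_factors D)"
  proof -
    have "D = (\<Prod>p\<in>prime_factors D. p ^ multiplicity p D)"
      using \<open>D \<noteq> 0\<close> by (intro prime_factorization_nat) simp
    also have "\<dots> = \<Prod>(prime_factors D)"
      using sq squarefree_factorial_semiring'[OF \<open>D \<noteq> 0\<close>] by (intro prod.cong) auto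
    finally show ?thesis .
  qed
  also have "\<dots> dvd \<Prod>(prime_factors k)"
    by (rule prod_dvd_prod_subset) (use dvd_prime_factors[of k D] assms in auto)
  finally show "D dvd \<Prod>(prime_factors k)" .
qed

text \<open>The order of \<open>rt k a\<close> is D a. In the product for the Ramanujan sum, - 1 / p
  is (1 - 1 / p) times - 1 / (p - 1) for the primes dividing D a, and the factors 1 - 1 / p over all
  primes of k multiply to \<open>dens k\<close>. This is the shape in which the exponent \<beta> is
  stated.\<close>

lemma gam_formula:
  assumes "k > 0"
  defines "D \<equiv> \<lambda>a. k div gcd a k"
  shows "(\<Sum>i=1..k. of_real (chi k i) * rt k a ^ i) / of_nat k = complex_of_real (gam k a)" (is ?th1)
    and "gam k a = dens k * (of_int (moebius (D a)) * (\<Prod>p\<in>prime_factors (D a). 1 / (real p - 1)))" (is ?th2)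
proof -
  define Q where "Q = prime_factors k"
  have Dk: "D a dvd k" unfolding D_def by (metis dvd_div_mult_self dvd_triv_left gcd_dvd2)
  have D0: "D a > 0" using Dk assms(1) by (metis dvd_0_left gr0I less_numeral_extra(3))
  have cop: "(\<exists>p\<in>Q. p dvd i) \<longleftrightarrow> \<not> coprime i k" for i
  proof
    assume "\<exists>p\<in>Q. p dvd i"
    then show "\<not> coprime i k"
      by (metis Q_def coprime_common_divisor in_prime_factors_iff not_prime_unit)
  next
    assume "\<not> coprime i k"
    then obtain p where "prime p" "p dvd gcd i k"
      using prime_factor_nat[of "gcd i k"] by (auto simp: coprime_iff_gcd_eq_1)
    then show "\<exists>p\<in>Q. p dvd i" using assms(1) by (auto simp: Q_def in_prime_factors_iff)
  qed
  define v where "v = (if D a dvd \<Prod>Q then \<Prod>p\<in>Q. if p dvd D a then - 1 / real p else 1 - 1 / real p else 0)"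
  have pfk: "\<Prod>Q dvd k"
    unfolding Q_def
  proof (subst (2) prime_factorization_nat[OF assms(1)], rule prod_dvd_prod)
    fix p assume "p \<in> prime_factors k"
    then have "multiplicity p k > 0" using assms(1) by (simp add: prime_factors_multiplicity)
    then show "p dvd p ^ multiplicity p k" by (intro dvd_power) auto
  qed
  have "(\<Sum>i=1..k. if \<exists>p\<in>Q. p dvd i then 0 else rt k a ^ i) / of_nat k = complex_of_real v"
    unfolding v_def
  proof (rule ramanujan_sum_aux)
    show "rt k a ^ k = 1" using rt_power_eq_1_iff[OF assms(1), of a k] Dk by (simp add: D_def)
  qed (use assms(1) D0 rt_power_eq_1_iff[OF assms(1)] pfk in \<open>auto simp: Q_def D_def\<close>)
  also have "(\<Sum>i=1..k. if \<exists>p\<in>Q. p dvd i then 0 else rt k a ^ i) =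
      (\<Sum>i=1..k. of_real (chi k i) * rt k a ^ i)"
    unfolding cop chi_def by (rule sum.cong) auto
  finally have v: "(\<Sum>i=1..k. of_real (chi k i) * rt k a ^ i) / of_nat k = complex_of_real v" .
  then have "Re ((\<Sum>i=1..k. of_real (chi k i) * rt k a ^ i) / of_nat k) = v" by simp
  then have "gam k a = v" unfolding gam_def by (simp only: Re_divide_of_nat)
  then show ?th1 using v by simp
  have tot: "dens k = (\<Prod>p\<in>Q. 1 - 1 / real p)"
    unfolding dens_def Q_def using totient_formula2[of k] assms(1) by (simp add: field_simps)
  have "v = dens k * (of_int (moebius (D a)) * (\<Prod>p\<in>prime_factors (D a). 1 / (real p - 1)))"
  proof (cases "squarefree (D a)")
    case False
    then show ?thesis
      using squarefree_iff_dvd_prod_prime_factors[OF Dk assms(1)] by (simp add: v_def Q_def moebius_def)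
  next
    case True
    have sub: "prime_factors (D a) \<subseteq> Q" unfolding Q_def using dvd_prime_factors[of k "D a"] Dk assms(1) by auto
    have mem: "p \<in> prime_factors (D a) \<longleftrightarrow> p dvd D a" if "p \<in> Q" for p
      using that D0 by (auto simp: Q_def in_prime_factors_iff)
    have "v = (\<Prod>p\<in>Q. if p dvd D a then - 1 / real p else 1 - 1 / real p)"
      using True squarefree_iff_dvd_prod_prime_factors[OF Dk assms(1)] by (simp add: v_def Q_def)
    also have "\<dots> = (\<Prod>p\<in>Q. (1 - 1 / real p) * (if p \<in> prime_factors (D a) then - (1 / (real p - 1)) else 1))"
    proof (rule prod.cong)
      fix p assume p: "p \<in> Q"
      then have "real p > 1" using prime_gt_1_nat by (auto simp: Q_def in_prime_factors_iff)
      then show "(if p dvd D a then - 1 / real p else 1 - 1 / real p) =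
         (1 - 1 / real p) * (if p \<in> prime_factors (D a) then - (1 / (real p - 1)) else 1)"
        using mem[OF p] by (simp add: field_simps)
    qed simp
    also have "\<dots> = dens k * (\<Prod>p\<in>Q. if p \<in> prime_factors (D a) then - (1 / (real p - 1)) else 1)"
      by (simp add: prod.distrib tot)
    also have "(\<Prod>p\<in>Q. if p \<in> prime_factors (D a) then - (1 / (real p - 1)) else 1) =
        (\<Prod>p\<in>prime_factors (D a). - (1 / (real p - 1)))"
      by (rule prod.mono_neutral_cong_right) (use sub in \<open>auto simp: Q_def\<close>)
    also have "\<dots> = (\<Prod>p\<in>prime_factors (D a). (- 1) * (1 / (real p - 1)))" by simp
    also have "\<dots> = of_int (moebius (D a)) * (\<Prod>p\<in>prime_factors (D a). 1 / (real p - 1))"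
      unfolding prod.distrib using True by (simp add: moebius_def)
    finally show ?thesis .
  qed
  then show ?th2 using \<open>gam k a = v\<close> by simp
qed

lemma chi_cong: "i mod k = j mod k \<Longrightarrow> chi k i = chi k j"
  by (metis chi_def coprime_mod_left_iff gcd_0_right mod_by_0 mod_0)

lemma rt_0 [simp]: "rt k 0 = 1"
  by (simp add: rt_def)

lemma rt_power_k: "k > 0 \<Longrightarrow> rt k a ^ k = 1"
  using cis_root_eq_1_iff[of k "a * k"] by (simp add: rt_power)

lemma gam_0: "gam k 0 = dens k"
  using sum_chi[of k] by (simp add: gam_def dens_def)

lemma abs_gam_le: 
  assumes "k > 0"
  shows "\<bar>gam k a\<bar> \<le> 1"
proof -
  have "\<bar>Re (\<Sum>i=1..k. of_real (chi k i) * rt k a ^ i)\<bar> \<le> cmod (\<Sum>i=1..k. of_real (chi k i) * rt k a ^ i)"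
    by (rule abs_Re_le_cmod)
  also have "\<dots> \<le> (\<Sum>i=1..k. 1)"
    by (rule order_trans[OF norm_sum], rule sum_mono)
       (simp add: norm_mult norm_power chi_bounds)
  finally show ?thesis using assms by (simp add: gam_def abs_mult field_simps)
qed

text \<open>Fourier inversion modulo k. It identifies the product of powers over the roots of unity
  as the generating function with weights \<open>chi k\<close>.\<close>

lemma sum_gam_rt:
  assumes "k > 0"
  shows "(\<Sum>a<k. of_real (gam k a) * cnj (rt k a) ^ j) = of_real (chi k j)"
proof -
  \<comment> \<open>The conjugate of \<open>rt k a\<close> is its power k - 1, so everything becomes
    a power with natural exponent.\<close>
  define e where "e i = i + (k - 1) * j" for i
  have cr: "cnj (rt k a) ^ j = rt k a ^ ((k - 1) * j)" for a
  proof -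
    have "cnj (rt k a) = cnj (rt k a) * rt k a ^ k" by (simp add: rt_power_k[OF assms])
    also have "\<dots> = (cnj (rt k a) * rt k a) * rt k a ^ (k - 1)"
      using assms by (simp add: power_eq_if mult.assoc)
    also have "cnj (rt k a) * rt k a = 1"
      using complex_norm_square[of "rt k a"] by (simp add: mult.commute)
    finally show ?thesis by (metis mult_1 power_mult)
  qed
  have dvd: "k dvd e i \<longleftrightarrow> i mod k = j mod k" for i
  proof -
    have "int (e i) = (int i - int j) + int k * int j"
    proof -
      have "int (k - 1) = int k - 1" using assms by simp
      then show ?thesis unfolding e_def of_nat_add of_nat_mult by (simp add: algebra_simps)
    qed
    then have "k dvd e i \<longleftrightarrow> int k dvd int i - int j"
      by (metis dvd_add_times_triv_right_iff int_dvd_int_iff mult.commute)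
    then show ?thesis by (metis mod_eq_dvd_iff of_nat_eq_iff zmod_int)
  qed
  \<comment> \<open>The residue of j represented in {1..k}, hence k in place of 0.\<close>
  define i0 where "i0 = (if j mod k = 0 then k else j mod k)"
  have i0: "i0 \<in> {1..k}" "i0 mod k = j mod k"
    using assms mod_less_divisor[OF assms, of j] by (auto simp: i0_def simp del: mod_less_divisor)
  have uniq: "i = i0" if "i \<in> {1..k}" "i mod k = j mod k" for i
    using that assms by (cases "i = k") (auto simp: i0_def)
  have "(\<Sum>a<k. of_real (gam k a) * cnj (rt k a) ^ j) =
      (\<Sum>a<k. \<Sum>i=1..k. of_real (chi k i) * rt k a ^ e i / of_nat k)"
    unfolding gam_formula(1)[OF assms, symmetric] cr
    by (simp add: e_def power_add sum_distrib_right sum_divide_distrib mult.assoc)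
  also have "\<dots> = (\<Sum>i=1..k. of_real (chi k i) * (\<Sum>a<k. rt k a ^ e i) / of_nat k)"
    by (subst sum.swap) (simp add: sum_distrib_left sum_divide_distrib)
  also have "\<dots> = (\<Sum>i=1..k. if i = i0 then of_real (chi k i0) else 0)"
  proof (rule sum.cong)
    fix i assume i: "i \<in> {1..k}"
    have "(\<Sum>a<k. rt k a ^ e i) = (if k dvd e i then of_nat k else 0)"
      unfolding rt_def by (rule unity_root_filter[OF assms])
    moreover have "k dvd e i \<longleftrightarrow> i = i0" using dvd[of i] uniq[OF i] i0 by auto
    ultimately show "of_real (chi k i) * (\<Sum>a<k. rt k a ^ e i) / of_nat k =
        (if i = i0 then complex_of_real (chi k i0) else 0)" using assms by simp
  qed simp
  also have "\<dots> = of_real (chi k i0)" using i0 by simp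
  finally show ?thesis using chi_cong[OF i0(2)] by simp
qed

text \<open>The term i = 1 is already strictly smaller: 1 is coprime to k, and a root of unity other
  than 1 has real part below 1.\<close>

lemma gam_less_dens:
  assumes "0 < a" "a < k"
  shows "gam k a < dens k"
proof -
  have ne: "rt k a \<noteq> 1"
    using cis_root_eq_1_iff[of k a] assms by (auto simp: rt_def dest: dvd_imp_le)
  have "Re (rt k a) < 1"
  proof (rule ccontr)
    assume "\<not> ?thesis"
    then have "Re (rt k a) = 1" using abs_Re_le_cmod[of "rt k a"] by simp
    moreover have "(Re (rt k a))\<^sup>2 + (Im (rt k a))\<^sup>2 = 1" using cmod_power2[of "rt k a"] by simp
    ultimately have "rt k a = 1" by (simp add: complex_eq_iff)
    then show False using ne by simp
  qed
  have re: "Re (rt k a ^ i) \<le> 1" for i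
    using complex_Re_le_cmod[of "rt k a ^ i"] by (simp add: norm_power)
  have "(\<Sum>i=1..k. chi k i * Re (rt k a ^ i)) < (\<Sum>i=1..k. chi k i)"
  proof (rule sum_strict_mono_ex1)
    show "\<forall>i\<in>{1..k}. chi k i * Re (rt k a ^ i) \<le> chi k i"
      using re chi_bounds mult_left_le by blast
    show "\<exists>i\<in>{1..k}. chi k i * Re (rt k a ^ i) < chi k i"
      using \<open>Re (rt k a) < 1\<close> assms by (intro bexI[of _ 1]) (auto simp: chi_def)
  qed simp
  then show ?thesis using assms sum_chi[of k] by (simp add: gam_def dens_def divide_strict_right_mono)
qed

section \<open>The exponent as a gap between singularities\<close>

lemma beta_exp_eq_dens: "k = 1 \<or> prime k \<Longrightarrow> beta_exp k = dens k"
  by (simp add: beta_exp_def dens_def)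

text \<open>\<open>rt k (k div d)\<close> has order d, so each candidate of the minimum is the gap
  between the exponent at 1 and that at a primitive d-th root of unity.\<close>

lemma beta_exp_composite:
  assumes "k > 0" "k \<noteq> 1" "\<not> prime k"
  shows "beta_exp k = Min ((\<lambda>d. dens k - gam k (k div d)) ` {d. d dvd k \<and> d > 1})"
proof -
  have "dens k * (1 - of_int (moebius d) * (\<Prod>p\<in>prime_factors d. 1 / (real p - 1))) = dens k - gam k (k div d)"
    if d: "d dvd k" for d
  proof -
    have "k div d dvd k" using d by (metis dvd_div_mult_self dvd_triv_left)
    then have "gcd (k div d) k = k div d" by (simp add: gcd_nat.absorb1)
    moreover have "k div (k div d) = d" using d assms(1) by (simp add: div_div_eq_right)
    ultimately show ?thesis using gam_formula(2)[OF assms(1), of "k div d"] by (simp add: algebra_simps)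
  qed
  then show ?thesis using assms by (auto simp: beta_exp_def dens_def intro!: arg_cong[of _ _ Min] image_cong)
qed

text \<open>\<open>gam k a\<close> depends only on the order of \<open>rt k a\<close>, so for
  composite k the gap is a candidate of the minimum. For prime k the exponent \<open>gam k a\<close>
  is negative and the gap exceeds \<open>dens k\<close>.\<close>

lemma beta_exp_le_gap:
  assumes "0 < a" "a < k"
  shows "beta_exp k \<le> dens k - gam k a"
proof -
  define d where "d = k div gcd a k"
  have dk: "d dvd k" unfolding d_def by (metis dvd_div_mult_self dvd_triv_left gcd_dvd2)
  have "d \<noteq> 1"
  proof
    assume "d = 1"
    then have "k = gcd a k" unfolding d_def by (metis dvd_div_mult_self gcd_dvd2 mult_1)
    then have "k dvd a" by (metis gcd_dvd1)
    then show False using assms by (auto dest: dvd_imp_le)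
  qed
  then have d1: "d > 1" using dk assms by (cases "d = 0") auto
  show ?thesis
  proof (cases "prime k")
    case True
    then have "d = k" using dk d1 unfolding prime_nat_iff by (metis less_irrefl)
    then have "gam k a = dens k * (- (1 / (real k - 1)))"
      using gam_formula(2)[of k a] True assms
      by (simp add: d_def[symmetric] moebius_def squarefree_prime prime_prime_factors)
    also have "\<dots> \<le> 0" using prime_gt_1_nat[OF True] dens_pos[of k] assms 
      by (intro mult_nonneg_nonpos) auto
    finally show ?thesis using True by (simp add: beta_exp_eq_dens)
  next
    case False
    have "gam k (k div d) = gam k a"
    proof -
      have "k div d dvd k" using dk by (metis dvd_div_mult_self dvd_triv_left)
      then have "gcd (k div d) k = k div d" by (simp add: gcd_nat.absorb1)
      moreover have "k div (k div d) = d" using dk assms by (simp add: div_div_eq_right)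
      ultimately show ?thesis using gam_formula(2)[of k "k div d"] gam_formula(2)[of k a] assms
        by (simp add: d_def[symmetric])
    qed
    then show ?thesis
      using assms d1 dk False by (subst beta_exp_composite) (auto intro!: Min_le intro: rev_image_eqI)
  qed
qed

lemma beta_exp_pos:
  assumes "k > 0"
  shows "beta_exp k > 0"
proof (cases "k = 1 \<or> prime k")
  case True
  then show ?thesis using assms by (simp add: beta_exp_eq_dens dens_pos)
next
  case False
  have "0 < dens k - gam k (k div d)" if "d dvd k" "d > 1" for d
    using gam_less_dens[of "k div d" k] that assms by (simp add: div_greater_zero_iff dvd_imp_le)
  moreover have "{d. d dvd k \<and> d > 1} \<noteq> {}" using False assms by (auto intro!: exI[of _ k])
  ultimately show ?thesis using assms False by (simp add: beta_exp_composite)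
qed

text \<open>A composite k has a divisor p q with p and q prime, possibly equal, whose Moebius value
  is 1 or 0; its candidate is at most \<open>dens k\<close>. For prime k the minimum would be 1, so
  the separate clause in \<open>beta_exp\<close> is what gives the bound. It ensures 1 / p <
  \<open>dens k\<close>, as required by \<open>weighted_sum_le\<close>.\<close>

lemma beta_exp_le_dens:
  assumes "k > 0"
  shows "beta_exp k \<le> dens k"
proof (cases "k = 1 \<or> prime k")
  case False
  then have k1: "k > 1" using assms by auto
  obtain p where p: "prime p" "p dvd k" using prime_factor_nat[of k] False by auto
  then obtain m where m: "k = p * m" by auto
  have "m \<noteq> 1" using m p False by auto
  then obtain q where q: "prime q" "q dvd m" using prime_factor_nat by blast
  define d where "d = p * q"
  have d: "d dvd k" "d > 1"
    using m q p less_1_mult[OF prime_gt_1_nat[OF p(1)] prime_gt_1_nat[OF q(1)]] by (auto simp: d_def)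
  have "0 \<le> moebius d"
  proof (cases "squarefree d")
    case True
    have "p \<noteq> q"
    proof
      assume "p = q"
      then have "p dvd 1" using squarefreeD[OF True, of p] by (simp add: d_def power2_eq_square)
      then show False using p(1) not_prime_unit by blast
    qed
    then have "prime_factors d = {p, q}"
      using p q by (auto simp: d_def prime_factorization_mult prime_factorization_prime)
    then show ?thesis using \<open>p \<noteq> q\<close> by (simp add: moebius_def)
  qed (simp add: moebius_def)
  moreover have "0 \<le> (\<Prod>p\<in>prime_factors d. 1 / (real p - 1))"
    by (rule prod_nonneg) (auto dest!: prime_gt_1_nat simp: in_prime_factors_iff)
  ultimately have "0 \<le> of_int (moebius d) * (\<Prod>p\<in>prime_factors d. 1 / (real p - 1))" by simp
  then have *: "real (totient k) / real k * (1 - of_int (moebius d) * (\<Prod>p\<in>prime_factors d. 1 / (real p - 1))) \<le> dens k * 1"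
    unfolding dens_def[symmetric] using dens_pos[OF assms] by (intro mult_left_mono) auto
  have "finite {d. d dvd k \<and> d > 1}" using assms by (auto intro: finite_subset[OF _ finite_divisors_nat[of k]])
  then have "beta_exp k \<le> real (totient k) / real k * (1 - of_int (moebius d) * (\<Prod>p\<in>prime_factors d. 1 / (real p - 1)))"
    using False d by (auto simp: beta_exp_def intro!: Min_le imageI)
  then show ?thesis using * by simp
qed (use beta_exp_eq_dens in auto)

lemma dens_less_1:
  assumes "k > 1"
  shows "dens k < 1"
  using totient_less[OF assms] assms by (simp add: dens_def)

subsection \<open>The generating function near its singularities\<close>

text \<open>A Poisson kernel: on |w| = r one has w - w0 = w cnj(1 - w u) for w0 = r^2 cnj u. The
  integrand is thus a Cauchy integrand of 1 / (1 - w u) at w0, where this function is 1 / (1 -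
  r^2).\<close>

lemma integral_inverse_norm_square:
  assumes "0 < r" "r < 1" "cmod u = 1"
  shows "((\<lambda>x. 1 / (cmod (1 - circlepath 0 r x * u))\<^sup>2) has_integral 1 / (1 - r\<^sup>2)) {0..1}"
proof -
  define w0 where "w0 = of_real (r\<^sup>2) * cnj u"
  define h where "h w = 1 / (1 - w * u)" for w
  have uu: "cnj u * u = 1" using complex_norm_square[of u] assms(3) by (simp add: mult.commute)
  have nz: "1 - w * u \<noteq> 0" if "cmod w \<le> r" for w
  proof
    assume "1 - w * u = 0"
    then have "cmod (w * u) = 1" by (metis eq_iff_diff_eq_0 norm_one)
    then show False using that assms by (simp add: norm_mult)
  qed
  have hol: "h holomorphic_on cball 0 r"
    unfolding h_def by (intro holomorphic_intros) (use nz in auto)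
  have "cmod w0 = r\<^sup>2" using assms by (simp add: w0_def norm_mult norm_power)
  also have "\<dots> < r" using assms by (simp add: power2_eq_square)
  finally have "((\<lambda>w. h w / (w - w0)) has_contour_integral 2 * of_real pi * \<i> * h w0) (circlepath 0 r)"
    using Cauchy_integral_circlepath_simple[OF hol, of w0] by simp
  then have "((\<lambda>x. h (circlepath 0 r x) / (circlepath 0 r x - w0) * vector_derivative (circlepath 0 r) (at x))
      has_integral 2 * of_real pi * \<i> * h w0) {0..1}"
    by (simp add: has_contour_integral)
  also have "(\<lambda>x. h (circlepath 0 r x) / (circlepath 0 r x - w0) * vector_derivative (circlepath 0 r) (at x)) =
     (\<lambda>x. 2 * of_real pi * \<i> * of_real (1 / (cmod (1 - circlepath 0 r x * u))\<^sup>2))"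
  proof
    fix x
    define w where "w = circlepath 0 r x"
    have cw: "cmod w = r" using assms by (simp add: w_def circlepath norm_mult)
    have w0: "w \<noteq> 0" using cw assms by auto
    have ww: "cnj w * w = of_real (r\<^sup>2)" using complex_norm_square[of w] cw by (simp add: mult.commute)
    have "w * cnj (1 - w * u) = w - w0"
      using ww by (simp add: w0_def algebra_simps)
    then have "w - w0 = w * cnj (1 - w * u)" ..
    moreover have "of_real ((cmod (1 - w * u))\<^sup>2) = (1 - w * u) * cnj (1 - w * u)"
      by (rule complex_norm_square)
    moreover have "vector_derivative (circlepath 0 r) (at x) = 2 * of_real pi * \<i> * w"
      unfolding vector_derivative_circlepath by (simp add: w_def circlepath mult_ac)
    ultimately show "h (circlepath 0 r x) / (circlepath 0 r x - w0) * vector_derivative (circlepath 0 r) (at x) =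
      2 * of_real pi * \<i> * of_real (1 / (cmod (1 - circlepath 0 r x * u))\<^sup>2)"
      unfolding w_def[symmetric] using w0 by (simp add: h_def of_real_divide)
  qed
  finally have "((\<lambda>x. 1 / (2 * of_real pi * \<i>) * (2 * of_real pi * \<i> * of_real (1 / (cmod (1 - circlepath 0 r x * u))\<^sup>2)))
     has_integral 1 / (2 * of_real pi * \<i>) * (2 * of_real pi * \<i> * h w0)) {0..1}"
    by (rule has_integral_mult_right)
  then have "((\<lambda>x. complex_of_real (1 / (cmod (1 - circlepath 0 r x * u))\<^sup>2)) has_integral h w0) {0..1}"
    by (simp add: mult.assoc[symmetric])
  then have "((\<lambda>x. Re (complex_of_real (1 / (cmod (1 - circlepath 0 r x * u))\<^sup>2))) has_integral Re (h w0)) {0..1}"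
    by (rule has_integral_linear[OF _ bounded_linear_Re, unfolded o_def])
  moreover have "h w0 = of_real (1 / (1 - r\<^sup>2))" using uu by (simp add: h_def w0_def mult.assoc)
  ultimately show ?thesis by simp
qed

text \<open>With inverse squares of distances as majorant, the integral in Cauchy's coefficient
  formula is evaluated exactly, and the circle need not be cut into arcs.\<close>

lemma fps_nth_circle_bound:
  assumes f: "f holomorphic_on ball 0 1" "f has_fps_expansion F"
    and r: "0 < r" "r < 1" and A: "finite A" "\<And>a. a \<in> A \<Longrightarrow> cmod (u a) = 1"
    and bd: "\<And>z. cmod z = r \<Longrightarrow> cmod (f z) \<le> (\<Sum>a\<in>A. c a / (cmod (1 - z * u a))\<^sup>2)"
  shows "cmod (fps_nth F n) \<le> (\<Sum>a\<in>A. c a) / (1 - r\<^sup>2) / r ^ n"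
proof -
  let ?\<gamma> = "circlepath 0 r"
  have sub: "cball 0 r \<subseteq> ball (0::complex) 1" using r by auto
  have hol: "f holomorphic_on cball 0 r" using f(1) sub holomorphic_on_subset by blast
  have "((\<lambda>u. f u / (u - 0) ^ Suc n) has_contour_integral (2 * pi * \<i>) / fact n * (deriv ^^ n) f 0) ?\<gamma>"
    by (rule Cauchy_has_contour_integral_higher_derivative_circlepath)
       (use hol r in \<open>auto intro: holomorphic_on_imp_continuous_on holomorphic_on_subset[OF hol]\<close>)
  then have I: "((\<lambda>x. f (?\<gamma> x) / (?\<gamma> x) ^ Suc n * vector_derivative ?\<gamma> (at x)) has_integral
      2 * pi * \<i> * fps_nth F n) {0..1}"
    by (simp add: has_contour_integral fps_nth_fps_expansion[OF f(2)])
  define g where "g x = (\<Sum>a\<in>A. c a * (1 / (cmod (1 - ?\<gamma> x * u a))\<^sup>2))" for x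
  have "(g has_integral (\<Sum>a\<in>A. c a * (1 / (1 - r\<^sup>2)))) {0..1}"
    unfolding g_def
    by (intro has_integral_sum[OF A(1)] has_integral_mult_right integral_inverse_norm_square r A(2))
  then have G: "((\<lambda>x. 2 * pi / r ^ n * g x) has_integral 2 * pi / r ^ n * ((\<Sum>a\<in>A. c a) / (1 - r\<^sup>2))) {0..1}"
    using has_integral_mult_right[of g _ _ "2 * pi / r ^ n"] by (simp add: sum_divide_distrib)
  have le: "cmod (f (?\<gamma> x) / (?\<gamma> x) ^ Suc n * vector_derivative ?\<gamma> (at x)) \<le> 2 * pi / r ^ n * g x" for x
  proof -
    have cw: "cmod (?\<gamma> x) = r" using r by (simp add: circlepath norm_mult)
    have "vector_derivative ?\<gamma> (at x) = 2 * of_real pi * \<i> * ?\<gamma> x"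
      unfolding vector_derivative_circlepath by (simp add: circlepath mult_ac)
    have "cmod (f (?\<gamma> x) / (?\<gamma> x) ^ Suc n * vector_derivative ?\<gamma> (at x)) =
        cmod (f (?\<gamma> x)) / r ^ Suc n * (2 * pi * r)"
    proof -
      have "?\<gamma> x \<noteq> 0" using cw r by auto
      then show ?thesis using \<open>vector_derivative ?\<gamma> (at x) = _\<close> r
        by (simp add: norm_mult norm_divide norm_power cw)
    qed
    also have "\<dots> = 2 * pi / r ^ n * cmod (f (?\<gamma> x))" using r by (simp add: field_simps)
    also have "\<dots> \<le> 2 * pi / r ^ n * g x"
      using bd[OF cw] r by (intro mult_left_mono) (auto simp: g_def)
    finally show ?thesis .
  qed
  have "cmod (2 * pi * \<i> * fps_nth F n) \<le> 2 * pi / r ^ n * ((\<Sum>a\<in>A. c a) / (1 - r\<^sup>2))"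
    using integral_norm_bound_integral[OF has_integral_integrable[OF I] has_integral_integrable[OF G] le]
    unfolding integral_unique[OF I] integral_unique[OF G] .
  then have "2 * pi * cmod (fps_nth F n) \<le> 2 * pi * ((\<Sum>a\<in>A. c a) / (1 - r\<^sup>2) / r ^ n)"
    by (simp add: norm_mult mult_ac)
  then show ?thesis by (rule mult_left_le_imp_le) simp
qed

section \<open>The function B in the unit disc\<close>

definition bfun :: "nat \<Rightarrow> complex \<Rightarrow> complex" where
  "bfun k z = exp (- (\<Sum>a<k. of_real (gam k a) * Ln (1 - z * cnj (rt k a))))"

text \<open>For k > 0 this is 1 - z^k, kept as a product because its factors are estimated
  separately.\<close>

definition dpoly :: "nat \<Rightarrow> complex poly" where
  "dpoly k = (\<Prod>a<k. [:1, - cnj (rt k a):])"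

text \<open>The numerator of z B' / B over the common denominator \<open>dpoly k\<close>.\<close>

definition psipoly :: "nat \<Rightarrow> complex poly" where
  "psipoly k = (\<Sum>a<k. smult (of_real (gam k a)) ([:0, cnj (rt k a):] * (\<Prod>b\<in>{..<k}-{a}. [:1, - cnj (rt k b):])))"

text \<open>Keeps the arguments of \<open>Ln\<close> in \<open>bfun\<close> away from the branch cut
  throughout the disc.\<close>

lemma Re_one_minus_rt_pos:
  assumes "cmod z < 1"
  shows "Re (1 - z * cnj (rt k a)) > 0"
proof -
  have "Re (z * cnj (rt k a)) \<le> cmod (z * cnj (rt k a))" by (rule complex_Re_le_cmod)
  then show ?thesis using assms by (simp add: norm_mult)
qed

lemma one_minus_rt:
  assumes "cmod z < 1"
  shows "1 - z * cnj (rt k a) \<noteq> 0" "1 - z * cnj (rt k a) \<notin> \<real>\<^sub>\<le>\<^sub>0"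
  using Re_one_minus_rt_pos[OF assms, of k a] by (auto simp: complex_nonpos_Reals_iff complex_eq_iff)

lemma dpoly_nz:
  assumes "cmod z < 1"
  shows "poly (dpoly k) z \<noteq> 0"
  using one_minus_rt(1)[OF assms, of k] by (auto simp: dpoly_def poly_prod algebra_simps)

lemma bfun_deriv:
  assumes "cmod z < 1"
  shows "(bfun k has_field_derivative bfun k z * (\<Sum>a<k. of_real (gam k a) * (cnj (rt k a) / (1 - z * cnj (rt k a))))) (at z)"
proof -
  have "((\<lambda>z. - (\<Sum>a<k. of_real (gam k a) * Ln (1 - z * cnj (rt k a)))) has_field_derivative
      (\<Sum>a<k. of_real (gam k a) * (cnj (rt k a) / (1 - z * cnj (rt k a))))) (at z)"
    by (rule derivative_eq_intros one_minus_rt(2)[OF assms] refl)+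
       (simp add: sum_negf divide_inverse mult_ac)
  then show ?thesis unfolding bfun_def[abs_def]
    by (rule DERIV_chain2[OF DERIV_exp, THEN DERIV_cong]) simp
qed

lemma bfun_holomorphic: "bfun k holomorphic_on ball 0 1"
proof (rule holomorphic_onI)
  fix z :: complex assume "z \<in> ball 0 1"
  then have "cmod z < 1" by simp
  then show "bfun k field_differentiable at z within ball 0 1"
    using has_field_derivative_at_within[OF bfun_deriv] unfolding field_differentiable_def by blast
qed

lemma psipoly_div_dpoly:
  assumes "cmod z < 1"
  shows "poly (psipoly k) z / poly (dpoly k) z = (\<Sum>a<k. of_real (gam k a) * (z * cnj (rt k a) / (1 - z * cnj (rt k a))))"
proof -
  have D: "poly (dpoly k) z = (1 - z * cnj (rt k a)) * (\<Prod>b\<in>{..<k}-{a}. 1 - z * cnj (rt k b))" if "a < k" for a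
  proof -
    have "poly (dpoly k) z = (\<Prod>b<k. 1 - z * cnj (rt k b))" by (simp add: dpoly_def poly_prod)
    then show ?thesis using that by (simp add: prod.remove[of "{..<k}" a])
  qed
  have "poly (psipoly k) z / poly (dpoly k) z = (\<Sum>a<k. of_real (gam k a) * (z * cnj (rt k a)) *
     (\<Prod>b\<in>{..<k}-{a}. 1 - z * cnj (rt k b)) / poly (dpoly k) z)"
    by (simp add: psipoly_def poly_sum poly_prod sum_divide_distrib mult_ac)
  also have "\<dots> = (\<Sum>a<k. of_real (gam k a) * (z * cnj (rt k a) / (1 - z * cnj (rt k a))))"
  proof (rule sum.cong)
    fix a assume "a \<in> {..<k}"
    then have a: "a < k" by simp
    have "(\<Prod>b\<in>{..<k}-{a}. 1 - z * cnj (rt k b)) \<noteq> 0" using one_minus_rt(1)[OF assms] by simp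
    then show "of_real (gam k a) * (z * cnj (rt k a)) * (\<Prod>b\<in>{..<k}-{a}. 1 - z * cnj (rt k b)) / poly (dpoly k) z =
       of_real (gam k a) * (z * cnj (rt k a) / (1 - z * cnj (rt k a)))"
      unfolding D[OF a] by simp
  qed simp
  finally show ?thesis .
qed

text \<open>Geometric series at each root of unity, with the coefficients combined by Fourier
  inversion.\<close>

lemma has_fps_expansion_log_deriv:
  assumes "k > 0"
  shows "(\<lambda>z. \<Sum>a<k. of_real (gam k a) * (z * cnj (rt k a) / (1 - z * cnj (rt k a)))) has_fps_expansion
     afps (\<lambda>j. of_real (chi k j))"
proof (rule has_fps_expansionI)
  have "eventually (\<lambda>z. z \<in> ball 0 1) (nhds (0::complex))"
    by (rule eventually_nhds_in_open) auto
  then show "\<forall>\<^sub>F z in nhds 0. (\<lambda>n. fps_nth (afps (\<lambda>j. complex_of_real (chi k j))) n * z ^ n) sums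
      (\<Sum>a<k. of_real (gam k a) * (z * cnj (rt k a) / (1 - z * cnj (rt k a))))"
  proof eventually_elim
    case (elim z)
    then have z: "cmod z < 1" by simp
    have "(\<lambda>n. \<Sum>a<k. of_real (gam k a) * (if n = 0 then 0 else (z * cnj (rt k a)) ^ n)) sums
      (\<Sum>a<k. of_real (gam k a) * (z * cnj (rt k a) / (1 - z * cnj (rt k a))))"
    proof (intro sums_sum sums_mult)
      fix a
      let ?w = "z * cnj (rt k a)"
      have "(\<lambda>n. ?w ^ n - (if n = 0 then 1 else 0)) sums (1 / (1 - ?w) - 1)"
        by (intro sums_diff geometric_sums sums_If_finite_set[of "{0}" "\<lambda>_. 1 :: complex", simplified])
           (use z in \<open>simp add: norm_mult\<close>)
      moreover have "1 / (1 - ?w) - 1 = ?w / (1 - ?w)"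
        using one_minus_rt(1)[OF z, of k a] by (simp add: field_simps)
      moreover have "(\<lambda>n. ?w ^ n - (if n = 0 then 1 else 0)) = (\<lambda>n. if n = 0 then 0 else ?w ^ n)"
        by auto
      ultimately show "(\<lambda>n. if n = 0 then 0 else ?w ^ n) sums (?w / (1 - ?w))" by simp
    qed
    moreover have "(\<Sum>a<k. of_real (gam k a) * (if n = 0 then 0 else (z * cnj (rt k a)) ^ n)) =
        fps_nth (afps (\<lambda>j. complex_of_real (chi k j))) n * z ^ n" for n
      by (simp add: afps_nth sum_gam_rt[OF assms, symmetric] power_mult_distrib sum_distrib_left mult_ac)
    ultimately show ?case by simp
  qed
qed

lemma bfun_has_fps_expansion:
  assumes "k > 0"
  shows "bfun k has_fps_expansion efps (\<lambda>j. of_real (chi k j))"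
proof -
  define F where "F = fps_expansion (bfun k) 0"
  have F: "bfun k has_fps_expansion F"
    unfolding F_def by (rule has_fps_expansion_fps_expansion[OF _ _ bfun_holomorphic]) auto
  have 1: "(\<lambda>z. z * deriv (bfun k) z) has_fps_expansion fps_XD F"
    unfolding fps_XD_def o_def
    by (intro has_fps_expansion_mult has_fps_expansion_deriv F has_fps_expansion_fps_X)
  have 2: "(\<lambda>z. (\<Sum>a<k. of_real (gam k a) * (z * cnj (rt k a) / (1 - z * cnj (rt k a)))) * bfun k z) has_fps_expansion
      afps (\<lambda>j. of_real (chi k j)) * F"
    by (intro has_fps_expansion_mult has_fps_expansion_log_deriv assms F)
  have "eventually (\<lambda>z. z \<in> ball 0 1) (nhds (0::complex))"
    by (rule eventually_nhds_in_open) auto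
  then have ev: "eventually (\<lambda>z. z * deriv (bfun k) z = (\<Sum>a<k. of_real (gam k a) * (z * cnj (rt k a) / (1 - z * cnj (rt k a)))) * bfun k z) (nhds 0)"
  proof eventually_elim
    case (elim z)
    then show ?case using DERIV_imp_deriv[OF bfun_deriv[of z k]] by (simp add: sum_distrib_left mult_ac)
  qed
  have "(\<lambda>z. z * deriv (bfun k) z) has_fps_expansion afps (\<lambda>j. of_real (chi k j)) * F"
    by (rule has_fps_expansion_cong[THEN iffD2, OF ev refl 2])
  then have "fps_XD F = afps (\<lambda>j. of_real (chi k j)) * F"
    using 1 fps_expansion_unique_complex by blast
  moreover have "fps_nth F 0 = 1"
    using fps_nth_fps_expansion[OF F, of 0] by (simp add: bfun_def)
  ultimately have "F = efps (\<lambda>j. of_real (chi k j))" by (rule efps_unique)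
  then show ?thesis using F by simp
qed

text \<open>The logarithmic derivative z B' / B is rational with denominator \<open>dpoly k\<close>,
  so every application of z d/dz raises the power of this denominator by one. Of the numerator only
  its being a polynomial matters, since it is then bounded on the disc.\<close>

lemma bfun_XD_pow:
  assumes "k > 0"
  shows "\<exists>Q. (\<lambda>z. bfun k z * poly Q z * inverse (poly (dpoly k) z) ^ i) has_fps_expansion
     (fps_XD ^^ i) (efps (\<lambda>j. of_real (chi k j)))"
proof (induction i)
  case 0
  show ?case using bfun_has_fps_expansion[OF assms] by (intro exI[of _ 1]) simp
next
  case (Suc i)
  then obtain Q where Q: "(\<lambda>z. bfun k z * poly Q z * inverse (poly (dpoly k) z) ^ i) has_fps_expansion
     (fps_XD ^^ i) (efps (\<lambda>j. of_real (chi k j)))" by blast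
  define D where "D = dpoly k"
  define G where "G z = bfun k z * poly Q z * inverse (poly D z) ^ i" for z
  \<comment> \<open>The three terms are the derivatives of B, of the polynomial and of the power of
    the denominator.\<close>
  define Q' where "Q' = Q * psipoly k + [:0, 1:] * pderiv Q * D - smult (of_nat i) ([:0, 1:] * pderiv D * Q)"
  have 1: "(\<lambda>z. z * deriv G z) has_fps_expansion (fps_XD ^^ Suc i) (efps (\<lambda>j. of_real (chi k j)))"
    using has_fps_expansion_mult[OF has_fps_expansion_fps_X has_fps_expansion_deriv[OF Q]]
    by (simp add: fps_XD_def G_def[abs_def] D_def)
  have "eventually (\<lambda>z. z \<in> ball 0 1) (nhds (0::complex))"
    by (rule eventually_nhds_in_open) auto
  then have ev: "eventually (\<lambda>z. z * deriv G z = bfun k z * poly Q' z * inverse (poly D z) ^ Suc i) (nhds 0)"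
  proof eventually_elim
    case (elim z)
    then have z: "cmod z < 1" by simp
    define b where "b = bfun k z"
    define I where "I = inverse (poly D z)"
    have DI: "poly D z * I = 1" using dpoly_nz[OF z, of k] by (simp add: I_def D_def)
    define S where "S = (\<Sum>a<k. of_real (gam k a) * (cnj (rt k a) / (1 - z * cnj (rt k a))))"
    have zS: "z * S = poly (psipoly k) z * I"
      using psipoly_div_dpoly[OF z, of k] by (simp add: S_def sum_distrib_left mult_ac I_def D_def divide_inverse)
    have dI: "((\<lambda>z. inverse (poly D z) ^ i) has_field_derivative - (of_nat i) * I ^ Suc i * poly (pderiv D) z) (at z)"
    proof (cases i)
      case (Suc i')
      have "((\<lambda>z. inverse (poly D z) ^ i) has_field_derivative 
          of_nat i * (- (inverse (poly D z) * poly (pderiv D) z * inverse (poly D z))) * inverse (poly D z) ^ (i - Suc 0)) (at z)"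
        by (rule derivative_eq_intros poly_DERIV refl)+ (use dpoly_nz[OF z, of k] in \<open>auto simp: D_def\<close>)
      then show ?thesis by (rule DERIV_cong) (simp add: Suc I_def algebra_simps)
    qed simp
    have "(G has_field_derivative (b * S * poly Q z + poly (pderiv Q) z * b) * I ^ i + 
        - (of_nat i) * I ^ Suc i * poly (pderiv D) z * (b * poly Q z)) (at z)"
      unfolding G_def[abs_def] b_def I_def S_def
      by (intro DERIV_mult bfun_deriv[OF z] poly_DERIV dI[unfolded I_def])
    then have "z * deriv G z = z * ((b * S * poly Q z + poly (pderiv Q) z * b) * I ^ i + 
        - (of_nat i) * I ^ Suc i * poly (pderiv D) z * (b * poly Q z))"
      by (simp add: DERIV_imp_deriv)
    also have "\<dots> = b * (z * S) * poly Q z * I ^ i + z * poly (pderiv Q) z * b * I ^ i * (poly D z * I)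
        - of_nat i * z * I ^ Suc i * poly (pderiv D) z * (b * poly Q z)"
      unfolding DI by (simp add: algebra_simps)
    also have "\<dots> = b * poly Q' z * I ^ Suc i"
      unfolding zS Q'_def by (simp add: algebra_simps)
    finally show ?case by (simp add: b_def I_def)
  qed
  have "(\<lambda>z. bfun k z * poly Q' z * inverse (poly D z) ^ Suc i) has_fps_expansion
      (fps_XD ^^ Suc i) (efps (\<lambda>j. of_real (chi k j)))"
    by (rule has_fps_expansion_cong[THEN iffD1, OF ev refl 1])
  then show ?case unfolding D_def by blast
qed

section \<open>Size of B and its derivatives near the roots of unity\<close>

lemma inj_on_rt:
  assumes "a < k" "b < k" "rt k a = rt k b"
  shows "a = b"
proof -
  have aux: "a = b" if "a \<le> b" "b < k" "rt k a = rt k b" for a b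
  proof -
    have "rt k b = rt k a * rt k (b - a)"
      using that(1) by (simp add: rt_def cis_mult add_divide_distrib[symmetric] of_nat_diff algebra_simps)
    moreover have "rt k a \<noteq> 0" using norm_rt[of k a] by (metis norm_zero zero_neq_one)
    ultimately have "rt k (b - a) = 1" using that(3) by simp
    then have "k dvd b - a"
      using cis_root_eq_1_iff[of k "b - a"] that(2) by (simp add: rt_def)
    then show "a = b" using that by (auto dest: dvd_imp_le)
  qed
  show ?thesis using aux[of a b] aux[of b a] assms by (cases "a \<le> b") auto
qed

lemma cmod_one_minus_rt: "cmod (1 - z * cnj (rt k a)) = cmod (rt k a - z)"
proof -
  have "rt k a * cnj (rt k a) = 1" using complex_norm_square[of "rt k a"] by simp
  then have "rt k a * (1 - z * cnj (rt k a)) = rt k a - z" by (simp add: algebra_simps)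
  then have "cmod (rt k a) * cmod (1 - z * cnj (rt k a)) = cmod (rt k a - z)"
    by (metis norm_mult)
  then show ?thesis by simp
qed

text \<open>Let a be a root nearest to z; any other root is then at least half the smallest distance
  between two distinct roots away.\<close>

lemma ex_nearest_rt:
  assumes "k > 0"
  shows "\<exists>\<delta>>0. \<delta> \<le> 1 \<and> (\<forall>z. \<exists>a<k. \<forall>b<k. b \<noteq> a \<longrightarrow> \<delta> \<le> cmod (1 - z * cnj (rt k b)))"
proof -
  \<comment> \<open>The inserted 1 gives the bound \<delta> <= 1 and keeps the set nonempty when k =
    1.\<close>
  define T where "T = insert 1 ((\<lambda>(a,b). cmod (rt k a - rt k b) / 2) ` {(a,b). a < k \<and> b < k \<and> a \<noteq> b})"
  have fT: "finite T"
    unfolding T_def by (intro finite.insertI finite_imageI, rule finite_subset[of _ "{..<k} \<times> {..<k}"]) auto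
  have "Min T > 0"
    using fT inj_on_rt[of _ k] by (subst Min_gr_iff) (auto simp: T_def)
  moreover have "Min T \<le> 1" using fT by (intro Min_le) (auto simp: T_def)
  moreover have "\<exists>a<k. \<forall>b<k. b \<noteq> a \<longrightarrow> Min T \<le> cmod (1 - z * cnj (rt k b))" for z
  proof -
    have ne: "{..<k} \<noteq> {}" using assms by auto
    obtain a where a: "a < k" "\<And>b. b < k \<Longrightarrow> cmod (rt k a - z) \<le> cmod (rt k b - z)"
    proof -
      have "Min ((\<lambda>a. cmod (rt k a - z)) ` {..<k}) \<in> (\<lambda>a. cmod (rt k a - z)) ` {..<k}"
        using ne by (intro Min_in) auto
      then obtain a where "Min ((\<lambda>a. cmod (rt k a - z)) ` {..<k}) = cmod (rt k a - z)" "a \<in> {..<k}"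
        by (rule imageE)
      moreover have "Min ((\<lambda>a. cmod (rt k a - z)) ` {..<k}) \<le> cmod (rt k b - z)" if "b < k" for b
        using that by (intro Min_le) auto
      ultimately show ?thesis using that[of a] by simp
    qed
    have "Min T \<le> cmod (1 - z * cnj (rt k b))" if b: "b < k" "b \<noteq> a" for b
    proof -
      have "Min T \<le> cmod (rt k a - rt k b) / 2"
        using fT a b by (intro Min_le) (auto simp: T_def)
      also have "cmod (rt k a - rt k b) \<le> cmod (rt k a - z) + cmod (rt k b - z)"
        using norm_triangle_ineq4[of "rt k a - z" "rt k b - z"] by simp
      also have "\<dots> \<le> 2 * cmod (rt k b - z)" using a(2)[OF b(1)] by simp
      finally show ?thesis by (simp add: cmod_one_minus_rt)
    qed
    then show ?thesis using a(1) by blast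
  qed
  ultimately show ?thesis by blast
qed

lemma norm_bfun:
  assumes "cmod z < 1"
  shows "cmod (bfun k z) = (\<Prod>a<k. cmod (1 - z * cnj (rt k a)) powr (- gam k a))"
proof -
  have "cmod (bfun k z) = exp (\<Sum>a<k. - gam k a * ln (cmod (1 - z * cnj (rt k a))))"
    unfolding bfun_def norm_exp_eq_Re using one_minus_rt(1)[OF assms, of k] by (simp add: sum_negf)
  also have "\<dots> = (\<Prod>a<k. exp (- gam k a * ln (cmod (1 - z * cnj (rt k a)))))"
    by (rule exp_sum) simp
  also have "\<dots> = (\<Prod>a<k. cmod (1 - z * cnj (rt k a)) powr (- gam k a))"
    using one_minus_rt(1)[OF assms, of k] by (intro prod.cong) (auto simp: powr_def)
  finally show ?thesis .
qed

lemma powr_le_of_bounds: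
  assumes "0 < \<delta>" "\<delta> \<le> 1" "\<delta> \<le> x" "x \<le> (2::real)" "\<bar>g\<bar> \<le> 1"
  shows "x powr g \<le> 2 / \<delta>"
proof (cases "g \<ge> 0")
  case True
  have "x powr g \<le> 2 powr g" using assms True by (intro powr_mono2) auto
  also have "\<dots> \<le> 2 powr 1" using assms by (intro powr_mono) auto
  also have "\<dots> \<le> 2 / \<delta>" using assms by (simp add: field_simps)
  finally show ?thesis .
next
  case False
  have "x powr g \<le> \<delta> powr g" using assms False by (intro powr_mono2') auto
  also have "\<dots> \<le> \<delta> powr (- 1)" using assms by (intro powr_mono') auto
  also have "\<dots> \<le> 2 / \<delta>" using assms by (simp add: powr_minus field_simps)
  finally show ?thesis .
qed

lemma cmod_one_minus_rt_le: "cmod z < 1 \<Longrightarrow> cmod (1 - z * cnj (rt k a)) \<le> 2"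
  unfolding cmod_one_minus_rt using norm_triangle_ineq4[of "rt k a" z] by simp

text \<open>Only the factor of the nearest root can be large. The other distances lie in
  [\<delta>, 2], and their powers with exponents in [-1, 1] are at most M = 2 / \<delta>.\<close>

lemma bfun_XD_bound:
  assumes "k > 0"
  shows "\<exists>C>0. \<forall>z. cmod z < 1 \<longrightarrow> (\<exists>a<k. cmod (bfun k z * poly Q z * inverse (poly (dpoly k) z) ^ N) \<le>
     C * cmod (1 - z * cnj (rt k a)) powr (- gam k a - real N))"
proof -
  obtain \<delta> where \<delta>: "\<delta> > 0" "\<delta> \<le> 1"
    "\<And>z. \<exists>a<k. \<forall>b<k. b \<noteq> a \<longrightarrow> \<delta> \<le> cmod (1 - z * cnj (rt k b))"
    using ex_nearest_rt[OF assms] by blast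
  obtain CQ where CQ: "CQ > 0" "\<And>z. cmod z \<le> 1 \<Longrightarrow> cmod (poly Q z) \<le> CQ"
    using poly_bound_exists[of 1 Q] by auto
  define M where "M = 2 / \<delta>"
  have M: "M \<ge> 1" using \<delta> by (simp add: M_def field_simps)
  have "\<exists>a<k. cmod (bfun k z * poly Q z * inverse (poly (dpoly k) z) ^ N) \<le>
     (CQ * M ^ k * (M ^ k) ^ N) * cmod (1 - z * cnj (rt k a)) powr (- gam k a - real N)" if z: "cmod z < 1" for z
  proof -
    define x where "x a = cmod (1 - z * cnj (rt k a))" for a
    obtain a where a: "a < k" "\<And>b. b < k \<Longrightarrow> b \<noteq> a \<Longrightarrow> \<delta> \<le> x b"
      using \<delta>(3)[of z] by (auto simp: x_def)
    have x0: "x b > 0" for b using one_minus_rt(1)[OF z, of k b] by (simp add: x_def)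
    have x2: "x b \<le> 2" for b using cmod_one_minus_rt_le[OF z] by (simp add: x_def)
    have others: "(\<Prod>b\<in>{..<k}-{a}. h b) \<le> M ^ k" if "\<And>b. b < k \<Longrightarrow> b \<noteq> a \<Longrightarrow> 0 \<le> h b \<and> h b \<le> M" for h
    proof -
      have "(\<Prod>b\<in>{..<k}-{a}. h b) \<le> (\<Prod>b\<in>{..<k}-{a}. M)" by (rule prod_mono) (use that in auto)
      also have "\<dots> \<le> M ^ k" using M card_Diff1_le[of "{..<k}" a] by (auto intro!: power_increasing)
      finally show ?thesis .
    qed
    have "cmod (bfun k z) = x a powr (- gam k a) * (\<Prod>b\<in>{..<k}-{a}. x b powr (- gam k b))"
      unfolding norm_bfun[OF z] x_def[symmetric] using a(1) by (simp add: prod.remove)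
    also have "\<dots> \<le> x a powr (- gam k a) * M ^ k"
      using a(2) x2 \<delta> abs_gam_le[OF assms]
      by (intro mult_left_mono others) (auto intro!: powr_le_of_bounds simp: M_def)
    finally have 1: "cmod (bfun k z) \<le> x a powr (- gam k a) * M ^ k" .
    have "cmod (inverse (poly (dpoly k) z)) = inverse (\<Prod>b<k. x b)"
      by (simp add: dpoly_def poly_prod norm_inverse prod_norm[symmetric] x_def)
    also have "\<dots> = (\<Prod>b<k. inverse (x b))" by (rule prod_inversef[symmetric, unfolded o_def])
    also have "\<dots> = inverse (x a) * (\<Prod>b\<in>{..<k}-{a}. inverse (x b))"
      using a(1) by (simp add: prod.remove)
    also have "\<dots> \<le> inverse (x a) * M ^ k"
    proof (intro mult_left_mono others)
      fix b assume "b < k" "b \<noteq> a"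
      then have "inverse (x b) \<le> inverse \<delta>" using a(2) \<delta> by (intro le_imp_inverse_le) auto
      also have "\<dots> \<le> M" using \<delta> by (simp add: M_def field_simps)
      finally show "0 \<le> inverse (x b) \<and> inverse (x b) \<le> M" using x0[of b] by simp
    qed (use x0[of a] in simp)
    finally have 2: "cmod (inverse (poly (dpoly k) z)) \<le> inverse (x a) * M ^ k" .
    have "cmod (bfun k z * poly Q z * inverse (poly (dpoly k) z) ^ N) =
        cmod (bfun k z) * cmod (poly Q z) * cmod (inverse (poly (dpoly k) z)) ^ N"
      by (simp add: norm_mult norm_power)
    also have "\<dots> \<le> (x a powr (- gam k a) * M ^ k) * CQ * (inverse (x a) * M ^ k) ^ N"
      using 1 2 CQ z x0[of a] M by (intro mult_mono power_mono) auto
    also have "\<dots> = (CQ * M ^ k * (M ^ k) ^ N) * (x a powr (- gam k a) * inverse (x a) ^ N)"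
      by (simp add: power_mult_distrib mult_ac)
    also have "x a powr (- gam k a) * inverse (x a) ^ N = x a powr (- gam k a - real N)"
      using x0[of a] by (simp add: powr_diff powr_realpow power_inverse divide_inverse)
    finally show ?thesis using a(1) unfolding x_def by blast
  qed
  then show ?thesis using CQ M by (intro exI[of _ "CQ * M ^ k * (M ^ k) ^ N"]) auto
qed

text \<open>
  With eight applications of \<^term>\<open>fps_XD\<close> the singularities on the unit circle become so
  strong that polynomial growth of \<^term>\<open>X\<close> away from them does no harm, and the integral over
  the circle of radius \<open>1 - 1/n\<close> is dominated by the arcs of length \<open>1/n\<close> around them.
\<close>

lemma XD_coeff_bound:
  assumes "k > 0"
  shows "\<exists>C>0. \<forall>n X F x. n \<ge> 2 \<longrightarrow> X holomorphic_on UNIV \<longrightarrow> X has_fps_expansion F \<longrightarrow> (\<forall>a<k. 0 \<le> x a) \<longrightarrow>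
     (\<forall>a<k. \<forall>z. cmod z = 1 - 1 / real n \<longrightarrow> cmod (X z) \<le> x a * (real n * cmod (1 - z * cnj (rt k a))) ^ 5) \<longrightarrow>
     cmod (fps_nth ((fps_XD ^^ 8) (efps (\<lambda>j. of_real (chi k j))) * F) n) \<le>
     C * (\<Sum>a<k. x a * real n powr (gam k a + 7))"
proof -
  obtain Q where Q: "(\<lambda>z. bfun k z * poly Q z * inverse (poly (dpoly k) z) ^ 8) has_fps_expansion
     (fps_XD ^^ 8) (efps (\<lambda>j. of_real (chi k j)))"
    using bfun_XD_pow[OF assms] by blast
  obtain C where C: "C > 0" "\<And>z. cmod z < 1 \<Longrightarrow> \<exists>a<k. cmod (bfun k z * poly Q z * inverse (poly (dpoly k) z) ^ 8) \<le>
     C * cmod (1 - z * cnj (rt k a)) powr (- gam k a - real 8)"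
    using bfun_XD_bound[OF assms, of Q 8] by blast
  have "cmod (fps_nth ((fps_XD ^^ 8) (efps (\<lambda>j. of_real (chi k j))) * F) n) \<le>
     (exp 2 * C) * (\<Sum>a<k. x a * real n powr (gam k a + 7))"
    if n: "n \<ge> 2" and X: "X holomorphic_on UNIV" "X has_fps_expansion F" and x0: "\<And>a. a < k \<Longrightarrow> 0 \<le> x a"
    and bd: "\<And>a z. a < k \<Longrightarrow> cmod z = 1 - 1 / real n \<Longrightarrow> cmod (X z) \<le> x a * (real n * cmod (1 - z * cnj (rt k a))) ^ 5"
    for n X F x
  proof -
    define r where "r = 1 - 1 / real n"
    have r: "0 < r" "r < 1" using n by (auto simp: r_def)
    define f where "f z = bfun k z * poly Q z * inverse (poly (dpoly k) z) ^ 8 * X z" for z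
    define c where "c a = C * x a * real n powr (gam k a + 6)" for a
    have hol: "f holomorphic_on ball 0 1"
      unfolding f_def using dpoly_nz
      by (intro holomorphic_intros bfun_holomorphic holomorphic_on_subset[OF X(1)]) auto
    have ex: "f has_fps_expansion (fps_XD ^^ 8) (efps (\<lambda>j. of_real (chi k j))) * F"
      unfolding f_def by (rule has_fps_expansion_mult[OF Q X(2)])
    have c0: "c a \<ge> 0" if "a < k" for a using x0[OF that] C(1) by (simp add: c_def)
    have fb: "cmod (f z) \<le> (\<Sum>a<k. c a / (cmod (1 - z * cnj (rt k a)))\<^sup>2)" if z: "cmod z = r" for z
    proof -
      have z1: "cmod z < 1" using z r by simp
      obtain a where a: "a < k" "cmod (bfun k z * poly Q z * inverse (poly (dpoly k) z) ^ 8) \<le>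
          C * cmod (1 - z * cnj (rt k a)) powr (- gam k a - real 8)" using C(2)[OF z1] by blast
      define t where "t = cmod (1 - z * cnj (rt k a))"
      have t: "real n * t \<ge> 1"
      proof -
        have "1 - cmod z \<le> t"
          unfolding t_def cmod_one_minus_rt using norm_triangle_ineq2[of "rt k a" z] by simp
        then have "1 / real n \<le> t" using z by (simp add: r_def)
        then show ?thesis using n by (simp add: field_simps)
      qed
      have t0: "t > 0" 
      proof -
        have "0 < real n * t" using t by simp
        then show ?thesis using n by (simp add: zero_less_mult_iff)
      qed
      have "cmod (f z) \<le> (C * t powr (- gam k a - real 8)) * (x a * (real n * t) ^ 5)"
        unfolding f_def norm_mult[of _ "X z"] using a(2) bd[OF a(1)] z C(1)
        by (intro mult_mono) (auto simp: t_def r_def)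
      also have "\<dots> = C * x a * (t powr (- gam k a - 8) * (real n * t) ^ 5)" by simp
      \<comment> \<open>The balance that fixes the number 8: of the powers of 1 / t, five cancel the
        growth of X, two form the kernel 1 / t^2, and the last makes the exponent of n t nonpositive
        because |gam| <= 1; here n t >= 1.\<close>
      also have "t powr (- gam k a - 8) * (real n * t) ^ 5 = real n powr (gam k a + 6) * ((real n * t) powr (- gam k a - 1) / t\<^sup>2)"
      proof -
        have "(real n * t) powr (- gam k a - 1) = real n powr (- gam k a - 1) * t powr (- gam k a - 1)"
          using t0 by (simp add: powr_mult)
        moreover have "real n powr (gam k a + 6) * real n powr (- gam k a - 1) = real n ^ 5"
          unfolding powr_add[symmetric] using n by simp
        moreover have "t powr (- gam k a - 1) / t\<^sup>2 = t powr (- gam k a - 8) * t ^ 5"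
        proof -
          have "t powr (- gam k a - 1) / t powr 2 = t powr (- gam k a - 8) * t powr 5"
            unfolding powr_add[symmetric] powr_diff[symmetric] by simp
          then show ?thesis using t0 by simp
        qed
        ultimately show ?thesis
          by (simp only: power_mult_distrib mult.assoc[symmetric] times_divide_eq_right[symmetric])
            (simp add: mult_ac)
      qed
      also have "C * x a * (real n powr (gam k a + 6) * ((real n * t) powr (- gam k a - 1) / t\<^sup>2)) \<le>
          C * x a * (real n powr (gam k a + 6) * (1 / t\<^sup>2))"
      proof (intro mult_left_mono divide_right_mono)
        have "(real n * t) powr (- gam k a - 1) \<le> (real n * t) powr 0"
          using t abs_gam_le[OF assms, of a] by (intro powr_mono) auto
        then show "(real n * t) powr (- gam k a - 1) \<le> 1" using n t0 by simp
      qed (use C(1) x0[OF a(1)] in auto)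
      also have "\<dots> = c a / t\<^sup>2" by (simp add: c_def)
      also have "\<dots> \<le> (\<Sum>a<k. c a / (cmod (1 - z * cnj (rt k a)))\<^sup>2)"
        unfolding t_def using a(1) c0 by (intro member_le_sum) auto
      finally show ?thesis .
    qed
    have "cmod (fps_nth ((fps_XD ^^ 8) (efps (\<lambda>j. of_real (chi k j))) * F) n) \<le> (\<Sum>a<k. c a) / (1 - r\<^sup>2) / r ^ n"
      by (rule fps_nth_circle_bound[OF hol ex r _ _ fb]) auto
    also have "\<dots> \<le> (\<Sum>a<k. c a) * real n * exp 2"
    proof -
      have S0: "(\<Sum>a<k. c a) \<ge> 0" using c0 by (intro sum_nonneg) auto
      have "1 - r\<^sup>2 = 1 / real n * (1 + r)"
        by (simp add: r_def power2_eq_square algebra_simps)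
      then have "1 / real n \<le> 1 - r\<^sup>2" using r n by (simp add: field_simps)
      then have "1 / (1 - r\<^sup>2) \<le> 1 / (1 / real n)" using n by (intro frac_le) auto
      then have "1 / (1 - r\<^sup>2) \<le> real n" by simp
      \<comment> \<open>(1 - 1 / n)^(- n) is bounded, while 1 / (1 - r^2) costs a factor n: hence
        the exponent \<open>gam k a + 7\<close> in the result against 6 in \<open>c\<close>.\<close>
      moreover have "1 / r ^ n \<le> exp 2"
      proof -
        have "1 / r = 1 + 1 / (real n - 1)" using n by (simp add: r_def field_simps)
        also have "\<dots> \<le> exp (1 / (real n - 1))" by (rule exp_ge_add_one_self)
        finally have "(1 / r) ^ n \<le> exp (1 / (real n - 1)) ^ n"
          using r by (intro power_mono) auto
        also have "\<dots> = exp (real n / (real n - 1))" by (simp flip: exp_of_nat_mult)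
        also have "\<dots> \<le> exp 2" using n by (simp add: field_simps)
        finally show ?thesis by (simp add: power_divide)
      qed
      ultimately have "(\<Sum>a<k. c a) * (1 / (1 - r\<^sup>2)) * (1 / r ^ n) \<le> (\<Sum>a<k. c a) * real n * exp 2"
        using S0 r by (intro mult_mono) (auto simp: power_le_one_iff)
      then show ?thesis by simp
    qed
    also have "\<dots> = (exp 2 * C) * (\<Sum>a<k. x a * real n powr (gam k a + 7))"
    proof -
      have "real n powr (gam k a + 6) * real n = real n powr (gam k a + 7)" for a
        using n powr_add[of "real n" "gam k a + 6" 1] by (simp add: add.assoc)
      then have "c a * real n * exp 2 = (exp 2 * C) * (x a * real n powr (gam k a + 7))" for a
        by (simp add: c_def mult_ac)
      then show ?thesis by (simp only: sum_distrib_left sum_distrib_right)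
    qed
    finally show ?thesis .
  qed
  then show ?thesis using C(1) by (intro exI[of _ "exp 2 * C"]) auto
qed

subsection \<open>Comparison of coefficients\<close>

text \<open>Each term is at most 4 / (j + 1 / t), whether j lies below or above 1 / t, and this is 4
  times a bound by increments of the logarithm. The factor 4 becomes the fourth power in the growth
  bounds for R.\<close>

lemma sum_min_div_le:
  assumes "t > (0::real)"
  shows "(\<Sum>j=1..n. min (real j * t) 2 / real j) \<le> 4 * ln (1 + real n * t)"
proof -
  define a where "a = 1 / t"
  have a: "a > 0" using assms by (simp add: a_def)
  have "(\<Sum>j=1..n. min (real j * t) 2 / real j) \<le> 4 * (ln (real n + a) - ln a)"
  proof (induction n)
    case (Suc n)
    let ?j = "real n + 1"
    have "min (?j * t) 2 / ?j \<le> 4 * (1 / ((real n + a) + 1))"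
    proof (cases "?j * t \<le> 1")
      case True
      then have "?j \<le> a" using assms by (simp add: a_def field_simps)
      then have "4 * (1 / (a + a)) \<le> 4 * (1 / ((real n + a) + 1))" using a by (intro mult_left_mono divide_left_mono) auto
      moreover have "4 * (1 / (a + a)) = 2 * t" using assms by (simp add: a_def)
      moreover have "min (?j * t) 2 / ?j \<le> t" using True by (simp add: field_simps)
      ultimately show ?thesis using assms by simp
    next
      case False
      then have "a \<le> ?j" using assms by (simp add: a_def field_simps)
      have "min (?j * t) 2 / ?j \<le> 2 / ?j" by (intro divide_right_mono) auto
      also have "\<dots> = 4 * (1 / (?j + ?j))" by (simp add: field_simps)
      also have "\<dots> \<le> 4 * (1 / ((real n + a) + 1))"
        using \<open>a \<le> ?j\<close> a by (intro mult_left_mono divide_left_mono) auto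
      finally show ?thesis .
    qed
    also have "\<dots> \<le> 4 * (ln ((real n + a) + 1) - ln (real n + a))"
      using a by (intro mult_left_mono inverse_Suc_le_ln) auto
    finally show ?case using Suc by (simp add: algebra_simps)
  qed simp
  also have "ln (real n + a) - ln a = ln (1 + real n * t)"
  proof -
    have "real n + a = a * (1 + real n * t)" using assms by (simp add: a_def field_simps)
    moreover have "1 + real n * t > 0" using assms by (simp add: add_pos_nonneg)
    ultimately show ?thesis using a by (simp add: ln_mult)
  qed
  finally show ?thesis .
qed

lemma norm_power_rt_diff:
  assumes "cmod z \<le> 1"
  shows "cmod (z ^ j - rt k a ^ j) \<le> min (real j * cmod (1 - z * cnj (rt k a))) 2"
proof -
  have "cmod (z ^ j - rt k a ^ j) \<le> real j * cmod (z - rt k a)"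
    using norm_power_diff[of z "rt k a" j] assms by simp
  moreover have "cmod (z ^ j - rt k a ^ j) \<le> cmod (z ^ j) + cmod (rt k a ^ j)" by (rule norm_triangle_ineq4)
  moreover have "cmod (z ^ j) \<le> 1" using assms by (simp add: norm_power power_le_one)
  ultimately show ?thesis by (simp add: cmod_one_minus_rt norm_minus_commute norm_power)
qed

text \<open>The real part is affine on the segment from a to b, so M bounds the derivative of exp
  there.\<close>

lemma norm_exp_diff_le:
  fixes a b :: complex
  assumes "cmod (exp a) \<le> M" "cmod (exp b) \<le> M"
  shows "cmod (exp a - exp b) \<le> M * cmod (a - b)"
proof (rule field_differentiable_bound[of "closed_segment a b" exp exp])
  fix z assume "z \<in> closed_segment a b"
  then obtain u where u: "0 \<le> u" "u \<le> 1" "z = (1 - u) *\<^sub>R a + u *\<^sub>R b"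
    by (auto simp: closed_segment_def)
  have M: "M > 0" using assms(1) exp_not_eq_zero by (meson less_le_trans zero_less_norm_iff)
  have "Re a \<le> ln M" "Re b \<le> ln M" using assms M by (simp_all add: ln_ge_iff)
  then have "(1 - u) * Re a + u * Re b \<le> (1 - u) * ln M + u * ln M"
    using u by (intro add_mono mult_left_mono) auto
  moreover have "Re z = (1 - u) * Re a + u * Re b" by (simp add: u(3))
  ultimately have "Re z \<le> ln M" by (simp add: algebra_simps)
  then show "cmod (exp z) \<le> M" using M by (simp add: ln_ge_iff)
qed (auto intro!: derivative_eq_intros)

section \<open>The function R, with d j in the role of fhat j - 1\<close>

definition lpoly :: "(nat \<Rightarrow> complex) \<Rightarrow> nat \<Rightarrow> complex \<Rightarrow> complex" where
  "lpoly d n z = (\<Sum>j=1..n. d j / of_nat j * z ^ j)"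

lemma lpoly_holomorphic: "(\<lambda>z. exp (lpoly d n z)) holomorphic_on UNIV"
  unfolding lpoly_def by (intro holomorphic_intros) auto

lemma exp_lpoly_has_fps_expansion:
  assumes "\<And>j. j > n \<Longrightarrow> d j = 0"
  shows "(\<lambda>z. exp (lpoly d n z)) has_fps_expansion efps d"
proof -
  define R where "R z = exp (lpoly d n z)" for z
  define F where "F = fps_expansion R 0"
  have F: "R has_fps_expansion F"
    unfolding F_def by (rule has_fps_expansion_fps_expansion[of UNIV]) (use lpoly_holomorphic in \<open>auto simp: R_def[abs_def]\<close>)
  have 1: "(\<lambda>z. z * deriv R z) has_fps_expansion fps_XD F"
    unfolding fps_XD_def o_def
    by (intro has_fps_expansion_mult has_fps_expansion_deriv F has_fps_expansion_fps_X)
  have S: "(\<lambda>z. \<Sum>j=1..n. d j * z ^ j) has_fps_expansion (\<Sum>j=1..n. fps_const (d j) * fps_X ^ j)"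
    by (intro has_fps_expansion_sum has_fps_expansion_cmult_left has_fps_expansion_fps_X_power)
  have "(\<Sum>j=1..n. fps_const (d j) * fps_X ^ j) = afps d"
  proof (rule fps_ext)
    fix m
    have "fps_nth (\<Sum>j=1..n. fps_const (d j) * fps_X ^ j) m = (\<Sum>j=1..n. if j = m then d j else 0)"
      unfolding fps_sum_nth by (rule sum.cong) (auto simp: fps_X_power_nth)
    also have "\<dots> = fps_nth (afps d) m" using assms by (auto simp: afps_nth not_le)
    finally show "fps_nth (\<Sum>j=1..n. fps_const (d j) * fps_X ^ j) m = fps_nth (afps d) m" .
  qed
  then have 2: "(\<lambda>z. (\<Sum>j=1..n. d j * z ^ j) * R z) has_fps_expansion afps d * F"
    using has_fps_expansion_mult[OF S F] by simp
  have "z * deriv R z = (\<Sum>j=1..n. d j * z ^ j) * R z" for z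
  proof -
    have "(lpoly d n has_field_derivative (\<Sum>j=1..n. d j / of_nat j * (of_nat j * z ^ (j - 1)))) (at z)"
      unfolding lpoly_def[abs_def]
    proof (rule DERIV_sum)
      fix j
      show "((\<lambda>z. d j / of_nat j * z ^ j) has_field_derivative d j / of_nat j * (of_nat j * z ^ (j - 1))) (at z)"
        by (rule DERIV_cmult, rule DERIV_power[OF DERIV_ident, THEN DERIV_cong]) simp
    qed
    then have "(R has_field_derivative exp (lpoly d n z) * (\<Sum>j=1..n. d j / of_nat j * (of_nat j * z ^ (j - 1)))) (at z)"
      unfolding R_def[abs_def] by (rule DERIV_chain2[OF DERIV_exp])
    then have "z * deriv R z = z * (R z * (\<Sum>j=1..n. d j / of_nat j * (of_nat j * z ^ (j - 1))))"
      by (simp add: DERIV_imp_deriv R_def)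
    also have "\<dots> = (\<Sum>j=1..n. d j / of_nat j * (of_nat j * z ^ (j - 1)) * z) * R z"
      by (simp add: sum_distrib_left sum_distrib_right mult_ac)
    also have "(\<Sum>j=1..n. d j / of_nat j * (of_nat j * z ^ (j - 1)) * z) = (\<Sum>j=1..n. d j * z ^ j)"
      by (rule sum.cong) (auto simp: power_eq_if)
    finally show ?thesis .
  qed
  then have "(\<lambda>z. z * deriv R z) has_fps_expansion afps d * F" using 2 by simp
  then have "fps_XD F = afps d * F" using 1 fps_expansion_unique_complex by blast
  moreover have "fps_nth F 0 = 1"
    using fps_nth_fps_expansion[OF F, of 0] by (simp add: R_def lpoly_def power_0_left)
  ultimately have "F = efps d" by (rule efps_unique)
  then show ?thesis using F by (simp add: R_def[abs_def])
qed

text \<open>From |chi j + d j| <= chi j one gets Re(d j z^j) <= chi j (1 - Re z^j). Replacing z by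
  the root of unity costs min (j t) 2 in the j-th term, t being the distance, and a logarithm in
  all. Indices above m are estimated by |d j| / j. At the root 1 the first sum vanishes and m = n is
  best; at the others m is a cut-off to be chosen.\<close>

lemma Re_lpoly_le:
  assumes d: "\<And>j. j \<ge> 1 \<Longrightarrow> cmod (of_real (chi k j) + d j) \<le> chi k j"
    and z: "cmod z \<le> 1" "1 - z * cnj (rt k a) \<noteq> 0" and m: "m \<le> n"
  shows "Re (lpoly d n z) \<le> (\<Sum>j=1..m. chi k j * (1 - Re (rt k a ^ j)) / real j)
     + 4 * ln (1 + real n * cmod (1 - z * cnj (rt k a))) + (\<Sum>j\<in>{m<..n}. cmod (d j) / real j)"
proof -
  define t where "t = cmod (1 - z * cnj (rt k a))"
  have t: "t > 0" using z by (simp add: t_def)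
  have small: "Re (d j / of_nat j * z ^ j) \<le> chi k j * (1 - Re (rt k a ^ j)) / real j + min (real j * t) 2 / real j"
    if j: "j \<ge> 1" for j
  proof -
    have "Re (d j * z ^ j) = Re ((of_real (chi k j) + d j) * z ^ j) - chi k j * Re (z ^ j)"
      by (simp add: algebra_simps)
    also have "Re ((of_real (chi k j) + d j) * z ^ j) \<le> cmod ((of_real (chi k j) + d j) * z ^ j)"
      by (rule complex_Re_le_cmod)
    also have "\<dots> \<le> chi k j * 1"
      unfolding norm_mult using d[OF j] z(1) chi_bounds
      by (intro mult_mono) (auto simp: norm_power power_le_one)
    also have "chi k j * 1 - chi k j * Re (z ^ j) = chi k j * (1 - Re (rt k a ^ j)) + chi k j * Re (rt k a ^ j - z ^ j)"
      by (simp add: algebra_simps)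
    also have "chi k j * Re (rt k a ^ j - z ^ j) \<le> 1 * min (real j * t) 2"
    proof -
      have "Re (rt k a ^ j - z ^ j) \<le> cmod (rt k a ^ j - z ^ j)" by (rule complex_Re_le_cmod)
      also have "\<dots> \<le> min (real j * t) 2"
        using norm_power_rt_diff[OF z(1), of j k a] by (simp add: t_def norm_minus_commute)
      finally have "Re (rt k a ^ j - z ^ j) \<le> min (real j * t) 2" .
      then have "chi k j * Re (rt k a ^ j - z ^ j) \<le> chi k j * min (real j * t) 2"
        using chi_bounds by (intro mult_left_mono) auto
      also have "\<dots> \<le> 1 * min (real j * t) 2" using chi_bounds t by (intro mult_right_mono) auto
      finally show ?thesis .
    qed
    finally have "Re (d j * z ^ j) / real j \<le> (chi k j * (1 - Re (rt k a ^ j)) + min (real j * t) 2) / real j"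
      by (intro divide_right_mono) auto
    moreover have "Re (d j / of_nat j * z ^ j) = Re (d j * z ^ j) / real j"
      by (simp flip: Re_divide_of_nat)
    ultimately show ?thesis by (simp add: add_divide_distrib)
  qed
  have large: "Re (d j / of_nat j * z ^ j) \<le> cmod (d j) / real j" for j
  proof -
    have "Re (d j / of_nat j * z ^ j) \<le> cmod (d j / of_nat j * z ^ j)" by (rule complex_Re_le_cmod)
    also have "\<dots> \<le> cmod (d j) / real j * 1"
      unfolding norm_mult using z(1) by (intro mult_mono) (auto simp: norm_divide norm_power power_le_one)
    finally show ?thesis by simp
  qed
  have split: "{1..n} = {1..m} \<union> {m<..n}" using m by auto
  have "Re (lpoly d n z) = (\<Sum>j=1..n. Re (d j / of_nat j * z ^ j))" by (simp add: lpoly_def)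
  also have "\<dots> = (\<Sum>j=1..m. Re (d j / of_nat j * z ^ j)) + (\<Sum>j\<in>{m<..n}. Re (d j / of_nat j * z ^ j))"
    unfolding split by (rule sum.union_disjoint) auto
  also have "(\<Sum>j\<in>{m<..n}. Re (d j / of_nat j * z ^ j)) \<le> (\<Sum>j\<in>{m<..n}. cmod (d j) / real j)"
    by (rule sum_mono) (rule large)
  also have "(\<Sum>j=1..m. Re (d j / of_nat j * z ^ j)) \<le>
      (\<Sum>j=1..m. chi k j * (1 - Re (rt k a ^ j)) / real j + min (real j * t) 2 / real j)"
    by (rule sum_mono) (use small in auto)
  also have "\<dots> = (\<Sum>j=1..m. chi k j * (1 - Re (rt k a ^ j)) / real j) + (\<Sum>j=1..m. min (real j * t) 2 / real j)"
    by (rule sum.distrib)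
  also have "(\<Sum>j=1..m. min (real j * t) 2 / real j) \<le> (\<Sum>j=1..n. min (real j * t) 2 / real j)"
    using m t by (intro sum_mono2) auto
  also have "\<dots> \<le> 4 * ln (1 + real n * t)" by (rule sum_min_div_le[OF t])
  finally show ?thesis by (simp add: t_def)
qed

lemma norm_exp_lpoly_le:
  assumes d: "\<And>j. j \<ge> 1 \<Longrightarrow> cmod (of_real (chi k j) + d j) \<le> chi k j"
    and z: "cmod z \<le> 1" "z \<noteq> 1"
  shows "cmod (exp (lpoly d n z)) \<le> (1 + real n * cmod (1 - z)) ^ 4"
proof -
  have pos: "1 + real n * cmod (1 - z) > 0" by (simp add: add_pos_nonneg)
  have "Re (lpoly d n z) \<le> 4 * ln (1 + real n * cmod (1 - z))"
    using Re_lpoly_le[OF d z(1), where a = 0 and m = n and n = n] z(2) by simp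
  then have "exp (Re (lpoly d n z)) \<le> exp (4 * ln (1 + real n * cmod (1 - z)))" by simp
  also have "\<dots> = (1 + real n * cmod (1 - z)) ^ 4"
    using pos exp_of_nat_mult[of 4 "ln (1 + real n * cmod (1 - z))"] by simp
  finally show ?thesis by simp
qed

lemma norm_exp_lpoly_1_le:
  assumes d: "\<And>j. j \<ge> 1 \<Longrightarrow> cmod (of_real (chi k j) + d j) \<le> chi k j"
  shows "cmod (exp (lpoly d n 1)) \<le> 1"
proof -
  have "Re (d j) \<le> 0" if "j \<ge> 1" for j
    using d[OF that] complex_Re_le_cmod[of "of_real (chi k j) + d j"] by simp
  then have "Re (lpoly d n 1) \<le> 0"
    by (auto simp: lpoly_def intro!: sum_nonpos divide_nonpos_nonneg)
  then show ?thesis by simp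
qed

lemma norm_lpoly_diff_le:
  assumes z: "cmod z \<le> 1"
  shows "cmod (lpoly d n z - lpoly d n 1) \<le> cmod (1 - z) * (\<Sum>j=1..n. cmod (d j))"
proof -
  have "lpoly d n z - lpoly d n 1 = (\<Sum>j=1..n. d j / of_nat j * (z ^ j - 1))"
    by (simp add: lpoly_def sum_subtractf[symmetric] algebra_simps diff_divide_distrib)
  also have "cmod \<dots> \<le> (\<Sum>j=1..n. cmod (1 - z) * cmod (d j))"
  proof (rule order_trans[OF norm_sum sum_mono])
    fix j assume j: "j \<in> {1..n}"
    have "cmod (z ^ j - 1) \<le> real j * cmod (1 - z)"
      using norm_power_diff[of z 1 j] z by (simp add: norm_minus_commute)
    then have "cmod (d j / of_nat j * (z ^ j - 1)) \<le> cmod (d j) / real j * (real j * cmod (1 - z))"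
      unfolding norm_mult norm_divide by (intro mult_mono) auto
    then show "cmod (d j / of_nat j * (z ^ j - 1)) \<le> cmod (1 - z) * cmod (d j)"
      using j by (simp add: mult.commute)
  qed
  finally show ?thesis by (simp add: sum_distrib_left)
qed

text \<open>
  The factor \<open>(1 + n \<mu>\<^sup>p) powr (dens k - gam k a)\<close>: only the indices up to about \<open>n \<mu>\<^sup>p\<close> can make
  the function large near another root of unity, the remaining ones contribute a bounded amount
  by Hoelder's inequality.
\<close>

lemma norm_exp_lpoly_rt_le:
  assumes k: "k > 0" and p: "p > 1"
  shows "\<exists>C>0. \<forall>n a d z. 1 \<le> n \<longrightarrow> a < k \<longrightarrow> (\<forall>j\<ge>1. cmod (of_real (chi k j) + d j) \<le> chi k j) \<longrightarrow>
     cmod z < 1 \<longrightarrow> cmod (exp (lpoly d n z)) \<le>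
       C * (2 + real n * ((\<Sum>j=1..n. cmod (d j) powr p) / real n)) powr (dens k - gam k a)
         * (1 + real n * cmod (1 - z * cnj (rt k a))) ^ 4"
proof -
  define q where "q = p / (p - 1)"
  have q: "q > 1" "1/p + 1/q = 1" using p by (auto simp: q_def field_simps)
  have "\<exists>C\<ge>0. \<forall>m\<ge>1. \<bar>(\<Sum>j=1..m. chi k j * (1 - Re (rt k a ^ j)) / real j) -
     (\<Sum>j=1..k. chi k j * (1 - Re (rt k a ^ j))) / real k * ln (real m)\<bar> \<le> C" for a
    by (rule log_sum_periodic[OF k]) (simp add: chi_add power_add rt_power_k[OF k])
  moreover have eq: "(\<Sum>j=1..k. chi k j * (1 - Re (rt k a ^ j))) / real k = dens k - gam k a" for a
    using sum_chi[of k]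
    by (simp add: gam_def dens_def algebra_simps sum_subtractf diff_divide_distrib)
  ultimately have "\<forall>a. \<exists>C\<ge>0. \<forall>m\<ge>1. \<bar>(\<Sum>j=1..m. chi k j * (1 - Re (rt k a ^ j)) / real j) - (dens k - gam k a) * ln (real m)\<bar> \<le> C"
    unfolding eq by blast
  then obtain K where K: "\<And>a. K a \<ge> 0" "\<And>a m. m \<ge> 1 \<Longrightarrow> \<bar>(\<Sum>j=1..m. chi k j * (1 - Re (rt k a ^ j)) / real j) - (dens k - gam k a) * ln (real m)\<bar> \<le> K a"
    by metis
  define C1 where "C1 = (\<Sum>a<k. K a)"
  have C1: "K a \<le> C1" if "a < k" for a
    unfolding C1_def using that K(1) by (intro member_le_sum) auto
  define C2 where "C2 = (1 / (q - 1)) powr (1 / q)"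
  have "cmod (exp (lpoly d n z)) \<le> exp (C1 + C2) * (2 + real n * ((\<Sum>j=1..n. cmod (d j) powr p) / real n)) powr (dens k - gam k a)
         * (1 + real n * cmod (1 - z * cnj (rt k a))) ^ 4"
    if n: "1 \<le> n" and a: "a < k" and d: "\<And>j. j \<ge> 1 \<Longrightarrow> cmod (of_real (chi k j) + d j) \<le> chi k j"
      and z: "cmod z < 1" for n a d z
  proof -
    define D where "D = (\<Sum>j=1..n. cmod (d j) powr p)"
    have D0: "D \<ge> 0" by (simp add: D_def sum_nonneg)
    \<comment> \<open>The cut-off must be at least D, for the tail D powr (1/p) * J powr (- 1/p) to
      stay bounded, and at most D + 2, for the indices below it to give only (2 + D) powr s.\<close>
    define J where "J = nat \<lceil>D\<rceil> + 1"
    have J: "J \<ge> 1" "real J \<le> D + 2" "D \<le> real J"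
      using D0 by (auto simp: J_def) linarith+
    define m where "m = min n J"
    have m: "m \<ge> 1" "m \<le> n" "m \<le> J" using n J by (auto simp: m_def)
    define s where "s = dens k - gam k a"
    have s: "s \<ge> 0" using gam_less_dens[of a k] gam_0[of k] a by (cases "a = 0") (auto simp: s_def)
    have first: "(\<Sum>j=1..m. chi k j * (1 - Re (rt k a ^ j)) / real j) \<le> s * ln (D + 2) + C1"
    proof -
      have "(\<Sum>j=1..m. chi k j * (1 - Re (rt k a ^ j)) / real j) \<le> s * ln (real m) + K a"
        using K(2)[OF m(1), of a] by (simp add: s_def abs_le_iff)
      also have "s * ln (real m) \<le> s * ln (D + 2)"
        using m J s by (intro mult_left_mono) (auto intro!: ln_mono)
      finally show ?thesis using C1[OF a] by simp
    qed
    have tail: "(\<Sum>j\<in>{m<..n}. cmod (d j) / real j) \<le> C2"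
    proof (cases "n \<le> J")
      case True
      then show ?thesis by (simp add: m_def C2_def)
    next
      case False
      then have mJ: "m = J" by (simp add: m_def)
      have "(\<Sum>j\<in>{J<..n}. cmod (d j) * (1 / real j)) \<le>
         (\<Sum>j\<in>{J<..n}. cmod (d j) powr p) powr (1/p) * (\<Sum>j\<in>{J<..n}. (1 / real j) powr q) powr (1/q)"
        by (rule Holder_sum) (use p q in auto)
      also have "\<dots> \<le> D powr (1/p) * (real J powr (1 - q) / (q - 1)) powr (1/q)"
      proof (intro mult_mono powr_mono2)
        show "(\<Sum>j\<in>{J<..n}. cmod (d j) powr p) \<le> D"
          unfolding D_def by (rule sum_mono2) auto
        have "(\<Sum>j\<in>{J<..n}. (1 / real j) powr q) = (\<Sum>j\<in>{J<..n}. real j powr (- q))"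
          by (rule sum.cong) (auto simp: powr_divide powr_minus_divide)
        also have "\<dots> \<le> real J powr (1 - q) / (q - 1)" by (rule sum_powr_tail_le[OF q(1) J(1)])
        finally show "(\<Sum>j\<in>{J<..n}. (1 / real j) powr q) \<le> real J powr (1 - q) / (q - 1)" .
      qed (use p q in \<open>auto intro!: sum_nonneg\<close>)
      also have "(real J powr (1 - q) / (q - 1)) powr (1/q) = C2 * real J powr (- (1/p))"
      proof -
        have "(1 - q) * (1 / q) = - (1 / p)" using q by (simp add: field_simps)
        then show ?thesis using q by (simp add: C2_def powr_divide powr_powr)
      qed
      also have "D powr (1/p) * (C2 * real J powr (- (1/p))) \<le> real J powr (1/p) * (C2 * real J powr (- (1/p)))"
        using D0 J p by (intro mult_right_mono powr_mono2) (auto simp: C2_def)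
      also have "\<dots> = C2" using J by (simp add: powr_minus field_simps)
      finally show ?thesis by (simp add: mJ)
    qed
    define T where "T = 1 + real n * cmod (1 - z * cnj (rt k a))"
    have T: "T > 0" by (simp add: T_def add_pos_nonneg)
    have "Re (lpoly d n z) \<le> (s * ln (D + 2) + C1) + 4 * ln T + C2"
      using Re_lpoly_le[OF d, of z a m n] z one_minus_rt(1)[OF z, of k a] m first tail by (simp add: T_def)
    then have "exp (Re (lpoly d n z)) \<le> exp ((s * ln (D + 2) + C1) + 4 * ln T + C2)" by simp
    also have "\<dots> = exp (C1 + C2) * exp (s * ln (D + 2)) * exp (real 4 * ln T)"
      by (simp add: exp_add mult_ac)
    also have "exp (real 4 * ln T) = T ^ 4" using T by (subst exp_of_nat_mult) simp
    also have "exp (s * ln (D + 2)) = (2 + D) powr s" using D0 by (simp add: powr_def add.commute)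
    finally show ?thesis using n by (simp add: D_def s_def T_def)
  qed
  then show ?thesis by (intro exI[of _ "exp (C1 + C2)"]) auto
qed

section \<open>The coefficient comparison\<close>

lemma powr_sum_le:
  assumes "0 \<le> u" "0 \<le> v" "0 \<le> s" "s \<le> (2::real)"
  shows "(u + v) powr s \<le> 4 * (u powr s + v powr s)"
proof -
  have "(u + v) powr s \<le> (2 * max u v) powr s" using assms by (intro powr_mono2) auto
  also have "\<dots> = 2 powr s * max u v powr s" using assms by (simp add: powr_mult)
  also have "\<dots> \<le> 2 powr 2 * (u powr s + v powr s)"
    using assms by (intro mult_mono powr_mono) (auto simp: max_def)
  finally show ?thesis by simp
qed

lemma one_plus_power_4_le:
  assumes "w \<ge> (1::real)"
  shows "(1 + w) ^ 4 \<le> 16 * w ^ 4"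
proof -
  have "(1 + w) ^ 4 \<le> (2 * w) ^ 4" using assms by (intro power_mono) auto
  then show ?thesis by (simp add: power_mult_distrib)
qed

lemma power_8_diff_le:
  assumes "m \<le> n" "n \<ge> 1"
  shows "real n ^ 8 - real (n - m) ^ 8 \<le> 8 * (real m / real n) * real n ^ 8"
proof -
  have "1 + real 8 * (- (real m / real n)) \<le> (1 + - (real m / real n)) ^ 8"
    by (rule Bernoulli_inequality) (use assms in \<open>simp add: field_simps\<close>)
  then have "real n ^ 8 * (1 - 8 * (real m / real n)) \<le> real n ^ 8 * (1 - real m / real n) ^ 8"
    by (intro mult_left_mono) auto
  also have "\<dots> = (real n * (1 - real m / real n)) ^ 8" by (simp add: power_mult_distrib)
  also have "real n * (1 - real m / real n) = real (n - m)"
    using assms by (simp add: of_nat_diff field_simps)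
  finally show ?thesis by (simp add: algebra_simps)
qed

text \<open>With N = n - m and c the coefficient of B R at N, n^8 times the difference splits into
  the error of replacing n^8 by N^8, the smoothing error at N, and the smoothed coefficient at N
  minus R(1) times the smoothed coefficient of B at n. The shift by m is included because the
  factors for the remaining lengths are convolved with these coefficients; 2 m <= n keeps N
  comparable with n.\<close>

lemma coeff_comparison:
  assumes k: "k > 0" and p: "p > 1 / beta_exp k"
  shows "\<exists>C>0. \<forall>n m d. 2 \<le> n \<longrightarrow> 2 * m \<le> n \<longrightarrow>
     (\<forall>j\<ge>1. cmod (of_real (chi k j) + d j) \<le> chi k j) \<longrightarrow> (\<forall>j>n. d j = 0) \<longrightarrow>
     cmod (ecoef (\<lambda>j. of_real (chi k j) + d j) (n - m) - exp (lpoly d n 1) * of_real (ecoef (chi k) n)) \<le>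
       C * real n powr (dens k - 1) *
         (real m / real n + ((\<Sum>j=1..n. cmod (d j) powr p) / real n) powr (1/p) + real n powr (- beta_exp k))"
proof -
  define \<alpha> where "\<alpha> = dens k"
  define \<beta> where "\<beta> = beta_exp k"
  have \<beta>: "0 < \<beta>" "\<beta> \<le> \<alpha>" "\<alpha> \<le> 1"
    using beta_exp_pos[OF k] beta_exp_le_dens[OF k] dens_le_1 by (simp_all add: \<alpha>_def \<beta>_def)
  have p\<beta>: "p * \<beta> > 1" using p \<beta> by (simp add: \<beta>_def[symmetric] field_simps)
  then have p0: "p > 0" using \<beta> by (metis less_trans zero_less_mult_pos2 zero_less_one)
  have p1: "p > 1" 
  proof -
    have "p * \<beta> \<le> p * 1" using \<beta> p0 by (intro mult_left_mono) auto
    then show ?thesis using p\<beta> by simp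
  qed
  have pd: "1 / p < dens k" 
  proof -
    have "p * \<beta> \<le> p * \<alpha>" using \<beta> p0 by (intro mult_left_mono) auto
    then have "1 < p * dens k" using p\<beta> by (simp add: \<alpha>_def)
    then show ?thesis using p0 by (simp add: field_simps)
  qed
  define q where "q = p / (p - 1)"
  have q: "q > 1" "1/p + 1/q = 1" using p1 by (auto simp: q_def field_simps)
  obtain C1 where C1: "C1 > 0" "\<And>n X F x. n \<ge> 2 \<Longrightarrow> X holomorphic_on UNIV \<Longrightarrow> X has_fps_expansion F \<Longrightarrow> \<forall>a<k. 0 \<le> x a \<Longrightarrow>
     \<forall>a<k. \<forall>z. cmod z = 1 - 1 / real n \<longrightarrow> cmod (X z) \<le> x a * (real n * cmod (1 - z * cnj (rt k a))) ^ 5 \<Longrightarrow>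
     cmod (fps_nth ((fps_XD ^^ 8) (efps (\<lambda>j. of_real (chi k j))) * F) n) \<le>
     C1 * (\<Sum>a<k. x a * real n powr (gam k a + 7))"
    using XD_coeff_bound[OF k] by blast
  obtain K where K: "K > 0" "\<And>n a d z. 1 \<le> n \<Longrightarrow> a < k \<Longrightarrow> \<forall>j\<ge>1. cmod (of_real (chi k j) + d j) \<le> chi k j \<Longrightarrow>
     cmod z < 1 \<Longrightarrow> cmod (exp (lpoly d n z)) \<le>
       K * (2 + real n * ((\<Sum>j=1..n. cmod (d j) powr p) / real n)) powr (dens k - gam k a)
         * (1 + real n * cmod (1 - z * cnj (rt k a))) ^ 4"
    using norm_exp_lpoly_rt_le[OF k p1] by blast
  obtain C2 where C2: "C2 > 0" "\<And>n n' \<delta>. 1 \<le> n' \<Longrightarrow> n' \<le> n \<Longrightarrow> \<forall>j. 0 \<le> \<delta> j \<Longrightarrow>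
     (\<Sum>j=1..n'. \<delta> j * ecoef (chi k) (n' - j)) \<le>
     C2 * real n powr dens k * ((\<Sum>j=1..n. \<delta> j powr p) / real n) powr (1/p)"
    using weighted_sum_le[OF k p1 pd] by blast
  obtain C3 where C3: "C3 > 0" "\<And>n. n \<ge> 1 \<Longrightarrow> ecoef (chi k) n \<le> C3 * real n powr (dens k - 1)"
    using ecoef_chi_le[OF k] by blast
  \<comment> \<open>\<open>Ca\<close> gathers the factors 16 K, 4 and 4 from the bounds at the other
    roots of unity, plus 1 for R(1). In \<open>C\<close> the three summands belong to the smoothed
    difference, the smoothing error and the replacement of n^8 by N^8.\<close>
  define Ca where "Ca = 256 * K + 64 * K * 4 powr p + 1"
  define C where "C = C1 * (16 + real k * Ca) + 8 * C2 + 16 * C3"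
  have Ca: "Ca > 0" using K(1) by (simp add: Ca_def add_pos_nonneg add_nonneg_pos)
  have C: "C > 0" unfolding C_def using C1(1) C2(1) C3(1) Ca by (intro add_pos_nonneg mult_pos_pos add_nonneg_nonneg) auto
  have "cmod (ecoef (\<lambda>j. of_real (chi k j) + d j) (n - m) - exp (lpoly d n 1) * of_real (ecoef (chi k) n)) \<le>
       C * real n powr (\<alpha> - 1) *
         (real m / real n + ((\<Sum>j=1..n. cmod (d j) powr p) / real n) powr (1/p) + real n powr (- \<beta>))"
    if n: "2 \<le> n" and m: "2 * m \<le> n" and d: "\<forall>j\<ge>1. cmod (of_real (chi k j) + d j) \<le> chi k j"
      and dn: "\<forall>j>n. d j = 0" for n m d
  proof -
    have d': "\<And>j. j \<ge> 1 \<Longrightarrow> cmod (of_real (chi k j) + d j) \<le> chi k j" using d by blast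
    define D where "D = (\<Sum>j=1..n. cmod (d j) powr p)"
    define \<mu> where "\<mu> = (D / real n) powr (1/p)"
    define \<epsilon> where "\<epsilon> = real m / real n + \<mu> + real n powr (- \<beta>)"
    define E where "E = exp (lpoly d n 1)"
    define N where "N = n - m"
    have N: "1 \<le> N" "N \<le> n" "n \<le> 2 * N" using n m by (auto simp: N_def)
    have D0: "D \<ge> 0" by (simp add: D_def sum_nonneg)
    have \<mu>0: "\<mu> \<ge> 0" by (simp add: \<mu>_def)
    have mup: "\<mu> powr p = D / real n" using p0 D0 by (simp add: \<mu>_def powr_powr)
    have E1: "cmod E \<le> 1" unfolding E_def by (rule norm_exp_lpoly_1_le[OF d'])
    have d2: "cmod (d j) \<le> 2" if "j \<ge> 1" for j
    proof -
      have "cmod (d j) \<le> cmod (of_real (chi k j) + d j) + cmod (complex_of_real (chi k j))"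
        using norm_triangle_ineq4[of "of_real (chi k j) + d j" "of_real (chi k j)"] by simp
      then show ?thesis using d'[OF that] chi_bounds[of k j] by simp
    qed
    have \<mu>2: "\<mu> \<le> 2"
    proof -
      have "D \<le> (\<Sum>j=1..n. 2 powr p)"
        unfolding D_def using d2 p0 by (intro sum_mono powr_mono2) auto
      then have "D / real n \<le> 2 powr p" using n by (simp add: field_simps)
      then have "\<mu> \<le> (2 powr p) powr (1/p)" unfolding \<mu>_def using D0 p0 by (intro powr_mono2) auto
      then show ?thesis using p0 by (simp add: powr_powr)
    qed
    have dsum: "(\<Sum>j=1..n. cmod (d j)) \<le> real n * \<mu>"
    proof -
      have "(\<Sum>j=1..n. cmod (d j) * 1) \<le> D powr (1/p) * (\<Sum>j=1..n. 1 powr q) powr (1/q)"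
        unfolding D_def by (rule Holder_sum) (use p1 q in auto)
      also have "(\<Sum>j=1..n. 1 powr q) powr (1/q) = real n powr (1 - 1/p)"
      proof -
        have "1 / q = 1 - 1 / p" using q(2) by linarith
        then show ?thesis by simp
      qed
      also have "D powr (1/p) * real n powr (1 - 1/p) = real n * \<mu>"
        using n D0 by (simp add: \<mu>_def powr_divide powr_diff)
      finally show ?thesis by simp
    qed
    \<comment> \<open>The factor z^m makes one coefficient, of index n, carry both the smoothed
      coefficient at n - m and the main term at n.\<close>
    define X where "X z = z ^ m * exp (lpoly d n z) - E" for z
    define F where "F = fps_X ^ m * efps d - fps_const E"
    have X1: "X holomorphic_on UNIV"
      unfolding X_def
      by (intro holomorphic_on_diff holomorphic_on_mult holomorphic_on_power holomorphic_on_ident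
          holomorphic_on_const lpoly_holomorphic)
    have X2: "X has_fps_expansion F"
      unfolding X_def F_def
      by (intro has_fps_expansion_diff has_fps_expansion_mult has_fps_expansion_fps_X_power
          has_fps_expansion_const exp_lpoly_has_fps_expansion) (use dn in auto)
    \<comment> \<open>Near 1 the function X is small, as it is a difference; at the other roots only
      its growth is bounded, and the gain has to come from the smaller exponent of B.\<close>
    define x where "x a = (if a = 0 then 16 * (real m / real n + \<mu>)
       else 16 * K * (2 + D) powr (dens k - gam k a) + 1)" for a
    have x0: "\<forall>a<k. 0 \<le> x a" using \<mu>0 K(1) by (simp add: x_def)
    have Xb: "\<forall>a<k. \<forall>z. cmod z = 1 - 1 / real n \<longrightarrow> cmod (X z) \<le> x a * (real n * cmod (1 - z * cnj (rt k a))) ^ 5"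
    proof (intro allI impI)
      fix a z assume a: "a < k" and z: "cmod z = 1 - 1 / real n"
      have z1: "cmod z < 1" using z n by simp
      define t where "t = cmod (1 - z * cnj (rt k a))"
      have t: "real n * t \<ge> 1"
      proof -
        have "1 - cmod z \<le> t"
          unfolding t_def cmod_one_minus_rt using norm_triangle_ineq2[of "rt k a" z] by simp
        then have "real n * (1 / real n) \<le> real n * t" using z by (intro mult_left_mono) auto
        then show ?thesis using n by simp
      qed
      have t16: "(1 + real n * t) ^ 4 \<le> 16 * (real n * t) ^ 4"
        by (rule one_plus_power_4_le[OF t])
      have zm: "cmod (z ^ m) \<le> 1" using z1 by (simp add: norm_power power_le_one)
      have "cmod (X z) \<le> x a * (real n * t) ^ 5"
      proof (cases "a = 0")
        case True
        then have tt: "t = cmod (1 - z)" by (simp add: t_def)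
        have zn: "z \<noteq> 1" using z1 by auto
        have R: "cmod (exp (lpoly d n z)) \<le> (1 + real n * t) ^ 4"
          unfolding tt by (rule norm_exp_lpoly_le[OF d']) (use z1 zn in auto)
        have E4: "cmod E \<le> (1 + real n * t) ^ 4"
          using E1 t one_le_power[of "1 + real n * t" 4] by linarith
        \<comment> \<open>Both differences gain a factor t: |z^m - 1| <= m t, and |R(z) - R(1)| is
          at most n \<mu> t times the growth bound. Together with the fourth power this gives the
          fifth power of n t.\<close>
        have "X z = (z ^ m - 1) * exp (lpoly d n z) + (exp (lpoly d n z) - E)" by (simp add: X_def algebra_simps)
        then have "cmod (X z) \<le> cmod (z ^ m - 1) * cmod (exp (lpoly d n z)) + cmod (exp (lpoly d n z) - E)"
          by (metis norm_mult norm_triangle_ineq)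
        also have "\<dots> \<le> (real m * t) * (1 + real n * t) ^ 4 + (1 + real n * t) ^ 4 * (t * (real n * \<mu>))"
        proof (intro add_mono mult_mono R)
          show "cmod (z ^ m - 1) \<le> real m * t"
            using norm_power_diff[of z 1 m] z1 by (simp add: tt norm_minus_commute)
          have "cmod (exp (lpoly d n z) - E) \<le> (1 + real n * t) ^ 4 * cmod (lpoly d n z - lpoly d n 1)"
            unfolding E_def by (rule norm_exp_diff_le) (use R E4 in \<open>auto simp: E_def\<close>)
          also have "\<dots> \<le> (1 + real n * t) ^ 4 * (t * (real n * \<mu>))"
          proof (rule mult_left_mono)
            have "cmod (lpoly d n z - lpoly d n 1) \<le> t * (\<Sum>j=1..n. cmod (d j))"
              unfolding tt using z1 by (intro norm_lpoly_diff_le) auto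
            also have "\<dots> \<le> t * (real n * \<mu>)" using dsum by (intro mult_left_mono) (auto simp: tt)
            finally show "cmod (lpoly d n z - lpoly d n 1) \<le> t * (real n * \<mu>)" .
          qed (use t in auto)
          finally show "cmod (exp (lpoly d n z) - E) \<le> (1 + real n * t) ^ 4 * (t * (real n * \<mu>))" .
        qed (auto simp: tt)
        also have "\<dots> = (1 + real n * t) ^ 4 * ((real n * t) * (real m / real n + \<mu>))"
          using n by (simp add: field_simps)
        also have "\<dots> \<le> (16 * (real n * t) ^ 4) * ((real n * t) * (real m / real n + \<mu>))"
          using t16 t \<mu>0 by (intro mult_right_mono) auto
        also have "\<dots> = x a * (real n * t) ^ 5" using True by (simp add: x_def power_eq_if)
        finally show ?thesis .
      next
        case False
        have "cmod (X z) \<le> cmod (z ^ m) * cmod (exp (lpoly d n z)) + cmod E"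
          unfolding X_def using norm_triangle_ineq4 norm_mult by metis
        also have "\<dots> \<le> 1 * (K * (2 + D) powr (dens k - gam k a) * (1 + real n * t) ^ 4) + 1"
        proof (intro add_mono mult_mono zm E1)
          show "cmod (exp (lpoly d n z)) \<le> K * (2 + D) powr (dens k - gam k a) * (1 + real n * t) ^ 4"
            using K(2)[of n a d z] n a d z1 by (simp add: D_def t_def)
        qed auto
        also have "\<dots> \<le> 1 * (K * (2 + D) powr (dens k - gam k a) * (16 * (real n * t) ^ 4)) + 1"
          using t16 K(1) by (intro add_mono mult_left_mono) auto
        also have "\<dots> \<le> 1 * (K * (2 + D) powr (dens k - gam k a) * (16 * (real n * t) ^ 5)) + (real n * t) ^ 5"
          using t K(1) by (intro add_mono mult_left_mono power_increasing) (auto simp: one_le_power)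
        also have "\<dots> = x a * (real n * t) ^ 5" using False by (simp add: x_def algebra_simps)
        finally show ?thesis .
      qed
      then show "cmod (X z) \<le> x a * (real n * cmod (1 - z * cnj (rt k a))) ^ 5" by (simp add: t_def)
    qed
    define Y where "Y = (fps_XD ^^ 8) (efps (\<lambda>j. complex_of_real (chi k j))) * efps d"
    have Yc: "fps_nth ((fps_XD ^^ 8) (efps (\<lambda>j. of_real (chi k j))) * F) n = fps_nth Y N - E * (of_nat n ^ 8 * of_real (ecoef (chi k) n))"
    proof -
      have "(fps_XD ^^ 8) (efps (\<lambda>j. of_real (chi k j))) * F =
         fps_X ^ m * Y - fps_const E * (fps_XD ^^ 8) (efps (\<lambda>j. complex_of_real (chi k j)))"
        by (simp add: F_def Y_def algebra_simps)
      then show ?thesis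
        using m by (simp add: fps_X_power_mult_nth N_def fps_mult_fps_XD_shift ecoef_of_real)
    qed
    have split0: "real n powr (gam k a + 7) = real n powr (\<alpha> + 7) * real n powr (- (dens k - gam k a))" for a
      unfolding powr_add[symmetric] by (simp add: \<alpha>_def add.commute)
    have xbound: "x a * real n powr (gam k a + 7) \<le> real n powr (\<alpha> + 7) * (if a = 0 then 16 * \<epsilon> else Ca * \<epsilon>)" if a: "a < k" for a
    proof (cases "a = 0")
      case True
      then have "x a * real n powr (gam k a + 7) = real n powr (\<alpha> + 7) * (16 * (real m / real n + \<mu>))"
        by (simp add: x_def gam_0 \<alpha>_def)
      also have "\<dots> \<le> real n powr (\<alpha> + 7) * (16 * \<epsilon>)" by (intro mult_left_mono) (auto simp: \<epsilon>_def)
      finally show ?thesis using True by simp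
    next
      case False
      define s where "s = dens k - gam k a"
      have s: "\<beta> \<le> s" "s \<le> 2"
        using beta_exp_le_gap[of a k] a False abs_gam_le[OF k, of a] dens_le_1[of k] by (auto simp: s_def \<beta>_def)
      have ns: "real n powr (- s) \<le> real n powr (- \<beta>)" using s n by (intro powr_mono) auto
      \<comment> \<open>Here the size of p matters: p s >= p \<beta> > 1, so \<mu> powr (p s) <=
        \<mu> as long as \<mu> <= 1. For 1 < \<mu> <= 2 the bound s <= 2 leaves the constant 2 powr
        (2 p) = 4 powr p.\<close>
      have \<mu>s: "\<mu> powr (p * s) \<le> 4 powr p * \<mu>"
      proof (cases "\<mu> \<le> 1")
        case True
        have "p * \<beta> \<le> p * s" using s p0 by (intro mult_left_mono) auto
        then have ps: "1 \<le> p * s" using p\<beta> by linarith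
        have "\<mu> powr (p * s) \<le> \<mu> powr 1"
          by (rule powr_mono'[OF ps \<mu>0 True])
        then have "\<mu> powr (p * s) \<le> 1 * \<mu>" using \<mu>0 by simp
        also have "\<dots> \<le> 4 powr p * \<mu>" using \<mu>0 p0 by (intro mult_right_mono ge_one_powr_ge_zero) auto
        finally show ?thesis .
      next
        case False
        have "\<mu> powr (p * s) \<le> 2 powr (p * s)" using \<mu>2 \<mu>0 p0 s \<beta> by (intro powr_mono2) auto
        also have "\<dots> \<le> 2 powr (p * 2)" using s p0 by (intro powr_mono) auto
        also have "\<dots> = 4 powr p" using powr_powr[of 2 2 p] by (simp add: mult.commute)
        also have "\<dots> = 4 powr p * 1" by simp
        also have "\<dots> \<le> 4 powr p * \<mu>" using False by (intro mult_left_mono) auto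
        finally show ?thesis .
      qed
      \<comment> \<open>D equals n \<mu> powr p, so the loss (2 + D) powr s at this root and the
        gain n powr (- s) from the smaller exponent nearly cancel.\<close>
      have "(2 + D) powr s * real n powr (- s) = (2 / real n + \<mu> powr p) powr s"
        using n D0 by (simp add: mup powr_minus_divide powr_divide flip: add_divide_distrib)
      also have "\<dots> \<le> 4 * ((2 / real n) powr s + (\<mu> powr p) powr s)"
        using s \<beta> by (intro powr_sum_le) auto
      also have "(2 / real n) powr s \<le> 4 * real n powr (- \<beta>)"
      proof -
        have "(2 / real n) powr s = 2 powr s * real n powr (- s)"
          using n by (simp add: powr_divide powr_minus_divide)
        also have "\<dots> \<le> 2 powr 2 * real n powr (- \<beta>)"
          using s ns n by (intro mult_mono powr_mono) auto
        finally show ?thesis by simp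
      qed
      also have "(\<mu> powr p) powr s \<le> 4 powr p * \<mu>" using \<mu>s by (simp add: powr_powr)
      finally have main: "(2 + D) powr s * real n powr (- s) \<le> 4 * (4 * real n powr (- \<beta>) + 4 powr p * \<mu>)" by simp
      have "x a * real n powr (gam k a + 7) = real n powr (\<alpha> + 7) * (16 * K * ((2 + D) powr s * real n powr (- s)) + real n powr (- s))"
        unfolding split0 using False by (simp add: x_def s_def algebra_simps)
      also have "\<dots> \<le> real n powr (\<alpha> + 7) * (16 * K * (4 * (4 * real n powr (- \<beta>) + 4 powr p * \<mu>)) + real n powr (- \<beta>))"
        using main ns K(1) by (intro mult_left_mono add_mono) auto
      finally have 1: "x a * real n powr (gam k a + 7) \<le> real n powr (\<alpha> + 7) *
        (16 * K * (4 * (4 * real n powr (- \<beta>) + 4 powr p * \<mu>)) + real n powr (- \<beta>))" .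
      have "16 * K * (4 * (4 * real n powr (- \<beta>) + 4 powr p * \<mu>)) + real n powr (- \<beta>) =
          (256 * K + 1) * real n powr (- \<beta>) + (64 * K * 4 powr p) * \<mu>" by (simp add: algebra_simps)
      also have "\<dots> \<le> Ca * real n powr (- \<beta>) + Ca * \<mu>"
        using K(1) \<mu>0 by (intro add_mono mult_right_mono) (auto simp: Ca_def)
      also have "\<dots> = Ca * (\<mu> + real n powr (- \<beta>))" by (simp add: algebra_simps)
      also have "\<dots> \<le> Ca * \<epsilon>" using Ca by (intro mult_left_mono) (auto simp: \<epsilon>_def)
      finally have "real n powr (\<alpha> + 7) * (16 * K * (4 * (4 * real n powr (- \<beta>) + 4 powr p * \<mu>)) + real n powr (- \<beta>))
          \<le> real n powr (\<alpha> + 7) * (Ca * \<epsilon>)" by (intro mult_left_mono) auto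
      then show ?thesis using 1 False by simp
    qed
    have \<epsilon>0: "\<epsilon> \<ge> 0" "\<mu> \<le> \<epsilon>" "real m / real n \<le> \<epsilon>" using \<mu>0 by (auto simp: \<epsilon>_def)
    have S: "cmod (fps_nth Y N - E * (of_nat n ^ 8 * of_real (ecoef (chi k) n))) \<le> C1 * (16 + real k * Ca) * (real n powr (\<alpha> + 7) * \<epsilon>)"
    proof -
      have "cmod (fps_nth Y N - E * (of_nat n ^ 8 * of_real (ecoef (chi k) n))) \<le> C1 * (\<Sum>a<k. x a * real n powr (gam k a + 7))"
        using C1(2)[OF n X1 X2 x0 Xb] unfolding Yc .
      also have "(\<Sum>a<k. x a * real n powr (gam k a + 7)) \<le> (\<Sum>a<k. real n powr (\<alpha> + 7) * ((if a = 0 then 16 * \<epsilon> else 0) + Ca * \<epsilon>))"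
      proof (rule sum_mono)
        fix a assume "a \<in> {..<k}"
        then have "x a * real n powr (gam k a + 7) \<le> real n powr (\<alpha> + 7) * (if a = 0 then 16 * \<epsilon> else Ca * \<epsilon>)" by (intro xbound) simp
        also have "\<dots> \<le> real n powr (\<alpha> + 7) * ((if a = 0 then 16 * \<epsilon> else 0) + Ca * \<epsilon>)"
          using Ca \<epsilon>0 by (intro mult_left_mono) auto
        finally show "x a * real n powr (gam k a + 7) \<le> \<dots>" .
      qed
      also have "\<dots> = real n powr (\<alpha> + 7) * (16 * \<epsilon> + real k * (Ca * \<epsilon>))"
        using k by (simp add: sum_distrib_left[symmetric] sum.distrib)
      finally show ?thesis using C1(1) by (simp add: algebra_simps)
    qed
    define c where "c = ecoef (\<lambda>j. of_real (chi k j) + d j) N"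
    have cb: "cmod c \<le> ecoef (chi k) N" unfolding c_def by (rule norm_ecoef_le[OF d'])
    have ceq: "fps_nth ((fps_XD ^^ 0) (efps (\<lambda>j. of_real (chi k j))) * efps d) N = c"
      by (simp add: c_def efps_add[symmetric])
    have T: "cmod (of_nat N ^ 8 * c - fps_nth Y N) \<le> 8 * C2 * (real n powr (\<alpha> + 7) * \<epsilon>)"
    proof -
      have "cmod (of_nat N ^ 8 * c - fps_nth Y N) \<le> real 8 * real N ^ 8 / real N * (\<Sum>j=1..N. cmod (d j) * ecoef (chi k) (N - j))"
        using smoothing_error[of k d N 8] d' N(1) unfolding Y_def ceq by blast
      also have "\<dots> \<le> 8 * real n ^ 7 * (C2 * real n powr \<alpha> * \<mu>)"
      proof (rule mult_mono)
        have "real N ^ 8 / real N = real N ^ 7" using N(1) by (simp add: power_eq_if)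
        moreover have "real N ^ 7 \<le> real n ^ 7" using N(2) by (intro power_mono) auto
        ultimately have "8 * (real N ^ 8 / real N) \<le> 8 * real n ^ 7" by linarith
        then show "real 8 * real N ^ 8 / real N \<le> 8 * real n ^ 7" by simp
        show "(\<Sum>j=1..N. cmod (d j) * ecoef (chi k) (N - j)) \<le> C2 * real n powr \<alpha> * \<mu>"
          using C2(2)[OF N(1,2), of "\<lambda>j. cmod (d j)"] by (simp add: \<alpha>_def \<mu>_def D_def)
      qed (use ecoef_chi_nonneg in \<open>auto intro!: sum_nonneg\<close>)
      also have "\<dots> = 8 * C2 * (real n powr (\<alpha> + 7) * \<mu>)" using n by (simp add: powr_add)
      also have "\<dots> \<le> 8 * C2 * (real n powr (\<alpha> + 7) * \<epsilon>)"
        using C2(1) \<epsilon>0 by (intro mult_left_mono) auto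
      finally show ?thesis .
    qed
    have U: "cmod (of_nat n ^ 8 * c - of_nat N ^ 8 * c) \<le> 16 * C3 * (real n powr (\<alpha> + 7) * \<epsilon>)"
    proof -
      have "of_nat n ^ 8 * c - of_nat N ^ 8 * c = of_real (real n ^ 8 - real N ^ 8) * c" by (simp add: algebra_simps)
      then have "cmod (of_nat n ^ 8 * c - of_nat N ^ 8 * c) = \<bar>real n ^ 8 - real N ^ 8\<bar> * cmod c"
        by (simp only: norm_mult norm_of_real)
      also have "\<bar>real n ^ 8 - real N ^ 8\<bar> = real n ^ 8 - real N ^ 8"
        using N(2) by (simp add: power_mono)
      also have "(real n ^ 8 - real N ^ 8) * cmod c \<le> (8 * (real m / real n) * real n ^ 8) * (2 * C3 * real n powr (\<alpha> - 1))"
      proof (rule mult_mono)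
        show "real n ^ 8 - real N ^ 8 \<le> 8 * (real m / real n) * real n ^ 8"
          unfolding N_def by (rule power_8_diff_le) (use n m in auto)
        have "cmod c \<le> C3 * real N powr (\<alpha> - 1)" using cb C3(2)[OF N(1)] by (simp add: \<alpha>_def)
        also have "real N powr (\<alpha> - 1) \<le> (real n / 2) powr (\<alpha> - 1)"
          using N n \<beta> by (intro powr_mono2') auto
        also have "(real n / 2) powr (\<alpha> - 1) = 2 powr (1 - \<alpha>) * real n powr (\<alpha> - 1)"
          using n by (simp add: powr_divide powr_diff field_simps)
        also have "\<dots> \<le> 2 powr 1 * real n powr (\<alpha> - 1)"
          using \<beta> by (intro mult_right_mono powr_mono) auto
        finally show "cmod c \<le> 2 * C3 * real n powr (\<alpha> - 1)" using C3(1) by (simp add: mult_left_mono)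
      qed auto
      also have "\<dots> = 16 * C3 * (real n powr (\<alpha> + 7) * (real m / real n))"
      proof -
        have "real n ^ 8 * real n powr (\<alpha> - 1) = real n powr (\<alpha> + 7)"
        proof -
          have "real n powr 8 * real n powr (\<alpha> - 1) = real n powr (\<alpha> + 7)"
            unfolding powr_add[symmetric] by (simp add: algebra_simps)
          then show ?thesis using n by simp
        qed
        then show ?thesis by (simp add: mult_ac)
      qed
      also have "\<dots> \<le> 16 * C3 * (real n powr (\<alpha> + 7) * \<epsilon>)"
        using C3(1) \<epsilon>0 by (intro mult_left_mono) auto
      finally show ?thesis .
    qed
    have "of_nat n ^ 8 * (c - E * of_real (ecoef (chi k) n)) =
       (of_nat n ^ 8 * c - of_nat N ^ 8 * c) + (of_nat N ^ 8 * c - fps_nth Y N)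
        + (fps_nth Y N - E * (of_nat n ^ 8 * of_real (ecoef (chi k) n)))"
      by (simp add: algebra_simps)
    then have "cmod (of_nat n ^ 8 * (c - E * of_real (ecoef (chi k) n))) \<le>
        16 * C3 * (real n powr (\<alpha> + 7) * \<epsilon>) + 8 * C2 * (real n powr (\<alpha> + 7) * \<epsilon>) + C1 * (16 + real k * Ca) * (real n powr (\<alpha> + 7) * \<epsilon>)"
      using S T U norm_triangle_ineq by (smt (verit))
    also have "\<dots> = C * (real n powr (\<alpha> + 7) * \<epsilon>)" by (simp add: C_def algebra_simps)
    finally have "real n ^ 8 * cmod (c - E * of_real (ecoef (chi k) n)) \<le> C * (real n powr (\<alpha> + 7) * \<epsilon>)"
      by (simp add: norm_mult norm_power)
    also have "real n powr (\<alpha> + 7) = real n ^ 8 * real n powr (\<alpha> - 1)"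
    proof -
      have "real n powr 8 * real n powr (\<alpha> - 1) = real n powr (\<alpha> + 7)"
        unfolding powr_add[symmetric] by (simp add: algebra_simps)
      then show ?thesis using n by simp
    qed
    also have "C * (real n ^ 8 * real n powr (\<alpha> - 1) * \<epsilon>) = real n ^ 8 * (C * real n powr (\<alpha> - 1) * \<epsilon>)" by (simp add: mult_ac)
    finally have "cmod (c - E * of_real (ecoef (chi k) n)) \<le> C * real n powr (\<alpha> - 1) * \<epsilon>"
      by (rule mult_left_le_imp_le) (use n in auto)
    then show ?thesis by (simp add: c_def E_def \<epsilon>_def \<mu>_def D_def N_def)
  qed
  then show ?thesis using C unfolding \<alpha>_def \<beta>_def by blast
qed

subsection \<open>Assembling the mean value\<close>

lemma ex_powr_neg_le:
  assumes "b > 0" "\<epsilon> > (0::real)"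
  shows "\<exists>n0::nat. \<forall>n\<ge>n0. real n powr (- b) \<le> \<epsilon>"
proof -
  have "real n powr (- b) \<le> \<epsilon>" if "n \<ge> nat \<lceil>\<epsilon> powr (- 1 / b)\<rceil>" for n
  proof -
    have "\<epsilon> powr (- 1 / b) \<le> real n" using that by linarith
    then have "real n powr (- b) \<le> (\<epsilon> powr (- 1 / b)) powr (- b)"
      using assms by (intro powr_mono2') auto
    then show ?thesis using assms by (simp add: powr_powr)
  qed
  then show ?thesis by blast
qed

lemma chi_1_add_mult: "chi k (1 + k * c) = 1"
proof -
  have "coprime (1 + k * c) k"
  proof (rule coprimeI)
    fix d assume "d dvd 1 + k * c" "d dvd k"
    then show "is_unit d" using dvd_add_left_iff[of d "k * c" 1] by simp
  qed
  then show ?thesis by (simp add: chi_def)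
qed

text \<open>Among k consecutive integers one is 1 modulo k, hence coprime to k. So when the
  recursions for the k indices n - m are added, every coefficient up to n - k is counted at least
  once.\<close>

lemma ecoef_chi_window:
  assumes k: "k > 0" and n: "k \<le> n"
  shows "(\<Sum>l\<le>n - k. ecoef (chi k) l) \<le> (\<Sum>m<k. real (n - m) * ecoef (chi k) (n - m))"
proof -
  have win: "1 \<le> (\<Sum>m<k. chi k (N - m))" if "N \<ge> k" for N
  proof -
    define m where "m = (N - 1) mod k"
    have N: "N \<ge> 1" using that k by simp
    have "N - 1 = m + k * ((N - 1) div k)" unfolding m_def by simp
    then have "N - m = 1 + k * ((N - 1) div k)" using N by linarith
    then have "1 = chi k (N - m)" using chi_1_add_mult by simp
    also have "\<dots> \<le> (\<Sum>m<k. chi k (N - m))"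
      using k chi_bounds by (intro member_le_sum) (auto simp: m_def)
    finally show ?thesis .
  qed
  have "(\<Sum>l\<le>n - k. ecoef (chi k) l) \<le> (\<Sum>l\<le>n - k. (\<Sum>m<k. chi k (n - l - m)) * ecoef (chi k) l)"
  proof (rule sum_mono)
    fix l assume "l \<in> {..n - k}"
    then have "1 \<le> (\<Sum>m<k. chi k (n - l - m))" using n by (intro win) auto
    then show "ecoef (chi k) l \<le> (\<Sum>m<k. chi k (n - l - m)) * ecoef (chi k) l"
      using mult_right_mono[OF _ ecoef_chi_nonneg[of k l]] by fastforce
  qed
  also have "\<dots> = (\<Sum>m<k. \<Sum>l\<le>n - k. chi k (n - m - l) * ecoef (chi k) l)"
    unfolding sum_distrib_right by (subst sum.swap) (simp add: diff_commute add.commute)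
  also have "\<dots> \<le> (\<Sum>m<k. real (n - m) * ecoef (chi k) (n - m))"
  proof (rule sum_mono)
    fix m assume m: "m \<in> {..<k}"
    have "real (n - m) * ecoef (chi k) (n - m) = (\<Sum>j=1..n - m. chi k j * ecoef (chi k) (n - m - j))"
      by (rule ecoef_rec)
    also have "\<dots> = (\<Sum>l<n - m. chi k (n - m - l) * ecoef (chi k) l)"
      by (rule sum.reindex_bij_witness[of _ "\<lambda>l. n - m - l" "\<lambda>j. n - m - j"]) auto
    also have "\<dots> \<ge> (\<Sum>l\<le>n - k. chi k (n - m - l) * ecoef (chi k) l)"
      using m n ecoef_chi_nonneg chi_bounds by (intro sum_mono2) auto
    finally show "(\<Sum>l\<le>n - k. chi k (n - m - l) * ecoef (chi k) l) \<le> real (n - m) * ecoef (chi k) (n - m)" .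
  qed
  finally show ?thesis .
qed

text \<open>The lower bound for partial sums shows that some coefficient among the last k is large;
  the comparison for d = 0 shows that these k coefficients are nearly equal, so the last one is
  large as well.\<close>

lemma ecoef_chi_ge:
  assumes k: "k > 0"
  shows "\<exists>c>0. \<exists>n0. \<forall>n\<ge>n0. c * real n powr (dens k - 1) \<le> ecoef (chi k) n"
proof -
  define \<alpha> where "\<alpha> = dens k"
  define \<beta> where "\<beta> = beta_exp k"
  have \<beta>: "0 < \<beta>" "\<beta> \<le> \<alpha>" "\<alpha> \<le> 1"
    using beta_exp_pos[OF k] beta_exp_le_dens[OF k] dens_le_1 by (simp_all add: \<alpha>_def \<beta>_def)
  \<comment> \<open>Any admissible exponent serves, since the mean of |d j|^p vanishes for d =
    0.\<close>
  have p: "2 / \<beta> > 1 / beta_exp k" using \<beta> by (simp add: \<beta>_def divide_strict_right_mono)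
  obtain K where K: "K > 0" "\<And>n m d. 2 \<le> n \<Longrightarrow> 2 * m \<le> n \<Longrightarrow>
     \<forall>j\<ge>1. cmod (of_real (chi k j) + d j) \<le> chi k j \<Longrightarrow> \<forall>j>n. d j = 0 \<Longrightarrow>
     cmod (ecoef (\<lambda>j. of_real (chi k j) + d j) (n - m) - exp (lpoly d n 1) * of_real (ecoef (chi k) n)) \<le>
       K * real n powr (dens k - 1) *
         (real m / real n + ((\<Sum>j=1..n. cmod (d j) powr (2 / \<beta>)) / real n) powr (1/(2 / \<beta>)) + real n powr (- beta_exp k))"
    using coeff_comparison[OF k p] by blast
  have diff: "ecoef (chi k) (n - m) \<le> ecoef (chi k) n + K * real n powr (\<alpha> - 1) * (real m / real n + real n powr (- \<beta>))"
    if "2 \<le> n" "2 * m \<le> n" for n m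
  proof -
    have "cmod (of_real (ecoef (chi k) (n - m)) - of_real (ecoef (chi k) n)) \<le> K * real n powr (\<alpha> - 1) * (real m / real n + real n powr (- \<beta>))"
      using K(2)[OF that, of "\<lambda>_. 0"] chi_bounds
      by (simp add: lpoly_def ecoef_of_real \<alpha>_def \<beta>_def)
    then have "\<bar>ecoef (chi k) (n - m) - ecoef (chi k) n\<bar> \<le> K * real n powr (\<alpha> - 1) * (real m / real n + real n powr (- \<beta>))"
      by (simp flip: of_real_diff)
    then show ?thesis by linarith
  qed
  obtain c where c: "c > 0" "\<And>n. n \<ge> 1 \<Longrightarrow> c * real n powr \<alpha> \<le> (\<Sum>m\<le>n. ecoef (chi k) m)"
    using sum_ecoef_chi_ge[OF k] unfolding \<alpha>_def by blast
  \<comment> \<open>Chosen so that the k errors of comparison together take c / 4 of the available c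
    / 2.\<close>
  define \<epsilon> where "\<epsilon> = c / (4 * real k * K * (real k + 1))"
  have \<epsilon>: "\<epsilon> > 0" using c(1) K(1) k by (simp add: \<epsilon>_def)
  obtain n0 where n0: "\<And>n. n \<ge> n0 \<Longrightarrow> real n powr (- \<beta>) \<le> \<epsilon>"
    using ex_powr_neg_le[OF \<beta>(1) \<epsilon>] by blast
  have "c / (4 * real k) * real n powr (\<alpha> - 1) \<le> ecoef (chi k) n" if n: "n \<ge> max n0 (2 * k + 2)" for n
  proof -
    have n': "n \<ge> 2" "2 * k \<le> n" "n \<ge> n0" "k \<le> n" using n by auto
    have np: "real n > 0" using n' by simp
    have "c * (real n powr \<alpha> / 2) \<le> c * real (n - k) powr \<alpha>"
    proof (rule mult_left_mono)
      have "real n powr \<alpha> / 2 \<le> real n powr \<alpha> / 2 powr \<alpha>"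
        using \<beta> powr_mono[of \<alpha> 1 2] by (intro divide_left_mono) auto
      also have "\<dots> = (real n / 2) powr \<alpha>" using np by (simp add: powr_divide)
      also have "\<dots> \<le> real (n - k) powr \<alpha>" using n' \<beta> by (intro powr_mono2) auto
      finally show "real n powr \<alpha> / 2 \<le> real (n - k) powr \<alpha>" .
    qed (use c in auto)
    also have "\<dots> \<le> (\<Sum>l\<le>n - k. ecoef (chi k) l)" using c(2)[of "n - k"] n' k by simp
    also have "\<dots> \<le> (\<Sum>m<k. real (n - m) * ecoef (chi k) (n - m))" by (rule ecoef_chi_window[OF k n'(4)])
    also have "\<dots> \<le> (\<Sum>m<k. real n * (ecoef (chi k) n + K * real n powr (\<alpha> - 1) * ((real k + 1) * \<epsilon>)))"
    proof (intro sum_mono mult_mono)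
      fix m assume m: "m \<in> {..<k}"
      have "1 / real n = real n powr (- 1)" using np by (simp add: powr_minus_divide)
      also have "\<dots> \<le> real n powr (- \<beta>)" using \<beta> n' by (intro powr_mono) auto
      finally have "1 / real n \<le> \<epsilon>" using n0[OF n'(3)] by simp
      then have "real k * (1 / real n) \<le> real k * \<epsilon>" by (intro mult_left_mono) auto
      moreover have "real m * (1 / real n) \<le> real k * (1 / real n)" using m by (intro mult_right_mono) auto
      ultimately have "real m / real n + real n powr (- \<beta>) \<le> (real k + 1) * \<epsilon>"
        using n0[OF n'(3)] by (simp add: algebra_simps)
      then have "K * real n powr (\<alpha> - 1) * (real m / real n + real n powr (- \<beta>)) \<le> K * real n powr (\<alpha> - 1) * ((real k + 1) * \<epsilon>)"
        using K(1) by (intro mult_left_mono) auto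
      then show "ecoef (chi k) (n - m) \<le> ecoef (chi k) n + K * real n powr (\<alpha> - 1) * ((real k + 1) * \<epsilon>)"
        using diff[of n m] n' m by simp
    qed (use ecoef_chi_nonneg in auto)
    also have "\<dots> = real k * real n * ecoef (chi k) n + c / 4 * (real n * real n powr (\<alpha> - 1))"
    proof -
      have "real k * K * (real k + 1) * \<epsilon> = c / 4"
        unfolding \<epsilon>_def using K(1) k by (simp add: divide_simps add_eq_0_iff)
      then have "c / 4 * (real n * real n powr (\<alpha> - 1)) = real k * K * (real k + 1) * \<epsilon> * (real n * real n powr (\<alpha> - 1))"
        by simp
      then show ?thesis by (simp add: algebra_simps)
    qed
    also have "real n * real n powr (\<alpha> - 1) = real n powr \<alpha>" using np by (simp add: powr_diff)
    finally have "c / 4 * real n powr \<alpha> \<le> real k * real n * ecoef (chi k) n" by simp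
    also have "real n powr \<alpha> = real n * real n powr (\<alpha> - 1)" using np by (simp add: powr_diff)
    finally have "real n * (c / 4 * real n powr (\<alpha> - 1)) \<le> real n * (real k * ecoef (chi k) n)" by (simp add: mult_ac)
    then have "c / 4 * real n powr (\<alpha> - 1) \<le> real k * ecoef (chi k) n" using np by simp
    then show ?thesis using k by (simp add: field_simps)
  qed
  then show ?thesis using c(1) k unfolding \<alpha>_def by (intro exI[of _ "c / (4 * real k)"] conjI exI[of _ "max n0 (2 * k + 2)"]) auto
qed

section \<open>Convolution with a quadratically decaying sequence\<close>

lemma inverse_squares_summable: "summable (\<lambda>m. C / real m ^ 2)"
  using summable_mult[OF inverse_power_summable[of 2, where 'a = real], of C] by (simp add: divide_inverse)

lemma sum_inverse_squares_tail:
  assumes "M \<ge> 1"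
  shows "(\<Sum>m\<in>{M<..N}. 1 / real m ^ 2) \<le> 1 / real M"
proof -
  have "(\<Sum>m\<in>{M<..N}. real m powr (- 2)) \<le> real M powr (1 - 2) / (2 - 1)"
    by (rule sum_powr_tail_le) (use assms in auto)
  moreover have "(\<Sum>m\<in>{M<..N}. real m powr (- 2)) = (\<Sum>m\<in>{M<..N}. 1 / real m ^ 2)"
    by (rule sum.cong) (auto simp: powr_minus_divide)
  ultimately show ?thesis using assms by (simp add: powr_minus_divide)
qed

lemma norm_suminf_tail_le:
  fixes G :: "nat \<Rightarrow> complex"
  assumes "\<And>m. m \<ge> 1 \<Longrightarrow> cmod (G m) \<le> C / real m ^ 2" "M \<ge> 1" "C \<ge> 0"
  shows "summable G" "cmod (suminf G - (\<Sum>m\<le>M. G m)) \<le> C / real M"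
proof -
  show s: "summable G"
    by (rule summable_comparison_test'[OF inverse_squares_summable[of C], of 1]) (use assms in auto)
  have "(\<lambda>N. (\<Sum>m\<le>N. G m) - (\<Sum>m\<le>M. G m)) \<longlonglongrightarrow> suminf G - (\<Sum>m\<le>M. G m)"
    by (intro tendsto_diff summable_LIMSEQ' s tendsto_const)
  moreover have "eventually (\<lambda>N. cmod ((\<Sum>m\<le>N. G m) - (\<Sum>m\<le>M. G m)) \<le> C / real M) sequentially"
    using eventually_ge_at_top[of M]
  proof eventually_elim
    case (elim N)
    then have "{..N} = {..M} \<union> {M<..N}" by auto
    moreover have "(\<Sum>m\<in>{..M} \<union> {M<..N}. G m) = (\<Sum>m\<le>M. G m) + (\<Sum>m\<in>{M<..N}. G m)"
      by (rule sum.union_disjoint) auto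
    ultimately have "(\<Sum>m\<le>N. G m) - (\<Sum>m\<le>M. G m) = (\<Sum>m\<in>{M<..N}. G m)"
      by simp
    also have "cmod \<dots> \<le> (\<Sum>m\<in>{M<..N}. C * (1 / real m ^ 2))"
      by (rule order_trans[OF norm_sum sum_mono]) (use assms in auto)
    also have "\<dots> \<le> C * (1 / real M)"
      unfolding sum_distrib_left[symmetric] using assms by (intro mult_left_mono sum_inverse_squares_tail) auto
    finally show ?case by simp
  qed
  ultimately show "cmod (suminf G - (\<Sum>m\<le>M. G m)) \<le> C / real M"
    by (rule Lim_norm_ubound[OF sequentially_bot])
qed

text \<open>For m <= n / 2 the coefficient at n - m is replaced by the main term at n; for larger m
  the bound G m = O(n^(-2)) meets a partial sum of order n powr \<open>dens k\<close>; completing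
  the sum of G costs O(1 / n).\<close>

lemma convolution_comparison:
  assumes k: "k > 0" and p: "p > 1 / beta_exp k" and CH: "CH > 0"
  shows "\<exists>C>0. \<forall>n d G. 2 \<le> n \<longrightarrow>
     (\<forall>j\<ge>1. cmod (of_real (chi k j) + d j) \<le> chi k j) \<longrightarrow> (\<forall>j>n. d j = 0) \<longrightarrow>
     cmod (G 0) \<le> 1 \<longrightarrow> (\<forall>m\<ge>1. cmod (G m) \<le> CH / real m ^ 2) \<longrightarrow> (k = 1 \<longrightarrow> (\<forall>m\<ge>1. G m = 0)) \<longrightarrow>
     cmod ((\<Sum>m\<le>n. ecoef (\<lambda>j. of_real (chi k j) + d j) (n - m) * G m) -
           exp (lpoly d n 1) * of_real (ecoef (chi k) n) * suminf G) \<le>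
       C * real n powr (dens k - 1) *
         (((\<Sum>j=1..n. cmod (d j) powr p) / real n) powr (1/p) + real n powr (- beta_exp k))"
proof -
  define \<alpha> where "\<alpha> = dens k"
  define \<beta> where "\<beta> = beta_exp k"
  have \<beta>: "0 < \<beta>" "\<beta> \<le> \<alpha>" "\<alpha> \<le> 1"
    using beta_exp_pos[OF k] beta_exp_le_dens[OF k] dens_le_1 by (simp_all add: \<alpha>_def \<beta>_def)
  obtain K where K: "K > 0" "\<And>n m d. 2 \<le> n \<Longrightarrow> 2 * m \<le> n \<Longrightarrow>
     \<forall>j\<ge>1. cmod (of_real (chi k j) + d j) \<le> chi k j \<Longrightarrow> \<forall>j>n. d j = 0 \<Longrightarrow>
     cmod (ecoef (\<lambda>j. of_real (chi k j) + d j) (n - m) - exp (lpoly d n 1) * of_real (ecoef (chi k) n)) \<le>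
       K * real n powr (dens k - 1) *
         (real m / real n + ((\<Sum>j=1..n. cmod (d j) powr p) / real n) powr (1/p) + real n powr (- beta_exp k))"
    using coeff_comparison[OF k p] by blast
  obtain C1 where C1: "C1 > 0" "\<And>n. n \<ge> 1 \<Longrightarrow> (\<Sum>m\<le>n. ecoef (chi k) m) \<le> C1 * real n powr dens k"
    using sum_ecoef_chi_le[OF k] by blast
  obtain C3 where C3: "C3 > 0" "\<And>n. n \<ge> 1 \<Longrightarrow> ecoef (chi k) n \<le> C3 * real n powr (dens k - 1)"
    using ecoef_chi_le[OF k] by blast
  \<comment> \<open>The shifts contribute the sum of (m / n) |G m|, of order log n / n. This is O(n
    powr (- \<beta>)) because \<beta> < 1 for k > 1. For k = 1, where \<beta> = 1, the sequence G
    consists of its constant term and the sum vanishes.\<close>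
  define L where "L = (if k = 1 then 0 else CH * (1 + 1 / (1 - \<beta>)))"
  have \<beta>1: "\<beta> < 1" if "k \<noteq> 1" using dens_less_1[of k] \<beta> k that by (simp add: \<alpha>_def)
  have L0: "L \<ge> 0"
  proof (cases "k = 1")
    case False
    then have "1 / (1 - \<beta>) \<ge> 0" using \<beta>1 by simp
    then show ?thesis using CH False by (simp add: L_def)
  qed (simp add: L_def)
  define C where "C = K * (L + 1 + 2 * CH) + 4 * CH * C1 + 3 * C3 * CH"
  have "L + 1 + 2 * CH > 0" using L0 CH by simp
  then have "K * (L + 1 + 2 * CH) > 0" "4 * CH * C1 > 0" "3 * C3 * CH > 0" using K(1) CH C1(1) C3(1) by simp_all
  then have C: "C > 0" unfolding C_def by (intro add_pos_pos)
  have "cmod ((\<Sum>m\<le>n. ecoef (\<lambda>j. of_real (chi k j) + d j) (n - m) * G m) -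
           exp (lpoly d n 1) * of_real (ecoef (chi k) n) * suminf G) \<le>
       C * real n powr (\<alpha> - 1) * (((\<Sum>j=1..n. cmod (d j) powr p) / real n) powr (1/p) + real n powr (- \<beta>))"
    if n: "2 \<le> n" and d: "\<forall>j\<ge>1. cmod (of_real (chi k j) + d j) \<le> chi k j"
      and dn: "\<forall>j>n. d j = 0" and G0: "cmod (G 0) \<le> 1" and G: "\<forall>m\<ge>1. cmod (G m) \<le> CH / real m ^ 2"
      and Gk: "k = 1 \<longrightarrow> (\<forall>m\<ge>1. G m = 0)" for n d G
  proof -
    define c where "c = ecoef (\<lambda>j. of_real (chi k j) + d j)"
    define b where "b = ecoef (chi k)"
    define E where "E = exp (lpoly d n 1)"
    define \<mu> where "\<mu> = ((\<Sum>j=1..n. cmod (d j) powr p) / real n) powr (1/p)"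
    define \<nu> where "\<nu> = real n powr (- \<beta>)"
    define A where "A = real n powr (\<alpha> - 1)"
    define M where "M = n div 2"
    have M: "M \<ge> 1" "2 * M \<le> n" using n by (auto simp: M_def)
    have "n \<le> 3 * M" using n unfolding M_def by presburger
    then have M3: "real n \<le> 3 * real M" by linarith
    have nn: "\<mu> \<ge> 0" "\<nu> \<ge> 0" "A \<ge> 0" by (auto simp: \<mu>_def \<nu>_def A_def)
    have inv: "1 / real n \<le> \<nu>"
    proof -
      have "1 / real n = real n powr (- 1)" using n by (simp add: powr_minus_divide)
      also have "\<dots> \<le> \<nu>" unfolding \<nu>_def using \<beta> n by (intro powr_mono) auto
      finally show ?thesis .
    qed
    have E1: "cmod E \<le> 1" unfolding E_def by (rule norm_exp_lpoly_1_le) (use d in blast)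
    have b0: "b l \<ge> 0" for l by (simp add: b_def ecoef_chi_nonneg)
    have cb: "cmod (c l) \<le> b l" for l unfolding c_def b_def by (rule norm_ecoef_le) (use d in blast)
    have bn: "b n \<le> C3 * A" using C3(2)[of n] n by (simp add: b_def A_def \<alpha>_def)
    have Gtail: "summable G" "cmod (suminf G - (\<Sum>m\<le>M. G m)) \<le> CH / real M"
      using norm_suminf_tail_le[of G CH M] G M CH by auto
    have sumG: "(\<Sum>m\<le>M. cmod (G m)) \<le> 1 + 2 * CH"
    proof -
      have "(\<Sum>m\<le>M. cmod (G m)) = cmod (G 0) + cmod (G 1) + (\<Sum>m\<in>{1<..M}. cmod (G m))"
      proof -
        have "{..M} = {0, 1} \<union> {1<..M}" using M by auto
        then show ?thesis by (simp add: sum.union_disjoint)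
      qed
      also have "(\<Sum>m\<in>{1<..M}. cmod (G m)) \<le> (\<Sum>m\<in>{1<..M}. CH * (1 / real m ^ 2))"
        by (rule sum_mono) (use G in auto)
      also have "\<dots> \<le> CH * (1 / real 1)"
        unfolding sum_distrib_left[symmetric] using CH by (intro mult_left_mono sum_inverse_squares_tail) auto
      also have "cmod (G 1) \<le> CH" using G[rule_format, of 1] by simp
      finally show ?thesis using G0 by simp
    qed
    have summG: "(\<Sum>m\<le>M. real m / real n * cmod (G m)) \<le> L * \<nu>"
    proof (cases "k = 1")
      case True
      then have "real m / real n * cmod (G m) = 0" for m using Gk by (cases "m = 0") auto
      then have "(\<Sum>m\<le>M. real m / real n * cmod (G m)) = 0" by (intro sum.neutral) blast
      then show ?thesis using True by (simp add: L_def)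
    next
      case False
      have "(\<Sum>m\<le>M. real m / real n * cmod (G m)) = (\<Sum>m=1..M. real m / real n * cmod (G m))"
        by (rule sum.mono_neutral_right) auto
      also have "\<dots> \<le> (\<Sum>m=1..M. CH / real n * (1 / real m))"
      proof (rule sum_mono)
        fix m assume m: "m \<in> {1..M}"
        have "real m / real n * cmod (G m) \<le> real m / real n * (CH / real m ^ 2)"
          using G m by (intro mult_left_mono) auto
        then show "real m / real n * cmod (G m) \<le> CH / real n * (1 / real m)"
          using m by (simp add: power2_eq_square)
      qed
      also have "\<dots> \<le> (\<Sum>m=1..n. CH / real n * (1 / real m))"
        using M CH by (intro sum_mono2) auto
      also have "\<dots> \<le> CH / real n * (1 + ln (real n))"
        unfolding sum_distrib_left[symmetric]
        using harmonic_bounds[of n] n CH by (intro mult_left_mono) (auto simp: abs_le_iff)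
      also have "ln (real n) \<le> real n powr (1 - \<beta>) / (1 - \<beta>)"
        using ln_powr_bound[of "real n" "1 - \<beta>"] n \<beta>1[OF False] by simp
      also have "1 + real n powr (1 - \<beta>) / (1 - \<beta>) \<le> real n powr (1 - \<beta>) * (1 + 1 / (1 - \<beta>))"
        using n \<beta>1[OF False] ge_one_powr_ge_zero[of "real n" "1 - \<beta>"] by (simp add: algebra_simps)
      also have "CH / real n * (real n powr (1 - \<beta>) * (1 + 1 / (1 - \<beta>))) = L * \<nu>"
        using n False by (simp add: L_def \<nu>_def powr_diff powr_minus_divide)
      finally show ?thesis using CH n by (simp add: mult_left_mono divide_right_mono)
    qed
    have part1: "cmod (\<Sum>m\<le>M. (c (n - m) - E * of_real (b n)) * G m) \<le> K * (L + 1 + 2 * CH) * (A * (\<mu> + \<nu>))"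
    proof -
      have "cmod (\<Sum>m\<le>M. (c (n - m) - E * of_real (b n)) * G m) \<le>
         (\<Sum>m\<le>M. K * A * (real m / real n * cmod (G m) + (\<mu> + \<nu>) * cmod (G m)))"
      proof (rule order_trans[OF norm_sum sum_mono])
        fix m assume "m \<in> {..M}"
        then have "2 * m \<le> n" using M by auto
        from K(2)[OF n this d dn]
        have "cmod (c (n - m) - E * of_real (b n)) \<le> K * A * (real m / real n + \<mu> + \<nu>)"
          by (simp add: c_def E_def b_def A_def \<mu>_def \<nu>_def \<alpha>_def \<beta>_def)
        then have "cmod (c (n - m) - E * of_real (b n)) * cmod (G m) \<le> K * A * (real m / real n + \<mu> + \<nu>) * cmod (G m)"
          by (intro mult_right_mono) auto
        then show "cmod ((c (n - m) - E * of_real (b n)) * G m) \<le> K * A * (real m / real n * cmod (G m) + (\<mu> + \<nu>) * cmod (G m))"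
        proof -
          have "K * A * (real m / real n + \<mu> + \<nu>) * cmod (G m) = K * A * (real m / real n * cmod (G m) + (\<mu> + \<nu>) * cmod (G m))"
            by (simp add: algebra_simps)
          then show ?thesis
            using \<open>cmod (c (n - m) - E * of_real (b n)) * cmod (G m) \<le> _\<close> by (simp only: norm_mult)
        qed
      qed
      also have "\<dots> = K * A * ((\<Sum>m\<le>M. real m / real n * cmod (G m)) + (\<mu> + \<nu>) * (\<Sum>m\<le>M. cmod (G m)))"
        by (simp add: sum.distrib sum_distrib_left algebra_simps)
      also have "\<dots> \<le> K * A * (L * (\<mu> + \<nu>) + (\<mu> + \<nu>) * (1 + 2 * CH))"
        using summG sumG K(1) nn mult_left_mono[of \<nu> "\<mu> + \<nu>" L] L0
        by (intro mult_left_mono add_mono) auto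
      finally show ?thesis by (simp add: algebra_simps)
    qed
    have part2: "cmod (\<Sum>m\<in>{M<..n}. c (n - m) * G m) \<le> 4 * CH * C1 * (A * (\<mu> + \<nu>))"
    proof -
      have "cmod (\<Sum>m\<in>{M<..n}. c (n - m) * G m) \<le> (\<Sum>m\<in>{M<..n}. b (n - m) * (4 * CH / real n ^ 2))"
      proof (rule order_trans[OF norm_sum sum_mono])
        fix m assume m: "m \<in> {M<..n}"
        then have m2: "real n \<le> 2 * real m" "m \<ge> 1" by (auto simp: M_def)
        have "real n ^ 2 \<le> (2 * real m) ^ 2" using m2 by (intro power_mono) auto
        then have "CH / real m ^ 2 \<le> 4 * CH / real n ^ 2"
          using CH n m2 by (simp add: field_simps)
        then have "cmod (G m) \<le> 4 * CH / real n ^ 2" using G m2 by (meson order_trans)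
        then show "cmod (c (n - m) * G m) \<le> b (n - m) * (4 * CH / real n ^ 2)"
          unfolding norm_mult using cb b0 by (intro mult_mono) auto
      qed
      also have "\<dots> = (\<Sum>m\<in>{M<..n}. b (n - m)) * (4 * CH / real n ^ 2)" by (rule sum_distrib_right[symmetric])
      also have "\<dots> \<le> (C1 * real n powr \<alpha>) * (4 * CH / real n ^ 2)"
      proof (rule mult_right_mono)
        have "(\<Sum>m\<in>{M<..n}. b (n - m)) \<le> (\<Sum>m\<le>n. b (n - m))" using b0 by (intro sum_mono2) auto
        also have "\<dots> = (\<Sum>m\<le>n. b m)"
          by (rule sum.reindex_bij_witness[of _ "\<lambda>m. n - m" "\<lambda>m. n - m"]) auto
        also have "\<dots> \<le> C1 * real n powr \<alpha>" using C1(2)[of n] n by (simp add: b_def \<alpha>_def)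
        finally show "(\<Sum>m\<in>{M<..n}. b (n - m)) \<le> C1 * real n powr \<alpha>" .
      qed (use CH in auto)
      also have "\<dots> = 4 * CH * C1 * (A * (1 / real n))"
        using n by (simp add: A_def powr_diff power2_eq_square)
      also have "\<dots> \<le> 4 * CH * C1 * (A * (\<mu> + \<nu>))"
        using inv nn CH C1(1) by (intro mult_left_mono) auto
      finally show ?thesis .
    qed
    have part3: "cmod (E * of_real (b n) * (suminf G - (\<Sum>m\<le>M. G m))) \<le> 3 * C3 * CH * (A * (\<mu> + \<nu>))"
    proof -
      have "cmod (E * of_real (b n) * (suminf G - (\<Sum>m\<le>M. G m))) \<le> 1 * (C3 * A) * (CH / real M)"
        unfolding norm_mult using E1 bn b0[of n] Gtail C3(1) nn by (intro mult_mono) auto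
      also have "\<dots> \<le> 1 * (C3 * A) * (3 * CH * (\<mu> + \<nu>))"
      proof (rule mult_left_mono)
        have "CH / real M \<le> 3 * CH * (1 / real n)"
          using M M3 n CH by (simp add: field_simps)
        also have "\<dots> \<le> 3 * CH * (\<mu> + \<nu>)" using inv nn CH by (intro mult_left_mono) auto
        finally show "CH / real M \<le> 3 * CH * (\<mu> + \<nu>)" .
      qed (use C3(1) nn in auto)
      also have "\<dots> = 3 * C3 * CH * (A * (\<mu> + \<nu>))" by (simp add: mult_ac)
      finally show ?thesis .
    qed
    have split: "{..n} = {..M} \<union> {M<..n}" using M by auto
    have "(\<Sum>m\<le>n. c (n - m) * G m) = (\<Sum>m\<le>M. c (n - m) * G m) + (\<Sum>m\<in>{M<..n}. c (n - m) * G m)"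
      unfolding split by (rule sum.union_disjoint) auto
    moreover have "(\<Sum>m\<le>M. c (n - m) * G m) = (\<Sum>m\<le>M. (c (n - m) - E * of_real (b n)) * G m) + E * of_real (b n) * (\<Sum>m\<le>M. G m)"
      by (simp add: sum_distrib_left sum.distrib[symmetric] algebra_simps)
    ultimately have "(\<Sum>m\<le>n. c (n - m) * G m) - E * of_real (b n) * suminf G =
       (\<Sum>m\<le>M. (c (n - m) - E * of_real (b n)) * G m) + (\<Sum>m\<in>{M<..n}. c (n - m) * G m)
         - E * of_real (b n) * (suminf G - (\<Sum>m\<le>M. G m))"
      by (simp add: algebra_simps)
    also have "cmod \<dots> \<le> K * (L + 1 + 2 * CH) * (A * (\<mu> + \<nu>)) + 4 * CH * C1 * (A * (\<mu> + \<nu>)) + 3 * C3 * CH * (A * (\<mu> + \<nu>))"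
      by (rule order_trans[OF norm_triangle_ineq4 add_mono[OF order_trans[OF norm_triangle_ineq add_mono[OF part1 part2]] part3]])
    also have "\<dots> = C * A * (\<mu> + \<nu>)" by (simp add: C_def algebra_simps)
    finally show ?thesis by (simp add: c_def E_def b_def A_def \<mu>_def \<nu>_def)
  qed
  then show ?thesis using C unfolding \<alpha>_def \<beta>_def by blast
qed

section \<open>The factors for lengths not coprime to k\<close>

lemma fps_prod_mono:
  fixes F G :: "'b \<Rightarrow> real fps"
  assumes "\<And>i m. i \<in> S \<Longrightarrow> 0 \<le> fps_nth (F i) m \<and> fps_nth (F i) m \<le> fps_nth (G i) m"
  shows "fps_nth (\<Prod>i\<in>S. F i) m \<le> fps_nth (\<Prod>i\<in>S. G i) m"
  using assms
proof (induction S arbitrary: m rule: infinite_finite_induct)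
  case (insert a S)
  have F0: "0 \<le> fps_nth (\<Prod>i\<in>S. F i) m" for m by (rule fps_prod_nonneg) (use insert in auto)
  have "0 \<le> fps_nth (G a) m" for m using insert.prems[of a m] by auto
  then show ?case
    using insert F0 by (auto simp: fps_mult_nth intro!: sum_mono mult_mono)
qed auto

lemma norm_fps_prod_le:
  fixes F :: "'b \<Rightarrow> complex fps" and H :: "'b \<Rightarrow> real fps"
  assumes "\<And>i m. i \<in> S \<Longrightarrow> cmod (fps_nth (F i) m) \<le> fps_nth (H i) m"
  shows "cmod (fps_nth (\<Prod>i\<in>S. F i) m) \<le> fps_nth (\<Prod>i\<in>S. H i) m"
  using assms
proof (induction S arbitrary: m rule: infinite_finite_induct)
  case (insert a S)
  have H0: "0 \<le> fps_nth (H a) m" for m using insert.prems[of a m] norm_ge_zero order_trans by blast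
  have "cmod (fps_nth (F a * (\<Prod>i\<in>S. F i)) m) \<le>
      (\<Sum>i=0..m. cmod (fps_nth (F a) i) * cmod (fps_nth (\<Prod>i\<in>S. F i) (m - i)))"
    unfolding fps_mult_nth by (rule order_trans[OF norm_sum]) (simp add: norm_mult)
  also have "\<dots> \<le> (\<Sum>i=0..m. fps_nth (H a) i * fps_nth (\<Prod>i\<in>S. H i) (m - i))"
    using insert H0 by (intro sum_mono mult_mono) auto
  finally show ?case using insert by (simp add: fps_mult_nth)
qed (auto simp: fps_one_nth)

lemma ecoef_ge:
  fixes y :: "nat \<Rightarrow> real"
  assumes "\<And>j. j \<ge> 1 \<Longrightarrow> 0 \<le> y j" "m \<ge> 1"
  shows "y m / real m \<le> ecoef y m"
proof -
  have "y m * ecoef y (m - m) \<le> (\<Sum>j=1..m. y j * ecoef y (m - j))"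
    using assms ecoef_nonneg[of y] by (intro member_le_sum[of m "{1..m}" "\<lambda>j. y j * ecoef y (m - j)"]) auto
  then have "y m \<le> real m * ecoef y m" by (simp add: ecoef_rec)
  then show ?thesis using assms(2) by (simp add: field_simps)
qed

lemma q_part_ge_2:
  assumes "k > 0" "j > 0" "\<not> coprime j k"
  shows "q_part k j \<ge> 2"
proof -
  obtain p where p: "prime p" "p dvd gcd j k"
    using assms(3) prime_factor_nat[of "gcd j k"] by (auto simp: coprime_iff_gcd_eq_1)
  have "multiplicity p (q_part k j) = multiplicity p k"
    using multiplicity_q_part[OF assms(1,2) p(1)] p by simp
  moreover have "multiplicity p k > 0" using p assms by (simp add: prime_multiplicity_gt_zero_iff)
  ultimately have "q_part k j \<noteq> 1" by auto
  then show ?thesis using q_part_pos[of k j] by linarith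
qed

lemma q_part_coprime:
  assumes "coprime j k"
  shows "q_part k j = 1"
proof -
  have "gcd k j = 1" using assms by (simp add: coprime_iff_gcd_eq_1 gcd.commute)
  then show ?thesis by (simp add: q_part_def)
qed

lemma cycle_factor_coprime:
  assumes "coprime j k" "j > 0"
  shows "cycle_factor x k j = efps (\<lambda>l. if l = j then x j else 0)"
  unfolding efps_single[OF assms(2)]
  by (rule fps_ext) (simp add: cycle_factor_def q_part_coprime[OF assms(1)] power_divide)

lemma cycle_factor_nth_0: "fps_nth (cycle_factor x k j) 0 = 1"
  by (simp add: cycle_factor_def)

lemma norm_cycle_factor_le:
  assumes "cmod (x j) \<le> 1"
  shows "cmod (fps_nth (cycle_factor x k j) m) \<le> fps_nth (cycle_factor (\<lambda>_. 1 :: real) k j) m"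
  using assms by (auto simp: cycle_factor_def norm_mult norm_divide norm_power intro!: divide_right_mono power_le_one)

text \<open>Weights of a majorant: \<open>efps (vcoef j)\<close> is the exponential of the sum of
  z^(j s) / (j^s s!) over s >= 2. It dominates the factor of length j because
  \<open>q_part k j\<close> >= 2, and being exponential it turns the product over j into a single
  \<open>efps\<close>.\<close>

definition vcoef :: "nat \<Rightarrow> nat \<Rightarrow> real" where
  "vcoef j m = (if j dvd m \<and> 2 \<le> m div j then real m / (real j ^ (m div j) * fact (m div j)) else 0)"

lemma vcoef_nonneg: "vcoef j m \<ge> 0"
  by (simp add: vcoef_def)

lemma cycle_factor_one_nonneg: "0 \<le> fps_nth (cycle_factor (\<lambda>_. 1 :: real) k j) m"
  by (simp add: cycle_factor_def)

lemma cycle_factor_one_le: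
  assumes "k > 0" "j > 0" "\<not> coprime j k"
  shows "fps_nth (cycle_factor (\<lambda>_. 1 :: real) k j) m \<le> fps_nth (efps (vcoef j)) m"
proof (cases "m = 0")
  case False
  have "fps_nth (cycle_factor (\<lambda>_. 1 :: real) k j) m \<le> vcoef j m / real m"
  proof (cases "j dvd m \<and> q_part k j dvd m div j")
    case True
    then have "m div j > 0" using False assms(2) by (auto simp: div_greater_zero_iff dvd_imp_le)
    then have "q_part k j \<le> m div j" using True by (auto dest: dvd_imp_le)
    then have "2 \<le> m div j" using q_part_ge_2[OF assms] by linarith
    then show ?thesis using True False by (simp add: cycle_factor_def vcoef_def)
  next
    case False
    then show ?thesis using vcoef_nonneg[of j m] by (auto simp: cycle_factor_def)
  qed
  also have "\<dots> \<le> ecoef (vcoef j) m" by (rule ecoef_ge) (use False vcoef_nonneg in auto)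
  finally show ?thesis by simp
qed (simp add: cycle_factor_def)

text \<open>s^2 / s! = s / ((s - 1) (s - 2)!) <= 2 / (s - 2)!, so the sum is at most 2 e.\<close>

lemma sum_squares_div_fact_le: "(\<Sum>s=2..m. real s ^ 2 / fact s) \<le> (6 :: real)"
proof -
  have "(\<Sum>s=2..m. real s ^ 2 / fact s) \<le> (\<Sum>s=2..m. 2 * (1 / fact (s - 2)))"
  proof (rule sum_mono)
    fix s assume "s \<in> {2..m}"
    then have t: "s = Suc (Suc (s - 2))" by auto
    define t where "t = s - 2"
    have t: "s = Suc (Suc t)" using t by (simp only: t_def)
    have f: "fact s = (real t + 2) * ((real t + 1) * fact t)" by (simp add: t algebra_simps)
    have "real s ^ 2 / fact s = (real t + 2) / ((real t + 1) * fact t)"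
      unfolding f by (simp add: t power2_eq_square add.commute)
    also have "\<dots> = ((real t + 2) / (real t + 1)) / fact t" by simp
    also have "\<dots> \<le> 2 / fact t" by (intro divide_right_mono) (simp_all add: field_simps)
    also have "\<dots> = 2 * (1 / fact t)" by simp
    finally show "real s ^ 2 / fact s \<le> 2 * (1 / fact (s - 2))" by (simp add: t)
  qed
  also have "\<dots> = 2 * (\<Sum>s=2..m. 1 / fact (s - 2))" by (simp add: sum_distrib_left)
  also have "(\<Sum>s=2..m. 1 / fact (s - 2)) = (\<Sum>i<m - 1. 1 / fact i :: real)"
    by (rule sum.reindex_bij_witness[of _ "\<lambda>i. i + 2" "\<lambda>s. s - 2"]) auto
  also have "\<dots> \<le> (\<Sum>i. 1 / fact i)"
    using summable_exp[of "1 :: real"] by (intro sum_le_suminf) (auto simp: divide_inverse)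
  also have "\<dots> = exp (1 :: real)" by (simp add: exp_def divide_inverse)
  also have "\<dots> \<le> 3" by (rule exp_le)
  finally show ?thesis by simp
qed

text \<open>Indexed by s = m / j >= 2, each term is at most m / (j^2 s!) = s^2 / (s! m), and
  distinct j have distinct s.\<close>

lemma sum_vcoef_le:
  assumes "m \<ge> 1" "J \<subseteq> {1..n}"
  shows "(\<Sum>j\<in>J. vcoef j m) \<le> 6 / real m"
proof -
  have fJ: "finite J" using assms(2) finite_subset by auto
  define T where "T = {j\<in>J. j dvd m \<and> 2 \<le> m div j}"
  have fT: "finite T" using fJ by (simp add: T_def)
  have "(\<Sum>j\<in>J. vcoef j m) = (\<Sum>j\<in>T. vcoef j m)"
    unfolding T_def by (rule sum.mono_neutral_right) (use fJ in \<open>auto simp: vcoef_def\<close>)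
  also have "\<dots> \<le> (\<Sum>j\<in>T. real (m div j) ^ 2 / fact (m div j) / real m)"
  proof (rule sum_mono)
    fix j assume j: "j \<in> T"
    define s where "s = m div j"
    have j1: "j \<ge> 1" "m = j * s" "s \<ge> 2" using j assms by (auto simp: T_def s_def)
    have "real j ^ 2 \<le> real j ^ s" using j1 by (intro power_increasing) auto
    then have "real m / (real j ^ s * fact s) \<le> real m / (real j ^ 2 * fact s)"
      using j1 by (intro divide_left_mono mult_right_mono) auto
    also have "\<dots> = real s ^ 2 / fact s / real m"
      using j1 by (simp add: field_simps power2_eq_square)
    finally show "vcoef j m \<le> real (m div j) ^ 2 / fact (m div j) / real m"
      using j by (simp add: vcoef_def T_def s_def)
  qed
  also have "\<dots> = (\<Sum>s\<in>(\<lambda>j. m div j) ` T. real s ^ 2 / fact s / real m)"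
  proof (rule sum.reindex[symmetric, unfolded o_def])
    show "inj_on (\<lambda>j. m div j) T"
    proof (rule inj_onI)
      fix j j' assume "j \<in> T" "j' \<in> T" and "m div j = m div j'"
      have aux: "b = c" if "b * s = (m::nat)" "c * s = m" "s > 0" for b c s
      proof -
        have "b * s = c * s" using that by simp
        then show ?thesis using that(3) by simp
      qed
      have 1: "j * (m div j) = m" "m div j > 0" using \<open>j \<in> T\<close> by (simp_all add: T_def)
      have "j' * (m div j') = m" using \<open>j' \<in> T\<close> by (simp add: T_def)
      then have "j' * (m div j) = m" by (simp only: \<open>m div j = m div j'\<close>)
      then show "j = j'" using aux[OF 1(1) _ 1(2)] by blast
    qed
  qed
  also have "\<dots> \<le> (\<Sum>s=2..m. real s ^ 2 / fact s / real m)"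
    by (rule sum_mono2) (auto simp: T_def)
  also have "\<dots> = (\<Sum>s=2..m. real s ^ 2 / fact s) / real m" by (simp add: sum_divide_distrib)
  also have "\<dots> \<le> 6 / real m" by (intro divide_right_mono sum_squares_div_fact_le) auto
  finally show ?thesis .
qed

text \<open>Applying z d/dz twice to F gives W F, and W has coefficients at most 6 + 36 = 42. The
  coefficients of F sum to at most exp 12, since the inverse squares sum to at most 2. Hence m^2
  times the m-th coefficient is bounded.\<close>

lemma ecoef_inverse_le:
  assumes "m \<ge> 1"
  shows "ecoef (\<lambda>l. 6 / real l) m \<le> 42 * exp 12 / real m ^ 2"
proof -
  define A where "A = afps (\<lambda>l. 6 / real l)"
  define W where "W = fps_XD A + A * A"
  define F where "F = efps (\<lambda>l. 6 / real l)"
  have F0: "fps_nth F l \<ge> 0" for l unfolding F_def efps_nth by (rule ecoef_nonneg) simp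
  have "fps_XD F = A * F" by (simp add: F_def A_def XD_efps)
  then have XX: "fps_XD (fps_XD F) = W * F" by (simp add: fps_XD_mult W_def algebra_simps)
  have W: "fps_nth W l \<le> 42" for l
  proof -
    have "fps_nth (A * A) l = (\<Sum>i=1..l. 6 / real i * fps_nth A (l - i))"
      by (simp add: A_def afps_mult_nth)
    also have "\<dots> \<le> 36"
    proof (cases "l \<le> 1")
      case True
      then show ?thesis by (cases l) (auto simp: A_def afps_nth)
    next
      case False
      have "(\<Sum>i=1..l. 6 / real i * fps_nth A (l - i)) = (\<Sum>i=1..l-1. 6 / real i * fps_nth A (l - i))"
        by (rule sum.mono_neutral_right) (auto simp: A_def afps_nth)
      also have "\<dots> \<le> (\<Sum>i=1..l-1. 36 / (real l - 1))"
      proof (rule sum_mono)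
        fix i assume i: "i \<in> {1..l-1}"
        \<comment> \<open>Gives i (l - i) >= l - 1, so each of the l - 1 terms of the convolution is
          at most 36 / (l - 1).\<close>
        have "0 \<le> (real i - 1) * (real (l - i) - 1)" using i by (intro mult_nonneg_nonneg) auto
        then have "real l - 1 \<le> real i * real (l - i)" using i by (simp add: of_nat_diff algebra_simps)
        then have "36 / (real i * real (l - i)) \<le> 36 / (real l - 1)"
          using False i by (intro divide_left_mono mult_pos_pos) auto
        moreover have "6 / real i * fps_nth A (l - i) = 36 / (real i * real (l - i))"
          using i by (simp add: A_def afps_nth del: of_nat_diff)
        ultimately show "6 / real i * fps_nth A (l - i) \<le> 36 / (real l - 1)" by (simp only:)
      qed
      also have "\<dots> = 36"
      proof -
        have l: "real (l - 1) = real l - 1" "real l - 1 \<noteq> 0" using False by (auto simp: of_nat_diff)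
        have "card {1..l - 1} = l - 1" by simp
        then have "(\<Sum>i=1..l-1. 36 / (real l - 1)) = (real l - 1) * (36 / (real l - 1))"
          by (simp only: sum_constant l(1))
        also have "\<dots> = 36"
        proof -
          have "y * (36 / y) = 36" if "y \<noteq> 0" for y :: real using that by simp
          then show ?thesis using l(2) by blast
        qed
        finally show ?thesis .
      qed
      finally show ?thesis .
    qed
    finally show ?thesis by (simp add: W_def A_def afps_nth)
  qed
  have "real m ^ 2 * ecoef (\<lambda>l. 6 / real l) m = fps_nth (W * F) m"
    using arg_cong[OF XX, of "\<lambda>f. fps_nth f m"] by (simp add: F_def power2_eq_square)
  also have "\<dots> = (\<Sum>i=0..m. fps_nth W i * fps_nth F (m - i))" by (rule fps_mult_nth)
  also have "\<dots> \<le> (\<Sum>i=0..m. 42 * fps_nth F (m - i))"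
    using W F0 by (intro sum_mono mult_right_mono) auto
  also have "\<dots> = 42 * (\<Sum>i=0..m. fps_nth F (m - i))" by (simp add: sum_distrib_left)
  also have "(\<Sum>i=0..m. fps_nth F (m - i)) = (\<Sum>i\<le>m. fps_nth F i)"
    by (rule sum.reindex_bij_witness[of _ "\<lambda>i. m - i" "\<lambda>i. m - i"]) auto
  also have "\<dots> \<le> exp (\<Sum>j=1..m. 6 / real j / real j)"
    unfolding F_def efps_nth by (rule sum_ecoef_le) simp
  also have "(\<Sum>j=1..m. 6 / real j / real j) = 6 * (\<Sum>j=1..m. 1 / real j ^ 2)"
    by (simp add: sum_distrib_left power2_eq_square)
  also have "(\<Sum>j=1..m. 1 / real j ^ 2) = 1 + (\<Sum>j\<in>{1<..m}. 1 / real j ^ 2)"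
    using assms by (subst sum.head) auto
  also have "\<dots> \<le> 2" using sum_inverse_squares_tail[of 1 m] by simp
  finally have "real m ^ 2 * ecoef (\<lambda>l. 6 / real l) m \<le> 42 * exp 12" by simp
  then show ?thesis using assms by (simp add: field_simps)
qed

text \<open>The point is uniformity in n and J: the whole product is dominated by one exponential
  whose weights are at most 6 / l.\<close>

lemma noncoprime_factor_bound:
  assumes k: "k > 0" and J: "J \<subseteq> {1..n}" "\<And>j. j \<in> J \<Longrightarrow> \<not> coprime j k" and m: "m \<ge> 1"
  shows "fps_nth (\<Prod>j\<in>J. cycle_factor (\<lambda>_. 1 :: real) k j) m \<le> 42 * exp 12 / real m ^ 2"
proof -
  have fJ: "finite J" using J(1) finite_subset by auto
  have "fps_nth (\<Prod>j\<in>J. cycle_factor (\<lambda>_. 1 :: real) k j) m \<le> fps_nth (\<Prod>j\<in>J. efps (vcoef j)) m"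
  proof (rule fps_prod_mono)
    fix j m assume "j \<in> J"
    then have "j > 0" "\<not> coprime j k" using J by auto
    then show "0 \<le> fps_nth (cycle_factor (\<lambda>_. 1 :: real) k j) m \<and>
        fps_nth (cycle_factor (\<lambda>_. 1 :: real) k j) m \<le> fps_nth (efps (vcoef j)) m"
      using cycle_factor_one_nonneg cycle_factor_one_le[OF k] by blast
  qed
  also have "\<dots> = ecoef (\<lambda>m. \<Sum>j\<in>J. vcoef j m) m"
    unfolding efps_sum[OF fJ, symmetric] by simp
  also have "\<dots> \<le> ecoef (\<lambda>l. 6 / real l) m"
    using J(1) by (intro ecoef_mono sum_nonneg vcoef_nonneg sum_vcoef_le) auto
  also have "\<dots> \<le> 42 * exp 12 / real m ^ 2" by (rule ecoef_inverse_le[OF m])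
  finally show ?thesis .
qed

section \<open>Evaluation of the factors at 1\<close>

lemma suminf_fps_prod:
  fixes F :: "'b \<Rightarrow> complex fps"
  assumes "finite S" "\<And>i. i \<in> S \<Longrightarrow> summable (\<lambda>m. cmod (fps_nth (F i) m))"
  shows "summable (\<lambda>m. cmod (fps_nth (\<Prod>i\<in>S. F i) m)) \<and>
         suminf (fps_nth (\<Prod>i\<in>S. F i)) = (\<Prod>i\<in>S. suminf (fps_nth (F i)))"
  using assms
proof (induction S rule: finite_induct)
  case empty
  have "(\<lambda>m. fps_nth 1 m :: complex) sums 1"
    using sums_single[of 0 "\<lambda>_. 1 :: complex"] by (simp add: fps_one_nth if_distrib cong: if_cong)
  moreover have "summable (\<lambda>m. cmod (fps_nth 1 m))"
    by (rule summable_finite[of "{0}"]) auto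
  ultimately show ?case by (simp add: sums_iff)
next
  case (insert a S)
  have a: "summable (\<lambda>m. cmod (fps_nth (F a) m))" using insert.prems by simp
  have S: "summable (\<lambda>m. cmod (fps_nth (\<Prod>i\<in>S. F i) m))"
    "suminf (fps_nth (\<Prod>i\<in>S. F i)) = (\<Prod>i\<in>S. suminf (fps_nth (F i)))" using insert by auto
  have conv: "(\<lambda>m. fps_nth (F a * (\<Prod>i\<in>S. F i)) m) sums (suminf (fps_nth (F a)) * suminf (fps_nth (\<Prod>i\<in>S. F i)))"
    using Cauchy_product_sums[OF a S(1)] by (simp add: fps_mult_nth atLeast0AtMost)
  have "summable (\<lambda>m. \<Sum>i\<le>m. cmod (fps_nth (F a) i) * cmod (fps_nth (\<Prod>i\<in>S. F i) (m - i)))"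
    using summable_Cauchy_product[of "\<lambda>m. cmod (fps_nth (F a) m)" "\<lambda>m. cmod (fps_nth (\<Prod>i\<in>S. F i) m)"] a S(1) by simp
  then have "summable (\<lambda>m. cmod (fps_nth (F a * (\<Prod>i\<in>S. F i)) m))"
    by (rule summable_comparison_test'[of _ 0])
       (auto simp: fps_mult_nth atLeast0AtMost norm_mult intro!: order_trans[OF norm_sum])
  then show ?case using conv insert S by (simp add: sums_iff)
qed

lemma cycle_factor_sum:
  fixes x :: "nat \<Rightarrow> complex"
  assumes "j > 0"
  shows "summable (\<lambda>m. cmod (fps_nth (cycle_factor x k j) m))"
    and "suminf (fps_nth (cycle_factor x k j)) =
         1 + (\<Sum>\<^sub>\<infinity>s\<in>{s. s \<ge> 1 \<and> q_part k j dvd s}. x j ^ s / (of_nat j ^ s * fact s))"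
proof -
  define g where "g s = (if q_part k j dvd s then x j ^ s / (of_nat j ^ s * fact s) else 0)" for s
  have sg: "summable (\<lambda>s. cmod (g s))"
  proof (rule summable_comparison_test'[of "\<lambda>s. (cmod (x j) / real j) ^ s / fact s" 0])
    show "summable (\<lambda>s. (cmod (x j) / real j) ^ s / fact s)"
      using summable_exp[of "cmod (x j) / real j"] by (simp add: divide_inverse mult.commute)
  qed (auto simp: g_def norm_divide norm_mult norm_power power_divide)
  have sub: "strict_mono (\<lambda>s. j * s)" using assms by (auto simp: strict_mono_def)
  have eq: "fps_nth (cycle_factor x k j) (j * s) = g s" for s
    using assms by (simp add: cycle_factor_def g_def)
  have out: "fps_nth (cycle_factor x k j) m = 0" if "m \<notin> range (\<lambda>s. j * s)" for m
    using that by (auto simp: cycle_factor_def)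
  show "summable (\<lambda>m. cmod (fps_nth (cycle_factor x k j) m))"
    using summable_mono_reindex[OF sub, of "\<lambda>m. cmod (fps_nth (cycle_factor x k j) m)"] out sg
    by (simp add: eq)
  have "suminf (fps_nth (cycle_factor x k j)) = suminf g"
    using suminf_mono_reindex[OF sub, of "fps_nth (cycle_factor x k j)"] out
    by (simp add: eq)
  also have "\<dots> = 1 + (\<Sum>\<^sub>\<infinity>s\<in>{s. s \<ge> 1 \<and> q_part k j dvd s}. x j ^ s / (of_nat j ^ s * fact s))"
  proof -
    have hs: "(g has_sum suminf g) UNIV"
      using norm_summable_imp_has_sum[OF sg] summable_norm_cancel[OF sg] by (simp add: summable_sums)
    have "(g has_sum (suminf g - g 0)) (UNIV - {0})"
      by (rule has_sum_Diff[OF hs]) (use has_sum_finite[of "{0}" g] in auto)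
    moreover have "(g has_sum (suminf g - g 0)) (UNIV - {0}) \<longleftrightarrow>
        ((\<lambda>s. x j ^ s / (of_nat j ^ s * fact s)) has_sum (suminf g - g 0)) {s. s \<ge> 1 \<and> q_part k j dvd s}"
      by (rule has_sum_cong_neutral) (auto simp: g_def)
    ultimately have "(\<Sum>\<^sub>\<infinity>s\<in>{s. s \<ge> 1 \<and> q_part k j dvd s}. x j ^ s / (of_nat j ^ s * fact s)) = suminf g - g 0"
      using infsumI by blast
    then show ?thesis by (simp add: g_def)
  qed
  finally show "suminf (fps_nth (cycle_factor x k j)) =
         1 + (\<Sum>\<^sub>\<infinity>s\<in>{s. s \<ge> 1 \<and> q_part k j dvd s}. x j ^ s / (of_nat j ^ s * fact s))" .
qed

text \<open>The factors of coprime lengths carry no restriction and merge into one exponential.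
  Beyond n their weight is set to 1, which does not affect coefficients up to n and gives it the
  form \<open>chi k\<close> + d with d supported on {1..n}.\<close>

lemma powers_sum_eq_convolution:
  fixes x :: "nat \<Rightarrow> complex" and n :: nat
  assumes k: "k > 0"
  defines "J \<equiv> {j \<in> {1..n}. \<not> coprime j k}"
  shows "(\<Sum>\<sigma>\<in>sym_group_powers k n. \<Prod>C\<in>perm_cycles n \<sigma>. x (card C)) =
     fact n * (\<Sum>m\<le>n. ecoef (\<lambda>j. if coprime j k then (if j \<le> n then x j else 1) else 0) (n - m)
        * fps_nth (\<Prod>j\<in>J. cycle_factor x k j) m)"
proof -
  define I where "I = {j \<in> {1..n}. coprime j k}"
  have fin: "finite I" "finite J" by (auto simp: I_def J_def)
  have split: "{1..n} = I \<union> J" "I \<inter> J = {}" by (auto simp: I_def J_def)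
  have "(\<Prod>j\<in>I. cycle_factor x k j) = (\<Prod>j\<in>I. efps (\<lambda>l. if l = j then x j else 0))"
    by (rule prod.cong) (auto simp: I_def cycle_factor_coprime)
  also have "\<dots> = efps (\<lambda>l. \<Sum>j\<in>I. if l = j then x j else 0)" by (rule efps_sum[OF fin(1), symmetric])
  finally have I: "(\<Prod>j\<in>I. cycle_factor x k j) = efps (\<lambda>l. if l \<in> I then x l else 0)"
    using fin by simp
  have "(\<Prod>j\<in>{1..n}. cycle_factor x k j) = (\<Prod>j\<in>J. cycle_factor x k j) * efps (\<lambda>l. if l \<in> I then x l else 0)"
    unfolding split(1) prod.union_disjoint[OF fin split(2)] I by (rule mult.commute)
  then have "fps_nth (\<Prod>j\<in>{1..n}. cycle_factor x k j) n =
      (\<Sum>m\<le>n. fps_nth (\<Prod>j\<in>J. cycle_factor x k j) m * ecoef (\<lambda>l. if l \<in> I then x l else 0) (n - m))"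
    by (simp add: fps_mult_nth atLeast0AtMost)
  also have "\<dots> = (\<Sum>m\<le>n. ecoef (\<lambda>j. if coprime j k then (if j \<le> n then x j else 1) else 0) (n - m)
        * fps_nth (\<Prod>j\<in>J. cycle_factor x k j) m)"
  proof (rule sum.cong)
    fix m assume "m \<in> {..n}"
    have "ecoef (\<lambda>l. if l \<in> I then x l else 0) (n - m) =
        ecoef (\<lambda>j. if coprime j k then (if j \<le> n then x j else 1) else 0) (n - m)"
      by (rule ecoef_cong) (auto simp: I_def)
    then show "fps_nth (\<Prod>j\<in>J. cycle_factor x k j) m * ecoef (\<lambda>l. if l \<in> I then x l else 0) (n - m) =
       ecoef (\<lambda>j. if coprime j k then (if j \<le> n then x j else 1) else 0) (n - m) * fps_nth (\<Prod>j\<in>J. cycle_factor x k j) m"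
      by (simp add: mult.commute)
  qed simp
  finally show ?thesis unfolding sum_over_powers[OF k] by simp
qed

section \<open>The quotient of the two sums\<close>

lemma card_powers_pos: "card (sym_group_powers k n) > 0"
proof -
  have "sym_group_powers k n \<subseteq> {\<sigma>. \<sigma> permutes {1..n}}"
    by (auto simp: sym_group_powers_def permutes_funpow)
  then have "finite (sym_group_powers k n)" by (rule finite_subset) (simp add: finite_permutations)
  moreover have "id ^^ k \<in> sym_group_powers k n"
    unfolding sym_group_powers_def using permutes_id by blast
  ultimately show ?thesis by (auto simp: card_gt_0_iff)
qed

lemma fps_prod_nth_0: "fps_nth (\<Prod>i\<in>S. F i) 0 = (\<Prod>i\<in>S. fps_nth (F i) 0)"
  by (induction S rule: infinite_finite_induct) auto

text \<open>Both main terms contain the same factor b, which cancels: the numerator's error is kept,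
  and the denominator's error enters multiplied by E Pf / P1, of modulus at most 1.\<close>

lemma norm_quotient_diff_le:
  fixes T1 P1 Tf Pf E :: complex
  assumes "cmod (Tf - E * b * Pf) \<le> e1" "cmod (T1 - b * P1) \<le> e2"
    and "cmod E \<le> 1" "cmod Pf \<le> cmod P1" "P1 \<noteq> 0" "0 < t" "t \<le> cmod T1"
  shows "cmod (Tf / T1 - E * (Pf / P1)) \<le> (e1 + e2) / t"
proof -
  have T1: "T1 \<noteq> 0" using assms by auto
  have e: "0 \<le> e1" using assms(1) norm_ge_zero[of "Tf - E * b * Pf"] by linarith
  have e2: "0 \<le> e2" using assms(2) norm_ge_zero[of "T1 - b * P1"] by linarith
  have "Tf / T1 - E * (Pf / P1) = ((Tf - E * b * Pf) - E * (Pf / P1) * (T1 - b * P1)) / T1"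
    using T1 assms(5) by (simp add: field_simps)
  then have "cmod (Tf / T1 - E * (Pf / P1)) = cmod ((Tf - E * b * Pf) - E * (Pf / P1) * (T1 - b * P1)) / cmod T1"
    by (simp only: norm_divide)
  also have "\<dots> \<le> (e1 + e2) / cmod T1"
  proof (rule divide_right_mono)
    have "cmod (E * (Pf / P1) * (T1 - b * P1)) \<le> 1 * 1 * e2"
      unfolding norm_mult using assms by (intro mult_mono) (auto simp: norm_divide divide_le_eq_1)
    then show "cmod ((Tf - E * b * Pf) - E * (Pf / P1) * (T1 - b * P1)) \<le> e1 + e2"
      using norm_triangle_ineq4[of "Tf - E * b * Pf" "E * (Pf / P1) * (T1 - b * P1)"] assms(1) by linarith
  qed simp
  also have "\<dots> \<le> (e1 + e2) / t" using assms e e2 T1 by (intro divide_left_mono mult_pos_pos) auto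
  finally show ?thesis .
qed

text \<open>Up to n!, the sum of f over the powers and the number of powers are the values of one
  convolution \<open>T\<close>, at \<open>fhat\<close> and at the constant 1. The comparison is
  applied to both, and the quotient of the main terms is the asserted expression.\<close>

theorem theorem17:
  fixes k :: nat and p :: real
  assumes "k \<ge> 1"
    and "p > 1 / beta_exp k"
  shows "\<exists>C::real. \<forall>(n::nat) (f :: (nat \<Rightarrow> nat) \<Rightarrow> complex) (fhat :: nat \<Rightarrow> complex).
           n \<ge> 1 \<longrightarrow> multiplicative_on_perms n f fhat \<longrightarrow> (\<forall>j\<in>{1..n}. cmod (fhat j) \<le> 1) \<longrightarrow>
           cmod (mean_on_powers k n f
                 - exp (\<Sum>j | j \<in> {1..n} \<and> coprime j k. (fhat j - 1) / of_nat j)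
                   * (\<Prod>j | j \<in> {1..n} \<and> gcd j k > 1.
                        (1 + (\<Sum>\<^sub>\<infinity>s\<in>{s. s \<ge> 1 \<and> q_part k j dvd s}.
                                fhat j ^ s / (of_nat j ^ s * fact s)))
                        / (1 + (\<Sum>\<^sub>\<infinity>s\<in>{s. s \<ge> 1 \<and> q_part k j dvd s}.
                                1 / (of_nat j ^ s * fact s)))))
           \<le> C * (mu_dist k n p fhat + 1 / real n powr beta_exp k)"
proof -
  have k: "k > 0" using assms(1) by simp
  define \<alpha> where "\<alpha> = dens k"
  define \<beta> where "\<beta> = beta_exp k"
  have \<beta>: "0 < \<beta>" using beta_exp_pos[OF k] by (simp add: \<beta>_def)
  define CH :: real where "CH = 42 * exp 12"
  have CH: "CH > 0" by (simp add: CH_def)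
  obtain C where C: "C > 0" "\<And>n d G. 2 \<le> n \<Longrightarrow>
     \<forall>j\<ge>1. cmod (of_real (chi k j) + d j) \<le> chi k j \<Longrightarrow> \<forall>j>n. d j = 0 \<Longrightarrow>
     cmod (G 0) \<le> 1 \<Longrightarrow> \<forall>m\<ge>1. cmod (G m) \<le> CH / real m ^ 2 \<Longrightarrow> (k = 1 \<longrightarrow> (\<forall>m\<ge>1. G m = 0)) \<Longrightarrow>
     cmod ((\<Sum>m\<le>n. ecoef (\<lambda>j. of_real (chi k j) + d j) (n - m) * G m) -
           exp (lpoly d n 1) * of_real (ecoef (chi k) n) * suminf G) \<le>
       C * real n powr (dens k - 1) *
         (((\<Sum>j=1..n. cmod (d j) powr p) / real n) powr (1/p) + real n powr (- beta_exp k))"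
    using convolution_comparison[OF k assms(2) CH] by blast
  obtain c n0 where c: "c > 0" "\<And>n. n \<ge> n0 \<Longrightarrow> c * real n powr (dens k - 1) \<le> ecoef (chi k) n"
    using ecoef_chi_ge[OF k] by blast
  \<comment> \<open>The lower bound for the denominator holds only for large n. The second summand
    of \<open>C'\<close> covers the finitely many smaller n, where the two quantities differ by at
    most 2.\<close>
  define n1 where "n1 = max n0 2"
  define C' where "C' = 2 * C / c + 2 * real n1 powr \<beta>"
  have "cmod (mean_on_powers k n f - exp (\<Sum>j | j \<in> {1..n} \<and> coprime j k. (fhat j - 1) / of_nat j)
                   * (\<Prod>j | j \<in> {1..n} \<and> gcd j k > 1.
                        (1 + (\<Sum>\<^sub>\<infinity>s\<in>{s. s \<ge> 1 \<and> q_part k j dvd s}.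
                                fhat j ^ s / (of_nat j ^ s * fact s)))
                        / (1 + (\<Sum>\<^sub>\<infinity>s\<in>{s. s \<ge> 1 \<and> q_part k j dvd s}.
                                1 / (of_nat j ^ s * fact s)))))
        \<le> C' * (mu_dist k n p fhat + 1 / real n powr \<beta>)"
    if n: "n \<ge> 1" and f: "multiplicative_on_perms n f fhat" and fh: "\<forall>j\<in>{1..n}. cmod (fhat j) \<le> 1" for n f fhat
  proof -
    define J where "J = {j \<in> {1..n}. \<not> coprime j k}"
    have fJ: "finite J" "J \<subseteq> {1..n}" by (auto simp: J_def)
    have Jeq: "{j. j \<in> {1..n} \<and> gcd j k > 1} = J"
    proof -
      have "gcd j k > 1 \<longleftrightarrow> \<not> coprime j k" for j
      proof -
        have "gcd j k \<ge> 1" using k by (simp add: Suc_le_eq)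
        then show ?thesis unfolding coprime_iff_gcd_eq_1 by linarith
      qed
      then show ?thesis by (simp add: J_def)
    qed
    define one where "one = (\<lambda>_ :: nat. 1 :: complex)"
    define G where "G x m = fps_nth (\<Prod>j\<in>J. cycle_factor x k j) m" for x :: "nat \<Rightarrow> complex" and m
    define H where "H m = fps_nth (\<Prod>j\<in>J. cycle_factor (\<lambda>_. 1 :: real) k j) m" for m
    define w where "w x j = (if coprime j k then (if j \<le> n then x j else 1) else 0)" for x :: "nat \<Rightarrow> complex" and j
    define d where "d x j = (if coprime j k \<and> j \<in> {1..n} then x j - 1 else 0)" for x :: "nat \<Rightarrow> complex" and j
    define T where "T x = (\<Sum>m\<le>n. ecoef (w x) (n - m) * G x m)" for x
    define P where "P x = suminf (G x)" for x
    define E where "E = exp (lpoly (d fhat) n 1)"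
    have bd1: "\<forall>j\<in>{1..n}. cmod (one j) \<le> 1" by (simp add: one_def)
    have GH: "cmod (G x m) \<le> H m" if "\<forall>j\<in>{1..n}. cmod (x j) \<le> 1" for x m
      unfolding G_def H_def
      by (rule norm_fps_prod_le, rule norm_cycle_factor_le) (use that fJ in auto)
    have H0: "H 0 = 1" unfolding H_def by (simp add: fps_prod_nth_0 cycle_factor_nth_0)
    have Hm: "H m \<le> CH / real m ^ 2" if "m \<ge> 1" for m
      unfolding H_def CH_def by (rule noncoprime_factor_bound[OF k fJ(2) _ that]) (simp add: J_def)
    have Hnn: "H m \<ge> 0" for m unfolding H_def by (rule fps_prod_nonneg) (rule cycle_factor_one_nonneg)
    have G1: "G one m = of_real (H m)" for m
    proof -
      have cf: "cycle_factor one k j = Abs_fps (\<lambda>m. of_real (fps_nth (cycle_factor (\<lambda>_. 1 :: real) k j) m))" for j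
        by (rule fps_ext) (simp add: cycle_factor_def one_def)
      have "fps_nth (\<Prod>j\<in>S. cycle_factor one k j) m = of_real (fps_nth (\<Prod>j\<in>S. cycle_factor (\<lambda>_. 1 :: real) k j) m)"
        if "finite S" for S m
        using that
      proof (induction S arbitrary: m rule: finite_induct)
        case (insert a S)
        then show ?case by (simp add: fps_mult_nth cf)
      qed (simp add: fps_one_nth)
      then show ?thesis using fJ by (simp add: G_def H_def)
    qed
    have Gk1: "k = 1 \<longrightarrow> (\<forall>m\<ge>1. G x m = 0)" for x
    proof
      assume "k = 1"
      then have "J = {}" by (simp add: J_def)
      then show "\<forall>m\<ge>1. G x m = 0" by (simp add: G_def)
    qed
    have sumG: "summable (\<lambda>m. cmod (G x m)) \<and> P x = (\<Prod>j\<in>J. 1 + (\<Sum>\<^sub>\<infinity>s\<in>{s. s \<ge> 1 \<and> q_part k j dvd s}. x j ^ s / (of_nat j ^ s * fact s)))" for x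
    proof -
      have pos: "j > 0" if "j \<in> J" for j using that fJ by auto
      have "summable (\<lambda>m. cmod (fps_nth (\<Prod>j\<in>J. cycle_factor x k j) m)) \<and>
         suminf (fps_nth (\<Prod>j\<in>J. cycle_factor x k j)) = (\<Prod>j\<in>J. suminf (fps_nth (cycle_factor x k j)))"
        by (rule suminf_fps_prod[OF fJ(1)]) (rule cycle_factor_sum(1)[OF pos])
      moreover have "(\<Prod>j\<in>J. suminf (fps_nth (cycle_factor x k j))) =
         (\<Prod>j\<in>J. 1 + (\<Sum>\<^sub>\<infinity>s\<in>{s. s \<ge> 1 \<and> q_part k j dvd s}. x j ^ s / (of_nat j ^ s * fact s)))"
        by (rule prod.cong[OF refl]) (rule cycle_factor_sum(2)[OF pos])
      moreover have "G x = fps_nth (\<Prod>j\<in>J. cycle_factor x k j)" by (rule ext) (simp add: G_def)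
      ultimately show ?thesis by (simp add: P_def)
    qed
    have sumH: "summable H"
      using sumG[of one] Hnn by (simp add: G1)
    have P1: "P one = of_real (suminf H)"
    proof -
      have "G one = (\<lambda>m. complex_of_real (H m))" by (rule ext) (rule G1)
      then show ?thesis using suminf_of_real[OF sumH, where 'a = complex] by (simp add: P_def)
    qed
    \<comment> \<open>The constant term is already 1, so the denominators of the product in the
      theorem do not vanish.\<close>
    have H1: "suminf H \<ge> 1"
      using sum_le_suminf[OF sumH, of "{0}"] Hnn H0 by simp
    \<comment> \<open>The factors for \<open>fhat\<close> are dominated coefficientwise by those for
      1, so the product in the theorem has modulus at most 1.\<close>
    have PfP1: "cmod (P fhat) \<le> cmod (P one)"
    proof -
      have "cmod (P fhat) \<le> suminf (\<lambda>m. cmod (G fhat m))" unfolding P_def by (rule summable_norm) (use sumG in blast)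
      also have "\<dots> \<le> suminf H" by (rule suminf_le) (use GH[OF fh] sumG sumH in auto)
      finally show ?thesis using P1 H1 by simp
    qed
    have P1nz: "P one \<noteq> 0" using P1 H1 by auto
    have prod: "(\<Prod>j | j \<in> {1..n} \<and> gcd j k > 1.
                        (1 + (\<Sum>\<^sub>\<infinity>s\<in>{s. s \<ge> 1 \<and> q_part k j dvd s}.
                                fhat j ^ s / (of_nat j ^ s * fact s)))
                        / (1 + (\<Sum>\<^sub>\<infinity>s\<in>{s. s \<ge> 1 \<and> q_part k j dvd s}.
                                1 / (of_nat j ^ s * fact s)))) = P fhat / P one"
      unfolding Jeq prod_dividef using sumG[of fhat] sumG[of one] by (simp add: one_def)
    have sumS: "(\<Sum>\<sigma>\<in>sym_group_powers k n. \<Prod>C\<in>perm_cycles n \<sigma>. x (card C)) = fact n * T x" for x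
      using powers_sum_eq_convolution[OF k, where n = n and x = x] by (simp add: T_def w_def[abs_def] G_def J_def)
    have card: "of_nat (card (sym_group_powers k n)) = fact n * T one"
      using sumS[of one] by (simp add: one_def)
    have permP: "\<sigma> permutes {1..n}" if "\<sigma> \<in> sym_group_powers k n" for \<sigma>
      using that by (auto simp: sym_group_powers_def permutes_funpow)
    have fs: "(\<Sum>\<sigma>\<in>sym_group_powers k n. f \<sigma>) = fact n * T fhat"
      unfolding sumS[symmetric] by (rule sum.cong) (use f permP in \<open>auto simp: multiplicative_on_perms_def\<close>)
    have mean: "mean_on_powers k n f = T fhat / T one"
      unfolding mean_on_powers_def fs card by simp
    have Eexp: "exp (\<Sum>j | j \<in> {1..n} \<and> coprime j k. (fhat j - 1) / of_nat j) = E"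
    proof -
      have "lpoly (d fhat) n 1 = (\<Sum>j=1..n. d fhat j / of_nat j)" by (simp add: lpoly_def)
      also have "\<dots> = (\<Sum>j | j \<in> {1..n} \<and> coprime j k. (fhat j - 1) / of_nat j)"
        by (rule sum.mono_neutral_cong_right) (auto simp: d_def)
      finally show ?thesis by (simp add: E_def)
    qed
    have mu: "mu_dist k n p fhat = ((\<Sum>j=1..n. cmod (d fhat j) powr p) / real n) powr (1/p)"
    proof -
      have "(\<Sum>j=1..n. cmod (d fhat j) powr p) = (\<Sum>j | j \<in> {1..n} \<and> coprime j k. cmod (fhat j - 1) powr p)"
        by (rule sum.mono_neutral_cong_right) (auto simp: d_def)
      then show ?thesis by (simp add: mu_dist_def)
    qed
    have mu0: "mu_dist k n p fhat \<ge> 0" by (simp add: mu_dist_def)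
    have dn: "cmod (of_real (chi k j) + d x j) \<le> chi k j" if "\<forall>j\<in>{1..n}. cmod (x j) \<le> 1" for x j
      using that by (auto simp: d_def chi_def)
    have E1: "cmod E \<le> 1" unfolding E_def by (rule norm_exp_lpoly_1_le) (rule dn[OF fh])
    have inv: "1 / real n powr \<beta> = real n powr (- \<beta>)" by (simp add: powr_minus_divide)
    have LHS: "mean_on_powers k n f - exp (\<Sum>j | j \<in> {1..n} \<and> coprime j k. (fhat j - 1) / of_nat j)
                   * (\<Prod>j | j \<in> {1..n} \<and> gcd j k > 1.
                        (1 + (\<Sum>\<^sub>\<infinity>s\<in>{s. s \<ge> 1 \<and> q_part k j dvd s}.
                                fhat j ^ s / (of_nat j ^ s * fact s)))
                        / (1 + (\<Sum>\<^sub>\<infinity>s\<in>{s. s \<ge> 1 \<and> q_part k j dvd s}.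
                                1 / (of_nat j ^ s * fact s)))) = T fhat / T one - E * (P fhat / P one)"
      unfolding mean Eexp prod ..
    show ?thesis
    proof (cases "n \<ge> n1")
      case True
      then have n2: "n \<ge> 2" "n \<ge> n0" by (auto simp: n1_def)
      define A where "A = real n powr (\<alpha> - 1)"
      have A: "A > 0" using n by (simp add: A_def)
      define b where "b = complex_of_real (ecoef (chi k) n)"
      have gen: "cmod (T x - exp (lpoly (d x) n 1) * b * P x) \<le>
         C * A * (((\<Sum>j=1..n. cmod (d x j) powr p) / real n) powr (1/p) + real n powr (- \<beta>))"
        if x: "\<forall>j\<in>{1..n}. cmod (x j) \<le> 1" for x
      proof -
        have "T x = (\<Sum>m\<le>n. ecoef (\<lambda>j. of_real (chi k j) + d x j) (n - m) * G x m)"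
          unfolding T_def
        proof (rule sum.cong)
          fix m
          have "ecoef (w x) (n - m) = ecoef (\<lambda>j. of_real (chi k j) + d x j) (n - m)"
            by (rule ecoef_cong) (auto simp: w_def d_def chi_def)
          then show "ecoef (w x) (n - m) * G x m = ecoef (\<lambda>j. of_real (chi k j) + d x j) (n - m) * G x m" by simp
        qed simp
        moreover have Gx0: "cmod (G x 0) \<le> 1" using GH[OF x, of 0] H0 by simp
        moreover have Gxm: "\<forall>m\<ge>1. cmod (G x m) \<le> CH / real m ^ 2" using GH[OF x] Hm order_trans by blast
        moreover have "\<forall>j\<ge>1. cmod (of_real (chi k j) + d x j) \<le> chi k j" using dn[OF x] by blast
        moreover have "\<forall>j>n. d x j = 0" by (simp add: d_def)
        ultimately show ?thesis
          using C(2)[OF n2(1), of "d x" "G x"] Gk1[of x]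
          unfolding A_def b_def P_def \<alpha>_def \<beta>_def by simp
      qed
      have ef: "cmod (T fhat - E * b * P fhat) \<le> C * A * (mu_dist k n p fhat + real n powr (- \<beta>))"
        using gen[OF fh] by (simp add: E_def mu)
      \<comment> \<open>For the constant 1 one has d = 0, so R(1) = 1 and only the error n powr (-
        \<beta>) remains.\<close>
      have e1: "cmod (T one - b * P one) \<le> C * A * real n powr (- \<beta>)"
      proof -
        have "d one = (\<lambda>_. 0)" by (rule ext) (simp add: d_def one_def)
        then show ?thesis using gen[OF bd1] by (simp add: lpoly_def)
      qed
      \<comment> \<open>All terms of \<open>T one\<close> are nonnegative, and the term m = 0 alone
        is the coefficient of B at n.\<close>
      have T1: "c * A \<le> cmod (T one)"
      proof -
        have wone: "ecoef (w one) l = of_real (ecoef (chi k) l)" for l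
        proof -
          have "ecoef (w one) l = ecoef (\<lambda>j. of_real (chi k j)) l"
            by (rule ecoef_cong) (simp add: w_def one_def chi_def)
          then show ?thesis by (simp add: ecoef_of_real)
        qed
        have "T one = of_real (\<Sum>m\<le>n. ecoef (chi k) (n - m) * H m)"
          by (simp add: T_def G1 wone)
        moreover have "ecoef (chi k) (n - 0) * H 0 \<le> (\<Sum>m\<le>n. ecoef (chi k) (n - m) * H m)"
          using Hnn ecoef_chi_nonneg by (intro member_le_sum) auto
        ultimately have "ecoef (chi k) n \<le> cmod (T one)" using H0 by (simp add: norm_of_real del: of_real_sum)
        then show ?thesis using c(2)[OF n2(2)] by (simp add: A_def \<alpha>_def)
      qed
      have "cmod (T fhat / T one - E * (P fhat / P one)) \<le>
          (C * A * (mu_dist k n p fhat + real n powr (- \<beta>)) + C * A * real n powr (- \<beta>)) / (c * A)"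
        by (rule norm_quotient_diff_le[OF ef e1 E1 PfP1 P1nz _ T1]) (use c A in simp)
      also have "\<dots> = C / c * (mu_dist k n p fhat + 2 * real n powr (- \<beta>))"
        using A c(1) by (simp add: field_simps)
      also have "\<dots> \<le> C / c * (2 * (mu_dist k n p fhat + real n powr (- \<beta>)))"
        using mu0 C(1) c(1) by (intro mult_left_mono) auto
      also have "\<dots> = 2 * C / c * (mu_dist k n p fhat + real n powr (- \<beta>))" by simp
      also have "\<dots> \<le> C' * (mu_dist k n p fhat + real n powr (- \<beta>))"
        using mu0 by (intro mult_right_mono) (auto simp: C'_def)
      finally show ?thesis unfolding LHS inv .
    next
      case False
      have T1: "T one \<noteq> 0" using card card_powers_pos[of k n] by auto
      \<comment> \<open>Trivial bound for small n: the mean of values of modulus at most 1.\<close>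
      have "cmod (T fhat / T one) \<le> 1"
      proof -
        have "cmod (\<Sum>\<sigma>\<in>sym_group_powers k n. \<Prod>C\<in>perm_cycles n \<sigma>. fhat (card C)) \<le> (\<Sum>\<sigma>\<in>sym_group_powers k n. 1)"
        proof (rule order_trans[OF norm_sum sum_mono])
          fix \<sigma> assume s: "\<sigma> \<in> sym_group_powers k n"
          have "cmod (\<Prod>C\<in>perm_cycles n \<sigma>. fhat (card C)) = (\<Prod>C\<in>perm_cycles n \<sigma>. cmod (fhat (card C)))"
            by (rule prod_norm[symmetric])
          also have "\<dots> \<le> (\<Prod>C\<in>perm_cycles n \<sigma>. 1)"
          proof (rule prod_mono, safe)
            fix D assume "D \<in> perm_cycles n \<sigma>"
            then obtain a where a: "a \<in> {1..n}" "D = orbit \<sigma> a" by (auto simp: perm_cycles_def)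
            have perm: "permutation \<sigma>" using permP[OF s] by (auto simp: permutation_permutes)
            have "D \<subseteq> {1..n}" using permutes_orbit_subset[OF permP[OF s] a(1)] a(2) by simp
            then have "card D \<le> n" using card_mono[of "{1..n}" D] by simp
            moreover have "card D > 0" using orbit_period(2)[OF perm] a by simp
            ultimately show "cmod (fhat (card D)) \<le> 1" using fh by simp
          qed simp
          finally show "cmod (\<Prod>C\<in>perm_cycles n \<sigma>. fhat (card C)) \<le> 1" by simp
        qed
        then have "cmod (fact n * T fhat) \<le> cmod (fact n * T one)"
          unfolding sumS card[symmetric] by simp
        then have "cmod (T fhat) \<le> cmod (T one)" by (simp add: norm_mult)
        then show ?thesis using T1 by (simp add: norm_divide)
      qed
      moreover have "cmod (E * (P fhat / P one)) \<le> 1 * 1"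
        unfolding norm_mult using E1 PfP1 P1nz by (intro mult_mono) (auto simp: norm_divide divide_le_eq_1)
      ultimately have "cmod (T fhat / T one - E * (P fhat / P one)) \<le> 2"
        using norm_triangle_ineq4[of "T fhat / T one" "E * (P fhat / P one)"] by linarith
      also have "2 \<le> 2 * real n1 powr \<beta> * real n powr (- \<beta>)"
      proof -
        have "real n powr \<beta> \<le> real n1 powr \<beta>" using False \<beta> by (intro powr_mono2) auto
        then have "real n powr \<beta> * real n powr (- \<beta>) \<le> real n1 powr \<beta> * real n powr (- \<beta>)"
          by (rule mult_right_mono) simp
        moreover have "real n powr \<beta> * real n powr (- \<beta>) = 1" using n by (simp flip: powr_add)
        ultimately show ?thesis by simp
      qed
      also have "\<dots> \<le> C' * (mu_dist k n p fhat + real n powr (- \<beta>))"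
        using mu0 C(1) c(1) by (intro mult_mono) (auto simp: C'_def)
      finally show ?thesis unfolding LHS inv .
    qed
  qed
  then show ?thesis unfolding \<beta>_def by blast
qed

end
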